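(* Let $m,n\in\mathbb{N}$. The mapping $$f\mapsto \tau f,\qquad \tau f(t):=\sum_{k=0}^\infty (Z_-^kf)(0)\,t^k,$$ is a linear bijection from the space of $\mathbb{C}^{m\times n}$-valued rational DA functions on $V(\Lambda)$ to the space of $\mathbb{C}^{m\times n}$-valued rational functions of the complex variable $t$ that have no poles in the set $$P(\Lambda)=\left\{t\in\mathbb{C}: t=0\text{ or }\tfrac1t\in S(\Lambda)\right\}.$$ Moreover, for any realization $f(z)=D+C(I-zA)^{-\odot}\odot(zB)$ of a rational DA function $f$ it holds that $$\tau f(t)=D+tC(I-tA)^{-1}B.$$
   Context: **Lattice.** $\Lambda$ is a rhombic lattice in the complex plane $\mathbb{C}$: a monohedral (all tiles congruent), edge-to-edge tessellation of $\mathbb{C}$ with rhombi of side length $1$. $V(\Lambda)$, $E(\Lambda)$, $F(\Lambda)$ denote its sets of vertices, edges and faces; $(a,b)\in E(\Lambda)$ means that $a,b\in V(\Lambda)$ are adjacent, and edges are taken in both orientations, so $(a,b)\in E(\Lambda)$ iff $(b,a)\in E(\Lambda)$. A path in $\Lambda$ from $a$ to $b$ is a finite sequence $(z_0,\dots,z_N)$ of vertices with $z_0=a$, $z_N=b$ and $z_{n-1},z_n$ adjacent for $n=1,\dots,N$; it is closed if $a=b$. Standing assumptions on $\Lambda$: (i) $0\in V(\Lambda)$; (ii) for every $z\in V(\Lambda)$ there are $N\in\mathbb{N}$ and a path $(z_0,\dots,z_N)$ with $z_0=z$, $z_n-z_{n-1}\neq\pm1$ for $n=1,\dots,N-1$,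 and $z_N-z_{N-1}=1$. **Discrete analyticity.** For $f:V(\Lambda)\to\mathbb{C}$ and a path $\gamma=(z_0,\dots,z_N)$, $\int_\gamma f\,\delta z=\sum_{n=1}^N\frac{f(z_{n-1})+f(z_n)}{2}(z_n-z_{n-1})$. $f$ is discrete analytic (DA) if $\int_\gamma f\,\delta z=0$ for every closed path $\gamma$; then $\int_a^b f\,\delta z$ denotes $\int_\gamma f\,\delta z$ for any path $\gamma$ from $a$ to $b$. $\mathcal{H}(\Lambda)$ is the complex vector space of DA functions. **Shift operators.** $Z_+:\mathcal{H}(\Lambda)\to\mathcal{H}(\Lambda)$ is $(Z_+f)(z)=\frac{f(0)-f(z)}{2}+\int_0^z f\,\delta z$. It is injective with range $\{g\in\mathcal{H}(\Lambda):g(0)=0\}$, so one may define $Z_-:\mathcal{H}(\Lambda)\to\mathcal{H}(\Lambda)$ by letting $Z_-f$ be the unique element of $\mathcal{H}(\Lambda)$ with $(Z_+Z_-f)(z)=f(z)-f(0)$. **The set $S(\Lambda)$.** $S(\Lambda)=\{t\in\mathbb{C}: t(1+b-a)=-2\text{ for some }(a,b)\in E(\Lambda)\}$. Standing assumption: no element of $S(\Lambda)$ is an eigenvalue of $Z_-$ on $\mathcal{H}(\Lambda)$. **DA polynomials.** $z^{(0)}=1$ and $z^{(n)}=Z_+z^{(n-1)}$ for $n\ge1$ (so $z^{(1)}=z$). DA polynomials are finite linear combinations of the functions $z^{(n)}$. **Matrix-valued functions.** $\mathcal{H}(\Lambda)^{m\times n}$ is the space of $\mathbb{C}^{m\times n}$-valued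 functions on $V(\Lambda)$ with DA entries; integrals and $Z_\pm$ act entrywise. $\mathbb{C}^{m\times n}$-valued DA polynomials are sums $\sum_{n=0}^N A_nz^{(n)}$ with matrix coefficients. For such a polynomial $p=\sum_{n=0}^N A_nz^{(n)}$ and DA matrix-valued functions $f,g$ of suitable sizes, the convolution product is $(p\odot f)(z)=\sum_{n=0}^N A_n(Z_+^nf)(z)$ and $(g\odot p)(z)=\sum_{n=0}^N(Z_+^ng)(z)A_n$. **Rational DA functions.** For $A\in\mathbb{C}^{\ell\times\ell}$ with spectrum $\sigma(A)$ satisfying $S(\Lambda)\cap\sigma(A)=\emptyset$, the DA polynomial $I-zA$ has a unique two-sided $\odot$-inverse in $\mathcal{H}(\Lambda)^{\ell\times\ell}$, denoted $(I-zA)^{-\odot}$. A matrix-valued DA function $f$ is called rational if it can be written as $f(z)=D+C(I-zA)^{-\odot}\odot(zB)$, i.e. $f(z)=D+C\big(Z_+(I-zA)^{-\odot}\big)(z)B$, with complex matrices $A,B,C,D$ of suitable dimensions and $S(\Lambda)\cap\sigma(A)=\emptyset$; such a representation is called a realization of $f$. The series $\tau f$ is identified with the rational function of $t$ whose Taylor series at $0$ it is. *)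

theory Defs
  imports
    "HOL-Analysis.Analysis"
    "HOL-Computational_Algebra.Computational_Algebra"
    "Jordan_Normal_Form.Spectral_Radius"
    "Jordan_Normal_Form.Gauss_Jordan_Elimination"
begin

section \<open>Rhombic lattices\<close>

text \<open>A lattice is represented by its set of faces (closed tiles).\<close>

definition unit_rhombus :: "complex set \<Rightarrow> bool" where
  "unit_rhombus T \<longleftrightarrow>
     (\<exists>p u v. norm u = 1 \<and> norm v = 1 \<and> \<not> collinear {0, u, v} \<and>
              T = convex hull {p, p + u, p + u + v, p + v})"

definition congruent_sets :: "complex set \<Rightarrow> complex set \<Rightarrow> bool" where
  "congruent_sets T T' \<longleftrightarrow> (\<exists>g. (\<forall>x y. dist (g x) (g y) = dist x y) \<and> g ` T = T')"

text \<open>In the last conjunct the common face is empty, a common vertex or a common edge: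
  it cannot be a whole tile, because distinct tiles have disjoint interiors.\<close>

definition rhombic_lattice :: "complex set set \<Rightarrow> bool" where
  "rhombic_lattice \<Lambda> \<longleftrightarrow>
     (\<forall>T\<in>\<Lambda>. unit_rhombus T) \<and>
     (\<forall>T\<in>\<Lambda>. \<forall>T'\<in>\<Lambda>. congruent_sets T T') \<and>
     \<Union>\<Lambda> = UNIV \<and>
     (\<forall>T\<in>\<Lambda>. \<forall>T'\<in>\<Lambda>. T \<noteq> T' \<longrightarrow> interior T \<inter> interior T' = {}) \<and>
     (\<forall>T\<in>\<Lambda>. \<forall>T'\<in>\<Lambda>. T \<noteq> T' \<longrightarrow> (T \<inter> T') face_of T \<and> (T \<inter> T') face_of T')"

definition verts :: "complex set set \<Rightarrow> complex set" where
  "verts \<Lambda> = {z. \<exists>T\<in>\<Lambda>. z extreme_point_of T}"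

definition edges :: "complex set set \<Rightarrow> (complex \<times> complex) set" where
  "edges \<Lambda> = {(a, b). \<exists>T\<in>\<Lambda>. closed_segment a b edge_of T}"

definition lattice_path :: "complex set set \<Rightarrow> complex list \<Rightarrow> bool" where
  "lattice_path \<Lambda> \<gamma> \<longleftrightarrow> \<gamma> \<noteq> [] \<and> set \<gamma> \<subseteq> verts \<Lambda> \<and>
     (\<forall>n. Suc n < length \<gamma> \<longrightarrow> (\<gamma> ! n, \<gamma> ! Suc n) \<in> edges \<Lambda>)"

definition unit_step_reachable :: "complex set set \<Rightarrow> bool" where
  "unit_step_reachable \<Lambda> \<longleftrightarrow>
     (\<forall>z\<in>verts \<Lambda>. \<exists>N \<gamma>. N \<ge> 1 \<and> length \<gamma> = Suc N \<and> lattice_path \<Lambda> \<gamma> \<and> \<gamma> ! 0 = z \<and>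
        (\<forall>n\<in>{1..N - 1}. \<gamma> ! n - \<gamma> ! (n - 1) \<notin> {1, -1}) \<and> \<gamma> ! N - \<gamma> ! (N - 1) = 1)"


section \<open>Discrete analytic functions and shift operators\<close>

text \<open>Functions on the vertex set are represented by functions on \<^typ>\<open>complex\<close> that are
  \<^const>\<open>extensional\<close> there, so that equality is equality on the vertices.\<close>

definition path_integral :: "(complex \<Rightarrow> complex) \<Rightarrow> complex list \<Rightarrow> complex" where
  "path_integral f \<gamma> =
     (\<Sum>n = 1..length \<gamma> - 1. (f (\<gamma> ! (n - 1)) + f (\<gamma> ! n)) / 2 * (\<gamma> ! n - \<gamma> ! (n - 1)))"

definition DA :: "complex set set \<Rightarrow> (complex \<Rightarrow> complex) set" where
  "DA \<Lambda> = {f \<in> extensional (verts \<Lambda>).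
             \<forall>\<gamma>. lattice_path \<Lambda> \<gamma> \<and> hd \<gamma> = last \<gamma> \<longrightarrow> path_integral f \<gamma> = 0}"

definition integral_between ::
    "complex set set \<Rightarrow> complex \<Rightarrow> complex \<Rightarrow> (complex \<Rightarrow> complex) \<Rightarrow> complex" where
  "integral_between \<Lambda> a b f =
     path_integral f (SOME \<gamma>. lattice_path \<Lambda> \<gamma> \<and> hd \<gamma> = a \<and> last \<gamma> = b)"

definition Z_plus :: "complex set set \<Rightarrow> (complex \<Rightarrow> complex) \<Rightarrow> (complex \<Rightarrow> complex)" where
  "Z_plus \<Lambda> f = (\<lambda>z\<in>verts \<Lambda>. (f 0 - f z) / 2 + integral_between \<Lambda> 0 z f)"

definition Z_minus :: "complex set set \<Rightarrow> (complex \<Rightarrow> complex) \<Rightarrow> (complex \<Rightarrow> complex)" where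
  "Z_minus \<Lambda> f = (THE g. g \<in> DA \<Lambda> \<and> (\<forall>z\<in>verts \<Lambda>. Z_plus \<Lambda> g z = f z - f 0))"

definition S_set :: "complex set set \<Rightarrow> complex set" where
  "S_set \<Lambda> = {t. \<exists>(a, b)\<in>edges \<Lambda>. t * (1 + b - a) = -2}"

definition Z_minus_eigenvalue :: "complex set set \<Rightarrow> complex \<Rightarrow> bool" where
  "Z_minus_eigenvalue \<Lambda> t \<longleftrightarrow>
     (\<exists>f\<in>DA \<Lambda>. (\<exists>z\<in>verts \<Lambda>. f z \<noteq> 0) \<and> (\<forall>z\<in>verts \<Lambda>. Z_minus \<Lambda> f z = t * f z))"


section \<open>Matrix-valued functions and the convolution product\<close>

definition DA_mat :: "complex set set \<Rightarrow> nat \<Rightarrow> nat \<Rightarrow> (complex \<Rightarrow> complex mat) set" where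
  "DA_mat \<Lambda> m n = {f \<in> verts \<Lambda> \<rightarrow>\<^sub>E carrier_mat m n.
                    \<forall>i<m. \<forall>j<n. (\<lambda>z\<in>verts \<Lambda>. f z $$ (i, j)) \<in> DA \<Lambda>}"

definition entrywise :: "complex set set \<Rightarrow> ((complex \<Rightarrow> complex) \<Rightarrow> (complex \<Rightarrow> complex)) \<Rightarrow>
    (complex \<Rightarrow> complex mat) \<Rightarrow> (complex \<Rightarrow> complex mat)" where
  "entrywise \<Lambda> Op f = (\<lambda>z\<in>verts \<Lambda>. Matrix.mat (dim_row (f z)) (dim_col (f z))
     (\<lambda>(i, j). Op (\<lambda>w\<in>verts \<Lambda>. f w $$ (i, j)) z))"

abbreviation Z_plus_mat where "Z_plus_mat \<Lambda> \<equiv> entrywise \<Lambda> (Z_plus \<Lambda>)"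

abbreviation Z_minus_mat where "Z_minus_mat \<Lambda> \<equiv> entrywise \<Lambda> (Z_minus \<Lambda>)"

text \<open>A matrix-valued DA polynomial $\sum_{k=0}^N A_k z^{(k)}$ is given by its nonempty list of
  coefficients $A_0, \dots, A_N$. The two functions below are $p \odot f$ and $g \odot p$.
  The matrix sum is taken entry by entry, since matrices of unspecified dimension form no monoid.\<close>

definition conv_poly_left :: "complex set set \<Rightarrow> complex mat list \<Rightarrow>
    (complex \<Rightarrow> complex mat) \<Rightarrow> (complex \<Rightarrow> complex mat)" where
  "conv_poly_left \<Lambda> p f = (\<lambda>z\<in>verts \<Lambda>. Matrix.mat (dim_row (hd p)) (dim_col (f z))
     (\<lambda>ij. \<Sum>k<length p. (p ! k * (Z_plus_mat \<Lambda> ^^ k) f z) $$ ij))"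

definition conv_poly_right :: "complex set set \<Rightarrow> (complex \<Rightarrow> complex mat) \<Rightarrow>
    complex mat list \<Rightarrow> (complex \<Rightarrow> complex mat)" where
  "conv_poly_right \<Lambda> g p = (\<lambda>z\<in>verts \<Lambda>. Matrix.mat (dim_row (g z)) (dim_col (hd p))
     (\<lambda>ij. \<Sum>k<length p. ((Z_plus_mat \<Lambda> ^^ k) g z * p ! k) $$ ij))"

text \<open>The two-sided $\odot$-inverse of $I - zA$ for an \<open>l\<close> by \<open>l\<close> matrix \<open>A\<close>.\<close>

definition resolvent_DA :: "complex set set \<Rightarrow> nat \<Rightarrow> complex mat \<Rightarrow> (complex \<Rightarrow> complex mat)" where
  "resolvent_DA \<Lambda> l A = (THE X. X \<in> DA_mat \<Lambda> l l \<and>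
     conv_poly_left \<Lambda> [1\<^sub>m l, - A] X = (\<lambda>z\<in>verts \<Lambda>. 1\<^sub>m l) \<and>
     conv_poly_right \<Lambda> X [1\<^sub>m l, - A] = (\<lambda>z\<in>verts \<Lambda>. 1\<^sub>m l))"


section \<open>Rational DA functions\<close>

definition realization :: "complex set set \<Rightarrow> nat \<Rightarrow> nat \<Rightarrow> nat \<Rightarrow>
    complex mat \<Rightarrow> complex mat \<Rightarrow> complex mat \<Rightarrow> complex mat \<Rightarrow>
    (complex \<Rightarrow> complex mat) \<Rightarrow> bool" where
  "realization \<Lambda> m n l A B C D f \<longleftrightarrow>
     A \<in> carrier_mat l l \<and> B \<in> carrier_mat l n \<and> C \<in> carrier_mat m l \<and> D \<in> carrier_mat m n \<and>
     S_set \<Lambda> \<inter> spectrum A = {} \<and>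
     f = (\<lambda>z\<in>verts \<Lambda>. D + C * conv_poly_right \<Lambda> (resolvent_DA \<Lambda> l A) [0\<^sub>m l n, B] z)"

definition rational_DA :: "complex set set \<Rightarrow> nat \<Rightarrow> nat \<Rightarrow> (complex \<Rightarrow> complex mat) set" where
  "rational_DA \<Lambda> m n = {f \<in> DA_mat \<Lambda> m n. \<exists>l A B C D. realization \<Lambda> m n l A B C D f}"


section \<open>Matrix-valued rational functions of a complex variable\<close>

text \<open>Rational functions are elements of the field \<^typ>\<open>complex poly fract\<close>. Such an element has no
  pole at \<open>t\<close> iff it is a fraction whose denominator does not vanish at \<open>t\<close>; its value at \<open>t\<close> is
  then independent of the choice of that fraction.\<close>

definition no_pole_at :: "complex poly fract \<Rightarrow> complex \<Rightarrow> bool" where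
  "no_pole_at r t \<longleftrightarrow> (\<exists>p q. poly q t \<noteq> 0 \<and> r = Fraction_Field.Fract p q)"

definition rat_eval :: "complex poly fract \<Rightarrow> complex \<Rightarrow> complex" where
  "rat_eval r t =
     (THE v. \<exists>p q. poly q t \<noteq> 0 \<and> r = Fraction_Field.Fract p q \<and> v = poly p t / poly q t)"

definition const_fract :: "complex \<Rightarrow> complex poly fract" where
  "const_fract c = Fraction_Field.Fract [:c:] 1"

definition mat_no_pole_at :: "complex poly fract mat \<Rightarrow> complex \<Rightarrow> bool" where
  "mat_no_pole_at M t \<longleftrightarrow> (\<forall>i<dim_row M. \<forall>j<dim_col M. no_pole_at (M $$ (i, j)) t)"

definition mat_eval :: "complex poly fract mat \<Rightarrow> complex \<Rightarrow> complex mat" where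
  "mat_eval M t = map_mat (\<lambda>r. rat_eval r t) M"

definition rational_mats :: "nat \<Rightarrow> nat \<Rightarrow> complex set \<Rightarrow> complex poly fract mat set" where
  "rational_mats m n P = {M \<in> carrier_mat m n. \<forall>t\<in>P. mat_no_pole_at M t}"

definition P_set :: "complex set set \<Rightarrow> complex set" where
  "P_set \<Lambda> = {t. t = 0 \<or> 1 / t \<in> S_set \<Lambda>}"

definition has_Taylor_series_at_0 ::
    "complex poly fract mat \<Rightarrow> (nat \<Rightarrow> complex mat) \<Rightarrow> bool" where
  "has_Taylor_series_at_0 M s \<longleftrightarrow> mat_no_pole_at M 0 \<and>
     (\<forall>i<dim_row M. \<forall>j<dim_col M.
        rat_eval (M $$ (i, j)) has_fps_expansion Abs_fps (\<lambda>k. s k $$ (i, j)))"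

definition tau :: "complex set set \<Rightarrow> nat \<Rightarrow> nat \<Rightarrow>
    (complex \<Rightarrow> complex mat) \<Rightarrow> complex poly fract mat" where
  "tau \<Lambda> m n f = (THE M. M \<in> carrier_mat m n \<and>
     has_Taylor_series_at_0 M (\<lambda>k. (Z_minus_mat \<Lambda> ^^ k) f 0))"

end

theory Submission
  imports Defs
begin


text \<open>
  Let \<open>f\<close> have the realization \<open>A, B, C, D\<close>, and let \<open>X\<close> be the two-sided inverse of \<open>I - zA\<close>. Along an
  edge from \<open>a\<close> to \<open>b\<close> with \<open>w = b - a\<close> the equation \<open>X - Z\<^sub>+(X) A = I\<close> reads
  \<open>X(b) (2 + (1 - w) A) = X(a) (2 + (1 + w) A)\<close>. No eigenvalue of \<open>A\<close> lies in \<open>S(\<Lambda>)\<close>, so both factors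
  are invertible and \<open>X(z) = p\<^sub>z(A)\<close> for polynomials \<open>p\<^sub>z\<close> that satisfy \<open>p\<^sub>0 = 1\<close> and the
  same edge relation modulo the characteristic polynomial of \<open>A\<close>. The argument works with these
  polynomials. For a complex sequence \<open>a\<close> write \<open>lin a\<close> for the linear functional on polynomials
  that sends the \<open>k\<close>-th power of the indeterminate to \<open>a k\<close>. If \<open>a\<close> satisfies the linear recurrence
  with characteristic polynomial \<open>\<mu>\<close>, where \<open>\<mu>\<close> has no root in \<open>S(\<Lambda>)\<close>, then \<open>lin a\<close> vanishes on the
  multiples of \<open>\<mu>\<close>, and \<open>phi a z = lin a p\<^sub>z\<close> is well defined. It is discrete analytic, its value
  at \<open>0\<close> is \<open>a 0\<close>, and \<open>Z\<^sub>-\<close> maps it to \<open>phi\<close> of the shifted sequence (lemmas \<open>phi_DA\<close>, \<open>phi_zero\<close>,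
  \<open>Z_minus_phi\<close>). By Cayley--Hamilton every entry of \<open>f\<close> is \<open>D\<^sub>i\<^sub>j + Z\<^sub>+(phi a)\<close> with
  \<open>a k = (C A^k B)\<^sub>i\<^sub>j\<close>, so the Taylor coefficients of \<open>\<tau> f\<close> are \<open>D, CB, CAB, CA^2B, \<dots>\<close>.

  Injectivity: \<open>phi a\<close> depends on the sequence \<open>a\<close> only, not on \<open>\<mu>\<close> (\<open>phi_eq\<close>). Surjectivity: the
  Taylor coefficients of a rational function without poles in \<open>P(\<Lambda>)\<close> satisfy such a recurrence, and
  a block companion matrix realizes any matrix of sequences with a common recurrence
  (\<open>companion_realization\<close>). The formula for \<open>\<tau> f(t)\<close> comes from one identity in commutative rings
  (\<open>telescoped_recurrence\<close>): used with formal power series it gives the Taylor series of the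
  candidate quotient of polynomials, used with complex numbers it gives its value.

  The existence of the \<open>p\<^sub>z\<close>, and the fact that discrete analyticity is a condition on single rhombi,
  are both instances of a monodromy principle (\<open>transport_along_edges\<close>): bijections attached to the
  edges whose composition around every rhombus is the identity admit a global solution. It is proved
  for covers of the plane by convex tiles in which every point has a neighbourhood that meets only
  tiles containing the point; local solutions on small rectangles are glued to larger rectangles.

  Of the statement that \<open>Z\<^sub>-\<close> is well defined only uniqueness is needed, because the required preimages
  under \<open>Z\<^sub>+\<close> are exhibited.
\<close>

section \<open>Rhombic tiles\<close>


(* The bullet denotes the inner product on the plane below, not the product of coordinate vectors. *)
no_notation scalar_prod (infix "\<bullet>" 70)

text \<open>The edge vectors of a unit rhombus.\<close>

definition rhomb :: "complex \<Rightarrow> complex \<Rightarrow> bool" where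
  "rhomb u v \<longleftrightarrow> norm u = 1 \<and> norm v = 1 \<and> \<not> collinear {0, u, v}"

text \<open>The closed parallelogram with corner \<open>p\<close> and edge vectors \<open>u\<close> and \<open>v\<close>.\<close>

definition tile :: "complex \<Rightarrow> complex \<Rightarrow> complex \<Rightarrow> complex set" where
  "tile p u v = convex hull {p, p + u, p + u + v, p + v}"

lemma unit_rhombus_iff_tile: "unit_rhombus T \<longleftrightarrow> (\<exists>p u v. rhomb u v \<and> T = tile p u v)"
  unfolding unit_rhombus_def rhomb_def tile_def by blast

lemma rhomb_swap: "rhomb u v \<Longrightarrow> rhomb v u"
  unfolding rhomb_def by (simp add: insert_commute)

lemma tile_swap: "tile p v u = tile p u v"
  unfolding tile_def by (simp add: insert_commute add.commute add.left_commute)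

lemma rhomb_flip:
  assumes "rhomb u v" shows "rhomb u (- v)"
proof -
  have "v = (- c) *\<^sub>R u" if "- v = c *\<^sub>R u" for c
    using that by (metis scaleR_minus_left minus_minus)
  thus ?thesis using assms unfolding rhomb_def collinear_lemma
    by (metis neg_equal_0_iff_equal norm_minus_cancel)
qed

lemma tile_flip: "tile (p + v) u (- v) = tile p u v"
  unfolding tile_def by (simp add: insert_commute add_ac)

text \<open>A linear functional that separates the two directions; it serves as a coordinate on the tile.\<close>

lemma rhomb_dual:
  assumes "rhomb u v"
  obtains a where "a \<bullet> u = 0" "a \<bullet> v = 1"
proof -
  define c where "c = (\<i> * u) \<bullet> v"
  have c: "c \<noteq> 0"
  proof
    assume "c = 0"
    hence c0: "Re u * Im v = Im u * Re v" by (simp add: c_def inner_complex_def algebra_simps)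
    have "(Re u)\<^sup>2 + (Im u)\<^sup>2 = 1" using assms unfolding rhomb_def norm_complex_def by simp
    hence *: "Re u * Re u + Im u * Im u = 1" by (simp add: power2_eq_square)
    have "v = (u \<bullet> v) *\<^sub>R u"
    proof (rule complex_eqI)
      have "(u \<bullet> v) * Re u = Re v * (Re u * Re u) + Im u * (Re u * Im v)"
        by (simp add: inner_complex_def algebra_simps)
      also have "\<dots> = Re v * (Re u * Re u + Im u * Im u)"
        unfolding c0 by (simp add: algebra_simps)
      finally show "Re v = Re ((u \<bullet> v) *\<^sub>R u)" using * by simp
      have "(u \<bullet> v) * Im u = Im v * (Im u * Im u) + Re u * (Im u * Re v)"
        by (simp add: inner_complex_def algebra_simps)
      also have "\<dots> = Im v * (Re u * Re u + Im u * Im u)"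
        unfolding c0[symmetric] by (simp add: algebra_simps)
      finally show "Im v = Im ((u \<bullet> v) *\<^sub>R u)" using * by simp
    qed
    thus False using assms unfolding rhomb_def collinear_lemma by blast
  qed
  show thesis
  proof (rule that[of "(\<i> * u) /\<^sub>R c"])
    show "((\<i> * u) /\<^sub>R c) \<bullet> u = 0" by (simp add: inner_complex_def)
    show "((\<i> * u) /\<^sub>R c) \<bullet> v = 1" using c by (simp add: c_def)
  qed
qed

lemma rhomb_nonzero: "rhomb u v \<Longrightarrow> u \<noteq> 0 \<and> v \<noteq> 0"
  unfolding rhomb_def by auto

lemma compact_tile: "compact (tile p u v)"
  unfolding tile_def by (rule compact_convex_hull[OF finite_imp_compact]) simp

lemma convex_tile: "convex (tile p u v)"
  unfolding tile_def by (rule convex_convex_hull)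

lemma corners_in_tile: "{p, p + u, p + u + v, p + v} \<subseteq> tile p u v"
  unfolding tile_def by (rule hull_subset)

lemma tile_bound: 
  assumes "rhomb u v" "x \<in> tile p u v" shows "dist p x \<le> 2"
proof -
  have "tile p u v \<subseteq> cball p 2" unfolding tile_def
  proof (rule hull_minimal)
    have "norm (u + v) \<le> 2" using norm_triangle_ineq[of u v] assms(1) unfolding rhomb_def by simp
    moreover have "dist p (p + w) = norm w" for w by (simp add: dist_norm)
    ultimately show "{p, p + u, p + u + v, p + v} \<subseteq> cball p 2"
      using assms(1) unfolding rhomb_def by (simp add: add.assoc)
  qed (rule convex_cball)
  thus ?thesis using assms by auto
qed

lemma side_face_of_tile:
  assumes "rhomb u v"
  shows "closed_segment p (p + u) face_of tile p u v"
proof -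
  obtain a where a: "a \<bullet> u = 0" "a \<bullet> v = 1" using rhomb_dual[OF assms] .
  let ?S = "{p, p + u, p + u + v, p + v}"
  have ge: "tile p u v \<subseteq> {x. a \<bullet> x \<ge> a \<bullet> p}" unfolding tile_def
    by (rule hull_minimal) (auto simp: inner_add_right a convex_halfspace_ge)
  have face: "tile p u v \<inter> {x. a \<bullet> x = a \<bullet> p} face_of tile p u v" (is "?F face_of _")
    by (rule face_of_Int_supporting_hyperplane_ge) (use ge convex_tile in auto)
  have "compact ?S" by (intro finite_imp_compact) auto
  then obtain S' where S': "S' \<subseteq> ?S" "?F = convex hull S'"
    using face_of_convex_hull_subset[OF _ face[unfolded tile_def]] unfolding tile_def by metis
  have "S' \<subseteq> {x. a \<bullet> x = a \<bullet> p}" using S'(2) hull_subset[of S' convex] by auto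
  hence "S' \<subseteq> {p, p + u}" using S'(1) a by (fastforce simp: inner_add_right)
  hence "?F \<subseteq> closed_segment p (p + u)"
    unfolding S'(2) segment_convex_hull by (rule hull_mono)
  moreover have "closed_segment p (p + u) \<subseteq> ?F"
  proof -
    have "convex ?F" using face face_of_imp_convex by blast
    moreover have "p \<in> ?F" "p + u \<in> ?F" using corners_in_tile[of p u v] a by (auto simp: inner_add_right)
    ultimately show ?thesis by (rule_tac closed_segment_subset) auto
  qed
  ultimately show ?thesis using face by auto
qed

text \<open>The four sides, oriented in the directions \<open>u\<close> and \<open>v\<close>.\<close>

definition sides :: "complex \<Rightarrow> complex \<Rightarrow> complex \<Rightarrow> (complex \<times> complex) set" where
  "sides p u v = {(p, p + u), (p + u, p + u + v), (p + v, p + u + v), (p, p + v)}"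

lemma sides_face_of_tile:
  assumes "rhomb u v" "(a, b) \<in> sides p u v"
  shows "closed_segment a b face_of tile p u v"
proof -
  have 1: "closed_segment p (p + v) face_of tile p u v"
    using side_face_of_tile[OF rhomb_swap[OF assms(1)], of p]
    by (simp only: tile_swap[of p v u])
  have 2: "closed_segment (p + v) (p + u + v) face_of tile p u v"
    using side_face_of_tile[OF rhomb_flip[OF assms(1)], of "p + v"]
    by (simp only: tile_flip add.assoc add.commute[of v u])
  have 3: "closed_segment (p + u) (p + u + v) face_of tile p u v"
    using side_face_of_tile[OF rhomb_flip[OF rhomb_swap[OF assms(1)]], of "p + u"]
    by (simp only: tile_flip tile_swap[of p v u])
  show ?thesis using assms 1 2 3 side_face_of_tile[OF assms(1), of p]
    unfolding sides_def by auto
qed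

lemma extreme_point_of_tile:
  assumes "rhomb u v"
  shows "x extreme_point_of tile p u v \<longleftrightarrow> x \<in> {p, p + u, p + u + v, p + v}"
proof
  show "x extreme_point_of tile p u v \<Longrightarrow> x \<in> {p, p + u, p + u + v, p + v}"
    unfolding tile_def by (rule extreme_point_of_convex_hull)
  have "a extreme_point_of tile p u v" "b extreme_point_of tile p u v" if "(a, b) \<in> sides p u v" for a b
    using extreme_point_of_face[OF sides_face_of_tile[OF assms that]] extreme_point_of_segment by blast+
  thus "x \<in> {p, p + u, p + u + v, p + v} \<Longrightarrow> x extreme_point_of tile p u v"
    unfolding sides_def by blast
qed

lemma diagonal_not_face:
  assumes "rhomb u v"
  shows "\<not> closed_segment p (p + u + v) face_of tile p u v"
proof
  assume f: "closed_segment p (p + u + v) face_of tile p u v"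
  have u: "p + u \<noteq> p + v" using assms unfolding rhomb_def by auto
  \<comment> \<open>The two diagonals bisect each other, so a face containing one contains the other.\<close>
  have "midpoint (p + u) (p + v) \<in> open_segment (p + u) (p + v)" using u by simp
  moreover have "midpoint (p + u) (p + v) = midpoint p (p + u + v)" by (simp add: midpoint_def add_ac)
  hence "midpoint (p + u) (p + v) \<in> closed_segment p (p + u + v)" by simp
  ultimately have "p + u \<in> closed_segment p (p + u + v)"
    using face_ofD[OF f] corners_in_tile[of p u v] by blast
  moreover have "closed_segment p (p + u + v) = (+) p ` closed_segment 0 (u + v)"
    using closed_segment_translation[of p 0 "u + v"] by (simp add: add_ac)
  ultimately have "u \<in> closed_segment 0 (u + v)" by auto
  then obtain r where r: "u = r *\<^sub>R (u + v)" unfolding closed_segment_def by auto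
  obtain a where a: "a \<bullet> u = 0" "a \<bullet> v = 1" using rhomb_dual[OF assms] .
  have "a \<bullet> u = r * (a \<bullet> u + a \<bullet> v)" using r by (metis inner_add_right inner_scaleR_right)
  hence "r = 0" using a by simp
  thus False using r rhomb_nonzero[OF assms] by simp
qed

lemma edge_of_tile:
  assumes "rhomb u v"
  shows "closed_segment a b edge_of tile p u v \<longleftrightarrow> (a, b) \<in> sides p u v \<or> (b, a) \<in> sides p u v"
    (is "?L \<longleftrightarrow> ?R")
proof
  assume ?L
  hence f: "closed_segment a b face_of tile p u v" and d: "aff_dim (closed_segment a b) = 1"
    unfolding edge_of_def by auto
  have ne: "a \<noteq> b" using d by auto
  have "a extreme_point_of tile p u v" "b extreme_point_of tile p u v"
    using extreme_point_of_face[OF f] extreme_point_of_segment by blast+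
  hence ab: "a \<in> {p, p + u, p + u + v, p + v}" "b \<in> {p, p + u, p + u + v, p + v}"
    using extreme_point_of_tile[OF assms] by auto
  have "\<not> closed_segment (p + v) (p + u) face_of tile p u v"
    using diagonal_not_face[OF rhomb_flip[OF assms], of "p + v"] unfolding tile_flip by (simp add: add.commute)
  hence "(a, b) \<noteq> (p, p + u + v)" "(b, a) \<noteq> (p, p + u + v)" "(a, b) \<noteq> (p + v, p + u)" "(b, a) \<noteq> (p + v, p + u)"
    using f f[unfolded closed_segment_commute[of a b]] diagonal_not_face[OF assms, of p] by blast+
  moreover have "a = p \<or> a = p + u \<or> a = p + u + v \<or> a = p + v" "b = p \<or> b = p + u \<or> b = p + u + v \<or> b = p + v"
    using ab by simp_all
  ultimately show ?R using ne unfolding sides_def by (elim disjE) (simp_all only: insert_iff simp_thms prod.inject)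
next
  assume ?R
  hence f: "closed_segment a b face_of tile p u v"
    using sides_face_of_tile[OF assms] closed_segment_commute by metis
  have "a \<noteq> b" using \<open>?R\<close> rhomb_nonzero[OF assms] unfolding sides_def by auto
  thus ?L using f unfolding edge_of_def segment_convex_hull by (simp add: aff_dim_convex_hull)
qed

lemma interior_tile_nonempty:
  assumes "rhomb u v" shows "interior (tile p u v) \<noteq> {}"
proof
  assume "interior (tile p u v) = {}"
  then obtain a b where ab: "a \<noteq> 0" "tile p u v \<subseteq> {x. a \<bullet> x = b}"
    using empty_interior_subset_hyperplane[OF convex_tile] by metis
  have "a \<bullet> p = b" "a \<bullet> (p + u) = b" "a \<bullet> (p + v) = b"
    using ab(2) corners_in_tile[of p u v] by blast+
  hence a0: "a \<bullet> u = 0" "a \<bullet> v = 0" by (simp_all add: inner_add_right)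
  obtain c where c: "c \<bullet> u = 0" "c \<bullet> v = 1" using rhomb_dual[OF assms] .
  obtain d where d: "d \<bullet> v = 0" "d \<bullet> u = 1" using rhomb_dual[OF rhomb_swap[OF assms]] .
  define D where "D = Re u * Im v - Im u * Re v"
  have "(c \<bullet> v) * (d \<bullet> u) - (c \<bullet> u) * (d \<bullet> v) = (Im c * Re d - Re c * Im d) * D"
    unfolding D_def by (simp add: inner_complex_def algebra_simps)
  hence D: "D \<noteq> 0" using c d by auto
  have "Re a * D = (a \<bullet> u) * Im v - (a \<bullet> v) * Im u" "Im a * D = (a \<bullet> v) * Re u - (a \<bullet> u) * Re v"
    unfolding D_def by (simp_all add: inner_complex_def algebra_simps)
  hence "Re a = 0" "Im a = 0" using D a0 by simp_all
  thus False using ab(1) by (simp add: complex_eq_iff)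
qed


section \<open>Flat transport over a locally finite cover of the plane\<close>

text \<open>A cover of the plane by convex sets together with a flat transport: \<open>trans T T'\<close> carries values at
  the tile \<open>T\<close> to values at \<open>T'\<close>. It matters only for tiles that meet, and it composes whenever three
  tiles have a common point.\<close>

locale flat_cover =
  fixes \<T> :: "complex set set" and trans :: "complex set \<Rightarrow> complex set \<Rightarrow> 'b \<Rightarrow> 'b"
  assumes covers: "\<And>x. \<exists>T\<in>\<T>. x \<in> T"
    and convex_tiles: "\<And>T. T \<in> \<T> \<Longrightarrow> convex T"
    and locally_near: "\<And>z. \<exists>r>0. \<forall>T\<in>\<T>. T \<inter> ball z r \<noteq> {} \<longrightarrow> z \<in> T"
    and trans_refl: "\<And>T y. T \<in> \<T> \<Longrightarrow> trans T T y = y"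
    and trans_trans: "\<And>T1 T2 T3 y. \<lbrakk>T1 \<in> \<T>; T2 \<in> \<T>; T3 \<in> \<T>; T1 \<inter> T2 \<inter> T3 \<noteq> {}\<rbrakk> \<Longrightarrow>
           trans T2 T3 (trans T1 T2 y) = trans T1 T3 y"
begin

text \<open>A family of values, one for each tile, is parallel over \<open>K\<close> if transport respects it for every two
  tiles that meet inside \<open>K\<close>.\<close>

definition parallel :: "complex set \<Rightarrow> (complex set \<Rightarrow> 'b) \<Rightarrow> bool" where
  "parallel K s \<longleftrightarrow> (\<forall>T\<in>\<T>. \<forall>T'\<in>\<T>. T \<inter> T' \<inter> K \<noteq> {} \<longrightarrow> s T' = trans T T' (s T))"

lemma parallel_mono: "parallel K s \<Longrightarrow> K' \<subseteq> K \<Longrightarrow> parallel K' s"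
  unfolding parallel_def by blast

lemma parallel_unique:
  assumes K: "connected K" and s: "parallel K s" "parallel K s'"
    and T0: "T0 \<in> \<T>" "T0 \<inter> K \<noteq> {}" "s T0 = s' T0" and T: "T \<in> \<T>" "T \<inter> K \<noteq> {}"
  shows "s T = s' T"
proof -
  \<comment> \<open>The set of points at which the two families agree is open and closed in \<open>K\<close>.\<close>
  define P where "P x \<longleftrightarrow> (\<forall>T\<in>\<T>. x \<in> T \<longrightarrow> s T = s' T)" for x
  have one: "P x" if "T \<in> \<T>" "x \<in> T" "x \<in> K" "s T = s' T" for T x
    unfolding P_def
  proof (intro ballI impI)
    fix T' assume "T' \<in> \<T>" "x \<in> T'"
    hence "s T' = trans T T' (s T)" "s' T' = trans T T' (s' T)"
      using s that unfolding parallel_def by blast+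
    thus "s T' = s' T'" using that by simp
  qed
  obtain a where a: "a \<in> T0" "a \<in> K" using T0 by blast
  obtain b where b: "b \<in> T" "b \<in> K" using T by blast
  have "P a = P b"
  proof (rule connected_local_const[OF K a(2) b(2)], intro ballI)
    fix x assume x: "x \<in> K"
    obtain r where r: "r > 0" "\<forall>T\<in>\<T>. T \<inter> ball x r \<noteq> {} \<longrightarrow> x \<in> T" using locally_near by blast
    have "P x = P y" if y: "y \<in> K" "dist y x < r" for y
    proof -
      obtain T1 where T1: "T1 \<in> \<T>" "y \<in> T1" using covers by blast
      have "y \<in> ball x r" using y by (simp add: dist_commute)
      hence "x \<in> T1" using r(2) T1 by blast
      thus ?thesis using one[OF T1(1)] T1 x y unfolding P_def by blast
    qed
    thus "\<forall>\<^sub>F y in at x within K. P x = P y"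
      unfolding eventually_at using r(1) by blast
  qed
  moreover have "P a" using one[OF T0(1) a T0(3)] .
  ultimately show ?thesis using b T unfolding P_def by blast
qed

text \<open>Every prescribed value at a tile meeting \<open>K\<close> extends to a parallel family over \<open>K\<close>.\<close>

definition extendable :: "complex set \<Rightarrow> bool" where
  "extendable K \<longleftrightarrow> (\<forall>T0\<in>\<T>. T0 \<inter> K \<noteq> {} \<longrightarrow> (\<forall>y. \<exists>s. parallel K s \<and> s T0 = y))"

lemma extendable_small:
  assumes r: "\<forall>T\<in>\<T>. T \<inter> ball z r \<noteq> {} \<longrightarrow> z \<in> T" and K: "K \<subseteq> ball z r"
  shows "extendable K"
  unfolding extendable_def
proof (intro ballI impI allI)
  fix T0 y assume T0: "T0 \<in> \<T>" "T0 \<inter> K \<noteq> {}"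
  have z: "z \<in> T" if "T \<in> \<T>" "T \<inter> K \<noteq> {}" for T using that r K by blast
  have "parallel K (\<lambda>T. trans T0 T y)"
    unfolding parallel_def
  proof (intro ballI impI)
    fix T T' assume T: "T \<in> \<T>" "T' \<in> \<T>" "T \<inter> T' \<inter> K \<noteq> {}"
    hence "T0 \<inter> T \<inter> T' \<noteq> {}" using z T0 by blast
    thus "trans T0 T' y = trans T T' (trans T0 T y)"
      using trans_trans[OF T0(1) T(1,2)] by auto
  qed
  thus "\<exists>s. parallel K s \<and> s T0 = y" using trans_refl[OF T0(1)] by blast
qed

text \<open>Gluing: a family over \<open>K1\<close> and a family over \<open>K2\<close> that agree at one tile meeting the connected
  set \<open>K1 \<inter> K2\<close> agree at all of them, and by \<open>cross\<close> these are all tiles that meet both sets.\<close>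

lemma extendable_Un:
  assumes K: "extendable K1" "extendable K2" and conn: "connected (K1 \<inter> K2)" "K1 \<inter> K2 \<noteq> {}"
    and cross: "\<And>T. \<lbrakk>T \<in> \<T>; T \<inter> K1 \<noteq> {}; T \<inter> K2 \<noteq> {}\<rbrakk> \<Longrightarrow> T \<inter> (K1 \<inter> K2) \<noteq> {}"
  shows "extendable (K1 \<union> K2)"
proof -
  obtain c T1 where c: "c \<in> K1 \<inter> K2" and T1: "T1 \<in> \<T>" "c \<in> T1" using conn(2) covers by blast
  have *: "\<exists>s. parallel (A \<union> B) s \<and> s T0 = y"
    if A: "extendable A" "extendable B" "A \<inter> B = K1 \<inter> K2"
      "\<And>T. \<lbrakk>T \<in> \<T>; T \<inter> A \<noteq> {}; T \<inter> B \<noteq> {}\<rbrakk> \<Longrightarrow> T \<inter> (A \<inter> B) \<noteq> {}"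
      and T0: "T0 \<in> \<T>" "T0 \<inter> A \<noteq> {}" for A B T0 y
  proof -
    obtain s1 where s1: "parallel A s1" "s1 T0 = y" using A(1) T0 unfolding extendable_def by blast
    have "T1 \<inter> B \<noteq> {}" using T1 c A(3) by blast
    then obtain s2 where s2: "parallel B s2" "s2 T1 = s1 T1" using A(2) T1 unfolding extendable_def by blast
    have eq: "s1 T = s2 T" if "T \<in> \<T>" "T \<inter> A \<noteq> {}" "T \<inter> B \<noteq> {}" for T
    proof (rule parallel_unique[where K = "A \<inter> B"])
      show "connected (A \<inter> B)" using conn A(3) by simp
      show "parallel (A \<inter> B) s1" "parallel (A \<inter> B) s2" using s1 s2 parallel_mono by blast+
      show "T1 \<inter> (A \<inter> B) \<noteq> {}" using T1 c A(3) by blast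
      show "T \<inter> (A \<inter> B) \<noteq> {}" by (rule A(4)) fact+
    qed (use T1 s2 that in auto)
    define s where "s T = (if T \<inter> A \<noteq> {} then s1 T else s2 T)" for T
    have sA: "s T = s1 T" if "T \<inter> A \<noteq> {}" for T using that by (simp add: s_def)
    have sB: "s T = s2 T" if "T \<in> \<T>" "T \<inter> B \<noteq> {}" for T using that eq by (simp add: s_def)
    have "parallel (A \<union> B) s"
      unfolding parallel_def
    proof (intro ballI impI)
      fix T T' assume T: "T \<in> \<T>" "T' \<in> \<T>" "T \<inter> T' \<inter> (A \<union> B) \<noteq> {}"
      then consider "T \<inter> T' \<inter> A \<noteq> {}" | "T \<inter> T' \<inter> B \<noteq> {}" by blast
      thus "s T' = trans T T' (s T)"
      proof cases
        case 1
        hence "s T = s1 T" "s T' = s1 T'" using sA by blast+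
        thus ?thesis using s1 T 1 unfolding parallel_def by simp
      next
        case 2
        hence "s T = s2 T" "s T' = s2 T'" using sB T by blast+
        thus ?thesis using s2 T 2 unfolding parallel_def by simp
      qed
    qed
    thus ?thesis using s1(2) sA[OF T0(2)] by auto
  qed
  show ?thesis
    unfolding extendable_def
  proof (intro ballI impI allI)
    fix T0 y assume T0: "T0 \<in> \<T>" "T0 \<inter> (K1 \<union> K2) \<noteq> {}"
    then consider "T0 \<inter> K1 \<noteq> {}" | "T0 \<inter> K2 \<noteq> {}" by blast
    thus "\<exists>s. parallel (K1 \<union> K2) s \<and> s T0 = y"
    proof cases
      case 1
      show ?thesis by (rule *[OF K _ _ T0(1) 1]) (use cross in auto)
    next
      case 2
      have "\<exists>s. parallel (K2 \<union> K1) s \<and> s T0 = y"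
        by (rule *[OF K(2,1) _ _ T0(1) 2]) (use cross in \<open>auto simp: Int_commute\<close>)
      thus ?thesis by (simp add: Un_commute)
    qed
  qed
qed

definition rectangle :: "real \<Rightarrow> real \<Rightarrow> real \<Rightarrow> real \<Rightarrow> complex set" where
  "rectangle a b c d = {z. a \<le> Re z \<and> Re z \<le> b \<and> c \<le> Im z \<and> Im z \<le> d}"

lemma convex_rectangle: "convex (rectangle a b c d)"
proof -
  have "rectangle a b c d = cbox (Complex a c) (Complex b d)"
    unfolding rectangle_def by (auto simp: in_cbox_complex_iff)
  thus ?thesis using convex_box by metis
qed

text \<open>Gluing along a line; a convex tile that meets both sides of the line inside \<open>R\<close> meets the line inside \<open>R\<close>.\<close>

lemma extendable_split:
  assumes e: "extendable (R \<inter> {z. w \<bullet> z \<le> b})" "extendable (R \<inter> {z. w \<bullet> z \<ge> b})"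
    and R: "convex R" and ne: "\<exists>z\<in>R. w \<bullet> z = b"
  shows "extendable R"
proof -
  have i: "R \<inter> {z. w \<bullet> z \<le> b} \<inter> (R \<inter> {z. w \<bullet> z \<ge> b}) = R \<inter> {z. w \<bullet> z = b}"
    and u: "R \<inter> {z. w \<bullet> z \<le> b} \<union> (R \<inter> {z. w \<bullet> z \<ge> b}) = R" by auto
  have "extendable (R \<inter> {z. w \<bullet> z \<le> b} \<union> (R \<inter> {z. w \<bullet> z \<ge> b}))"
  proof (rule extendable_Un[OF e])
    show "connected (R \<inter> {z. w \<bullet> z \<le> b} \<inter> (R \<inter> {z. w \<bullet> z \<ge> b}))"
      unfolding i using R convex_hyperplane convex_Int convex_connected by blast
    show "R \<inter> {z. w \<bullet> z \<le> b} \<inter> (R \<inter> {z. w \<bullet> z \<ge> b}) \<noteq> {}" unfolding i using ne by auto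
    fix T assume T: "T \<in> \<T>" "T \<inter> (R \<inter> {z. w \<bullet> z \<le> b}) \<noteq> {}" "T \<inter> (R \<inter> {z. w \<bullet> z \<ge> b}) \<noteq> {}"
    then obtain x y where "x \<in> T \<inter> R" "y \<in> T \<inter> R" "w \<bullet> x \<le> b" "b \<le> w \<bullet> y" by blast
    moreover have "connected (T \<inter> R)" using T(1) R convex_tiles convex_Int convex_connected by blast
    ultimately have "\<exists>z\<in>T \<inter> R. w \<bullet> z = b" using connected_ivt_hyperplane by metis
    thus "T \<inter> (R \<inter> {z. w \<bullet> z \<le> b} \<inter> (R \<inter> {z. w \<bullet> z \<ge> b})) \<noteq> {}" unfolding i by blast
  qed
  thus ?thesis unfolding u .
qed

text \<open>Subdivision in both coordinates. The inner application of Bolzano's principle glues small squares to a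
  thin vertical strip, the outer one glues strips.\<close>

lemma extendable_rectangle:
  assumes "a \<le> b" "c \<le> d" shows "extendable (rectangle a b c d)"
  using assms(1)
proof (induction rule: Bolzano)
  case (trans a b b')
  have "rectangle a b' c d \<inter> {z. 1 \<bullet> z \<le> b} = rectangle a b c d"
       "rectangle a b' c d \<inter> {z. 1 \<bullet> z \<ge> b} = rectangle b b' c d"
    using trans(3,4) unfolding rectangle_def by (auto simp: inner_complex_def)
  moreover have "\<exists>z\<in>rectangle a b' c d. 1 \<bullet> z = b"
    by (rule bexI[of _ "Complex b c"])
      (use trans(3,4) assms(2) in \<open>auto simp: rectangle_def inner_complex_def\<close>)
  ultimately show ?case using extendable_split[of "rectangle a b' c d" 1 b] trans(1,2) convex_rectangle by simp
next
  case (local x)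
  have "\<exists>e>0. \<forall>a b. a \<le> x \<and> x \<le> b \<and> b - a < e \<longrightarrow> extendable (rectangle a b c d)"
    using assms(2)
  proof (induction rule: Bolzano)
    case (trans c d d')
    obtain e1 where e1: "e1 > 0" "\<forall>a b. a \<le> x \<and> x \<le> b \<and> b - a < e1 \<longrightarrow> extendable (rectangle a b c d)"
      using trans(1) by blast
    obtain e2 where e2: "e2 > 0" "\<forall>a b. a \<le> x \<and> x \<le> b \<and> b - a < e2 \<longrightarrow> extendable (rectangle a b d d')"
      using trans(2) by blast
    show ?case
    proof (intro exI[of _ "min e1 e2"] conjI allI impI)
      fix a b assume ab: "a \<le> x \<and> x \<le> b \<and> b - a < min e1 e2"
      have "rectangle a b c d' \<inter> {z. \<i> \<bullet> z \<le> d} = rectangle a b c d"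
           "rectangle a b c d' \<inter> {z. \<i> \<bullet> z \<ge> d} = rectangle a b d d'"
        using trans(3,4) unfolding rectangle_def by (auto simp: inner_complex_def)
      moreover have "\<exists>z\<in>rectangle a b c d'. \<i> \<bullet> z = d"
        by (rule bexI[of _ "Complex a d"])
          (use trans(3,4) ab in \<open>auto simp: rectangle_def inner_complex_def\<close>)
      ultimately show "extendable (rectangle a b c d')"
        using extendable_split[of "rectangle a b c d'" \<i> d] e1(2) e2(2) ab convex_rectangle by simp
    qed (use e1 e2 in auto)
  next
    case (local y)
    obtain r where r: "r > 0" "\<forall>T\<in>\<T>. T \<inter> ball (Complex x y) r \<noteq> {} \<longrightarrow> Complex x y \<in> T"
      using locally_near by blast
    have "extendable (rectangle a b c d)"
      if "a \<le> x" "x \<le> b" "b - a < r / 2" "c \<le> y" "y \<le> d" "d - c < r / 2" for a b c d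
    proof (rule extendable_small[OF r(2)], rule subsetI)
      fix z assume "z \<in> rectangle a b c d"
      hence "a \<le> Re z" "Re z \<le> b" "c \<le> Im z" "Im z \<le> d" unfolding rectangle_def by auto
      hence "\<bar>Re (z - Complex x y)\<bar> < r / 2" "\<bar>Im (z - Complex x y)\<bar> < r / 2"
        using that unfolding minus_complex.sel complex.sel by arith+
      hence "norm (z - Complex x y) < r" using cmod_le[of "z - Complex x y"] by linarith
      thus "z \<in> ball (Complex x y) r" by (simp add: dist_norm norm_minus_commute)
    qed
    thus ?case using r(1) by (intro exI[of _ "r / 2"]) (auto intro!: exI[of _ "r / 2"])
  qed
  thus ?case .
qed

lemma global_parallel:
  assumes T0: "T0 \<in> \<T>" "0 \<in> T0"
  obtains s where "parallel UNIV s" "s T0 = y"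
proof -
  \<comment> \<open>The families over an exhaustion by squares are compatible, because all take the value \<open>y\<close> at \<open>T0\<close>.\<close>
  define B where "B n = rectangle (- real n) (real n) (- real n) (real n)" for n
  have B0: "T0 \<inter> B n \<noteq> {}" for n using T0 by (auto simp: B_def rectangle_def)
  have "\<exists>s. parallel (B n) s \<and> s T0 = y" for n
    using extendable_rectangle[of "- real n" "real n" "- real n" "real n"] T0 B0
    unfolding extendable_def B_def by simp
  then obtain \<sigma> where \<sigma>: "\<And>n. parallel (B n) (\<sigma> n)" "\<And>n. \<sigma> n T0 = y" by metis
  have Bmono: "B m \<subseteq> B n" if "m \<le> n" for m n using that unfolding B_def rectangle_def by auto
  have conn: "connected (B n)" for n unfolding B_def using convex_rectangle convex_connected by blast
  have eq: "\<sigma> m T = \<sigma> n T" if "T \<in> \<T>" "T \<inter> B m \<noteq> {}" "m \<le> n" for m n T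
    by (rule parallel_unique[OF conn \<sigma>(1) parallel_mono[OF \<sigma>(1) Bmono[OF that(3)]] T0(1) B0 _ that(1,2)])
       (simp add: \<sigma>(2))
  have ex: "\<exists>n. x \<in> B n" for x
  proof -
    obtain n where "norm x \<le> real n" using real_arch_simple by blast
    hence "\<bar>Re x\<bar> \<le> real n" "\<bar>Im x\<bar> \<le> real n"
      using abs_Re_le_cmod[of x] abs_Im_le_cmod[of x] by linarith+
    thus ?thesis unfolding B_def rectangle_def by (intro exI[of _ n]) auto
  qed
  define s where "s T = \<sigma> (LEAST n. T \<inter> B n \<noteq> {}) T" for T
  have s: "s T = \<sigma> n T" if "T \<in> \<T>" "T \<inter> B n \<noteq> {}" for T n
  proof -
    have "T \<inter> B (LEAST n. T \<inter> B n \<noteq> {}) \<noteq> {}" by (rule LeastI, rule that(2))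
    moreover have "(LEAST n. T \<inter> B n \<noteq> {}) \<le> n" by (rule Least_le, rule that(2))
    ultimately show ?thesis unfolding s_def by (rule eq[OF that(1)])
  qed
  have "parallel UNIV s"
    unfolding parallel_def
  proof (intro ballI impI)
    fix T T' assume T: "T \<in> \<T>" "T' \<in> \<T>" "T \<inter> T' \<inter> UNIV \<noteq> {}"
    then obtain x n where "x \<in> T \<inter> T'" "x \<in> B n" using ex by blast
    hence n: "T \<inter> B n \<noteq> {}" "T' \<inter> B n \<noteq> {}" "T \<inter> T' \<inter> B n \<noteq> {}" by blast+
    have "\<sigma> n T' = trans T T' (\<sigma> n T)"
      using \<sigma>(1)[of n] T n(3) unfolding parallel_def by blast
    thus "s T' = trans T T' (s T)" unfolding s[OF T(1) n(1)] s[OF T(2) n(2)] .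
  qed
  moreover have "s T0 = y" using s[OF T0(1) B0] \<sigma>(2) by simp
  ultimately show thesis using that by blast
qed

end


section \<open>Local finiteness, vertices and edges of a rhombic tiling\<close>

lemma isometry_image_ball:
  fixes g :: "complex \<Rightarrow> complex"
  assumes "\<forall>x y. dist (g x) (g y) = dist x y"
  shows "g ` ball c r = ball (g c) r"
proof -
  define h where "h x = g x - g 0" for x
  have "orthogonal_transformation h"
    unfolding orthogonal_transformation_isometry h_def using assms by (simp add: dist_norm)
  hence "surj h" using orthogonal_transformation_bij bij_is_surj by blast
  have "surj g"
    unfolding surj_def
  proof
    fix y
    obtain x where "h x = y - g 0" using \<open>surj h\<close> by (metis surjD)
    hence "y = g x" unfolding h_def by simp
    thus "\<exists>x. y = g x" ..
  qed
  show ?thesis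
  proof (intro equalityI subsetI)
    fix y assume y: "y \<in> ball (g c) r"
    obtain x where x: "y = g x" using \<open>surj g\<close> by (metis surjD)
    hence "dist c x < r" using y assms by simp
    thus "y \<in> g ` ball c r" using x by simp
  qed (use assms in auto)
qed

lemma finite_separated_bounded:
  fixes C :: "complex set"
  assumes "bounded C" "d > 0" "\<And>x y. x \<in> C \<Longrightarrow> y \<in> C \<Longrightarrow> x \<noteq> y \<Longrightarrow> d \<le> dist x y"
  shows "finite C"
proof (rule ccontr)
  assume "infinite C"
  then obtain l where "l islimpt C" using assms(1) bounded_infinite_imp_islimpt by blast
  hence inf: "infinite (C \<inter> ball l (d / 2))" using assms(2) islimpt_eq_infinite_ball[of l C] by simp
  then obtain x where x: "x \<in> C \<inter> ball l (d / 2)" by (metis finite.emptyI ex_in_conv)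
  have "infinite (C \<inter> ball l (d / 2) - {x})" using inf by simp
  then obtain y where y: "y \<in> C \<inter> ball l (d / 2) - {x}" by (metis finite.emptyI ex_in_conv)
  have "dist x y < d"
    using x y dist_triangle_half_r[of l x d y] by auto
  thus False using assms(3)[of x y] x y by force
qed

locale rhombic_tiling =
  fixes \<Lambda> :: "complex set set"
  assumes lattice: "rhombic_lattice \<Lambda>"
begin

lemmas lattice_conjuncts = lattice[unfolded rhombic_lattice_def]

lemmas unit_rhombus_face = lattice_conjuncts[THEN conjunct1, rule_format]
  and congruent = lattice_conjuncts[THEN conjunct2, THEN conjunct1, rule_format]
  and Union_faces = lattice_conjuncts[THEN conjunct2, THEN conjunct2, THEN conjunct1]
  and disjoint_interiors =
    lattice_conjuncts[THEN conjunct2, THEN conjunct2, THEN conjunct2, THEN conjunct1, rule_format]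
  and faces_meet_in_face =
    lattice_conjuncts[THEN conjunct2, THEN conjunct2, THEN conjunct2, THEN conjunct2, rule_format,
      THEN conjunct1]

lemma tileE:
  assumes "T \<in> \<Lambda>" obtains p u v where "rhomb u v" "T = tile p u v"
  using unit_rhombus_face[OF assms] unfolding unit_rhombus_iff_tile by blast

lemma covered: "\<exists>T\<in>\<Lambda>. x \<in> T"
  using Union_faces by blast

lemma compact_face: "T \<in> \<Lambda> \<Longrightarrow> compact T"
  by (erule tileE) (simp add: compact_tile)

lemma convex_face: "T \<in> \<Lambda> \<Longrightarrow> convex T"
  by (erule tileE) (simp add: convex_tile)

lemma common_face:
  assumes "T \<in> \<Lambda>" "T' \<in> \<Lambda>" shows "(T \<inter> T') face_of T"
proof (cases "T = T'")
  case True
  thus ?thesis using face_of_refl[OF convex_face[OF assms(1)]] by simp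
next
  case False
  thus ?thesis using faces_meet_in_face[OF assms] by blast
qed

text \<open>The radius is the same for all tiles because the tiles are congruent.\<close>

lemma interior_balls:
  obtains d where "d > 0" "\<And>T. T \<in> \<Lambda> \<Longrightarrow> \<exists>c. ball c d \<subseteq> interior T"
proof -
  obtain T0 where T0: "T0 \<in> \<Lambda>" using covered by blast
  then obtain p u v where "rhomb u v" "T0 = tile p u v" by (rule tileE)
  hence "interior T0 \<noteq> {}" using interior_tile_nonempty by simp
  then obtain c where "c \<in> interior T0" by blast
  then obtain d where d: "d > 0" "ball c d \<subseteq> interior T0"
    using open_interior open_contains_ball by blast
  have "\<exists>c. ball c d \<subseteq> interior T" if "T \<in> \<Lambda>" for T
  proof -
    have "congruent_sets T0 T" using T0 that by (rule congruent)
    then obtain g where g: "\<forall>x y. dist (g x) (g y) = dist x y" "g ` T0 = T"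
      unfolding congruent_sets_def by blast
    have "ball (g c) d \<subseteq> T"
      using isometry_image_ball[OF g(1), of c d] d(2) interior_subset[of T0] g(2) by blast
    thus ?thesis using interior_maximal[OF _ open_ball] by blast
  qed
  thus thesis using that d(1) by blast
qed

text \<open>Balls inscribed in distinct tiles are disjoint, so their centres cannot accumulate.\<close>

lemma finite_faces_near: "finite {T\<in>\<Lambda>. T \<inter> cball z 1 \<noteq> {}}"
proof -
  let ?N = "{T\<in>\<Lambda>. T \<inter> cball z 1 \<noteq> {}}"
  obtain d where d: "d > 0" "\<And>T. T \<in> \<Lambda> \<Longrightarrow> \<exists>c. ball c d \<subseteq> interior T" using interior_balls by blast
  then obtain c where c: "\<And>T. T \<in> \<Lambda> \<Longrightarrow> ball (c T) d \<subseteq> interior T" by metis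
  have sep: "d \<le> dist (c T) (c T')" if "T \<in> \<Lambda>" "T' \<in> \<Lambda>" "T \<noteq> T'" for T T'
  proof (rule ccontr)
    assume "\<not> d \<le> dist (c T) (c T')"
    hence "c T' \<in> ball (c T) d" by simp
    moreover have "c T' \<in> ball (c T') d" using d(1) by simp
    ultimately show False using disjoint_interiors[OF that] c that by blast
  qed
  have inj: "inj_on c ?N"
  proof (rule inj_onI, rule ccontr)
    fix T T' assume "T \<in> ?N" "T' \<in> ?N" "c T = c T'" "T \<noteq> T'"
    thus False using sep[of T T'] d(1) by simp
  qed
  have "c T \<in> cball z 5" if near: "T \<in> ?N" for T
  proof -
    from near have T: "T \<in> \<Lambda>" by simp
    obtain x where x: "x \<in> T" "dist z x \<le> 1" using near by auto
    obtain p u v where puv: "rhomb u v" "T = tile p u v" using T by (rule tileE)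
    have "c T \<in> ball (c T) d" using d(1) by simp
    hence "c T \<in> T" using c[OF T] interior_subset by blast
    hence "dist p (c T) \<le> 2" "dist p x \<le> 2" using tile_bound[OF puv(1)] x puv(2) by blast+
    thus ?thesis using x(2) dist_triangle[of z "c T" x] dist_triangle[of x "c T" p]
      by (simp add: dist_commute)
  qed
  hence "c ` ?N \<subseteq> cball z 5" by blast
  hence "bounded (c ` ?N)" using bounded_cball bounded_subset by blast
  hence "finite (c ` ?N)"
    by (rule finite_separated_bounded[OF _ d(1)]) (use sep in blast)
  thus ?thesis using inj finite_image_iff by blast
qed

lemma locally_near: "\<exists>r>0. \<forall>T\<in>\<Lambda>. T \<inter> ball z r \<noteq> {} \<longrightarrow> z \<in> T"
proof -
  define F where "F = {T\<in>\<Lambda>. T \<inter> cball z 1 \<noteq> {}} \<inter> {T. z \<notin> T}"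
  have closed: "closed T" if "T \<in> F" for T
  proof -
    have "T \<in> \<Lambda>" using that unfolding F_def by simp
    thus ?thesis by (rule compact_imp_closed[OF compact_face])
  qed
  have "finite F" unfolding F_def using finite_faces_near[of z] by simp
  hence "closed (\<Union>F)" using closed by (rule closed_Union[OF _ ballI])
  hence "open (- \<Union>F)" by (rule open_Compl)
  moreover have "z \<in> - \<Union>F" unfolding F_def by simp
  ultimately obtain e where e: "e > 0" "ball z e \<subseteq> - \<Union>F" by (rule openE)
  have "z \<in> T" if T: "T \<in> \<Lambda>" "T \<inter> ball z (min e 1) \<noteq> {}" for T
  proof (rule ccontr)
    assume z: "z \<notin> T"
    obtain x where x: "x \<in> T" "x \<in> ball z (min e 1)" using T(2) by blast
    have "x \<in> T \<inter> cball z 1" using x by simp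
    hence "T \<in> F" unfolding F_def using T(1) z by blast
    moreover have "x \<in> ball z e" using x(2) by simp
    ultimately show False using e(2) x(1) by blast
  qed
  moreover have "min e 1 > 0" using e(1) by simp
  ultimately show ?thesis by blast
qed

lemma common_vertex:
  assumes "T1 \<in> \<Lambda>" "T2 \<in> \<Lambda>" "T3 \<in> \<Lambda>" "T1 \<inter> T2 \<inter> T3 \<noteq> {}"
  obtains w where "w extreme_point_of T1" "w extreme_point_of T2" "w extreme_point_of T3"
proof -
  let ?F = "T1 \<inter> T2 \<inter> T3"
  have *: "(A \<inter> B \<inter> C) face_of A" if "A \<in> \<Lambda>" "B \<in> \<Lambda>" "C \<in> \<Lambda>" for A B C
    using face_of_Int[OF common_face[OF that(1,2)] common_face[OF that(1,3)]]
    by (simp add: Int_ac)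
  have f: "?F face_of T1" "?F face_of T2" "?F face_of T3"
    using *[OF assms(1-3)] *[OF assms(2,1,3)] *[OF assms(3,1,2)] by (simp_all add: Int_ac)
  have "compact ?F" using assms compact_face by (simp add: compact_Int)
  moreover have "convex ?F" using assms convex_face by (simp add: convex_Int)
  ultimately obtain w where "w extreme_point_of ?F" using extreme_point_exists_convex assms(4) by blast
  thus thesis using that extreme_point_of_face[OF f(1)] extreme_point_of_face[OF f(2)]
      extreme_point_of_face[OF f(3)] by blast
qed

text \<open>A diagonal is excluded: the common face would contain the crossing point of both diagonals and hence
  the whole tile, although distinct tiles have disjoint interiors.\<close>

lemma common_edge:
  assumes T: "T \<in> \<Lambda>" "T' \<in> \<Lambda>" "T \<noteq> T'"
    and w: "w extreme_point_of T" "w extreme_point_of T'" "w' extreme_point_of T" "w' extreme_point_of T'" "w \<noteq> w'"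
  shows "closed_segment w w' edge_of T"
proof -
  obtain p u v where puv: "rhomb u v" "T = tile p u v" using T(1) by (rule tileE)
  have f: "(T \<inter> T') face_of T" using T common_face by blast
  have F: "w \<in> T \<inter> T'" "w' \<in> T \<inter> T'" using w unfolding extreme_point_of_def by blast+
  have nd: False if corners: "q \<in> T \<inter> T'" "q + a + b \<in> T \<inter> T'" and q: "rhomb a b" "T = tile q a b" for q a b
  proof -
    have "q + a \<noteq> q + b" using q(1) unfolding rhomb_def by auto
    hence "midpoint (q + a) (q + b) \<in> open_segment (q + a) (q + b)" by simp
    moreover have "midpoint (q + a) (q + b) = midpoint q (q + a + b)" by (simp add: midpoint_def add_ac)
    moreover have "midpoint q (q + a + b) \<in> T \<inter> T'"
      using corners convex_Int[OF convex_face[OF T(1)] convex_face[OF T(2)]]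
      by (meson convex_contains_segment midpoint_in_closed_segment subsetD)
    ultimately have "q + a \<in> T \<inter> T'" "q + b \<in> T \<inter> T'"
      using face_ofD[OF f] corners_in_tile[of q a b] q(2) by (metis insert_subset)+
    hence "tile q a b \<subseteq> T \<inter> T'" unfolding tile_def
      using corners convex_Int[OF convex_face[OF T(1)] convex_face[OF T(2)]] by (intro hull_minimal) auto
    hence "interior T \<subseteq> interior T'" using q(2) by (intro interior_mono) blast
    moreover have "interior T \<noteq> {}" using interior_tile_nonempty q by simp
    ultimately show False using disjoint_interiors[OF T] by blast
  qed
  have "w = p \<or> w = p + u \<or> w = p + u + v \<or> w = p + v" "w' = p \<or> w' = p + u \<or> w' = p + u + v \<or> w' = p + v"
    using w puv extreme_point_of_tile[OF puv(1)] by simp_all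
  moreover have "(w, w') \<noteq> (p, p + u + v)" "(w', w) \<noteq> (p, p + u + v)"
    using nd[OF _ _ puv] F by blast+
  moreover have "(w, w') \<noteq> (p + v, p + u)" "(w', w) \<noteq> (p + v, p + u)"
    using nd[OF _ _ rhomb_flip[OF puv(1)], of "p + v"] F puv(2) unfolding tile_flip
    by (auto simp: add.commute)
  ultimately have "(w, w') \<in> sides p u v \<or> (w', w) \<in> sides p u v"
    using w(5) unfolding sides_def by (elim disjE) (simp_all only: insert_iff simp_thms prod.inject)
  thus ?thesis using edge_of_tile[OF puv(1)] puv(2) by simp
qed

lemma edges_iff: "(a, b) \<in> edges \<Lambda> \<longleftrightarrow> (\<exists>T\<in>\<Lambda>. closed_segment a b edge_of T)"
  unfolding edges_def by simp

lemma edges_sym: "(a, b) \<in> edges \<Lambda> \<Longrightarrow> (b, a) \<in> edges \<Lambda>"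
  unfolding edges_iff by (simp only: closed_segment_commute)

lemma side_edge: "\<lbrakk>rhomb u v; tile p u v \<in> \<Lambda>; (a, b) \<in> sides p u v\<rbrakk> \<Longrightarrow> (a, b) \<in> edges \<Lambda>"
  unfolding edges_iff using edge_of_tile by blast

lemma vertex_iff: "x \<in> verts \<Lambda> \<longleftrightarrow> (\<exists>T\<in>\<Lambda>. x extreme_point_of T)"
  unfolding verts_def by simp

lemma corner_vertex:
  assumes "rhomb u v" "tile p u v \<in> \<Lambda>" "x \<in> {p, p + u, p + u + v, p + v}"
  shows "x \<in> verts \<Lambda>"
  unfolding vertex_iff using assms(2,3) extreme_point_of_tile[OF assms(1)] by metis

lemma edge_vertices:
  assumes "(a, b) \<in> edges \<Lambda>" shows "a \<in> verts \<Lambda>" "b \<in> verts \<Lambda>"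
proof -
  obtain T where T: "T \<in> \<Lambda>" "closed_segment a b edge_of T" using assms unfolding edges_iff ..
  hence f: "closed_segment a b face_of T" unfolding edge_of_def by simp
  have "a extreme_point_of T" "b extreme_point_of T"
    using extreme_point_of_face[OF f, of a] extreme_point_of_face[OF f, of b]
      extreme_point_of_segment[of a a b] extreme_point_of_segment[of b a b] by simp_all
  thus "a \<in> verts \<Lambda>" "b \<in> verts \<Lambda>" unfolding vertex_iff using T(1) by metis+
qed

end


section \<open>Transport of values along edges\<close>

context rhombic_tiling begin

text \<open>On a single tile, solutions of the edge equations exist and are determined by their value at any
  corner: \<open>w x y\<close> is the value at the corner \<open>x\<close> of the solution with value \<open>y\<close> at a reference corner.\<close>

lemma face_section:
  fixes g :: "complex \<Rightarrow> complex \<Rightarrow> 'b \<Rightarrow> 'b"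
  assumes inverse: "\<And>a b y. (a, b) \<in> edges \<Lambda> \<Longrightarrow> g b a (g a b y) = y"
    and holonomy: "\<And>p u v y. \<lbrakk>rhomb u v; tile p u v \<in> \<Lambda>\<rbrakk> \<Longrightarrow>
      g (p + u) (p + u + v) (g p (p + u) y) = g (p + v) (p + u + v) (g p (p + v) y)"
    and T: "T \<in> \<Lambda>"
  shows "\<exists>w :: complex \<Rightarrow> 'b \<Rightarrow> 'b. (\<forall>x. x extreme_point_of T \<longrightarrow> bij (w x)) \<and>
    (\<forall>a b y. closed_segment a b edge_of T \<longrightarrow> w b y = g a b (w a y))"
proof -
  obtain p u v where puv: "rhomb u v" "T = tile p u v" using T by (rule tileE)
  have side: "(a, b) \<in> edges \<Lambda>" if "(a, b) \<in> sides p u v" for a b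
    using side_edge[OF puv(1) _ that] T puv(2) by simp
  have bij: "bij (g a b)" if "(a, b) \<in> sides p u v" for a b
    by (rule o_bij[of "g b a"]) (use inverse[OF side[OF that]] inverse[OF edges_sym[OF side[OF that]]] in auto)
  have ne: "u \<noteq> 0" "v \<noteq> 0" "u \<noteq> v" "u + v \<noteq> 0"
  proof -
    show "u \<noteq> 0" "v \<noteq> 0" using rhomb_nonzero[OF puv(1)] by auto
    obtain d where d: "d \<bullet> u = 0" "d \<bullet> v = 1" using rhomb_dual[OF puv(1)] .
    show "u \<noteq> v" using d by auto
    have "d \<bullet> (u + v) = 1" using d by (simp add: inner_add_right)
    thus "u + v \<noteq> 0" by auto
  qed
  define w where "w x y = (if x = p then y else if x = p + u then g p (p + u) y
     else if x = p + v then g p (p + v) y else g (p + u) (p + u + v) (g p (p + u) y))" for x y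
  have w: "w p = id" "w (p + u) = g p (p + u)" "w (p + v) = g p (p + v)"
      "w (p + u + v) = g (p + u) (p + u + v) \<circ> g p (p + u)"
    using ne by (auto simp: w_def fun_eq_iff add.assoc)
  have s: "(p, p + u) \<in> sides p u v" "(p + u, p + u + v) \<in> sides p u v" "(p + v, p + u + v) \<in> sides p u v" "(p, p + v) \<in> sides p u v"
    unfolding sides_def by simp_all
  have corner: "bij (w x)" if "x extreme_point_of T" for x
  proof -
    have "x = p \<or> x = p + u \<or> x = p + u + v \<or> x = p + v"
      using that extreme_point_of_tile[OF puv(1), of x p] puv(2) by simp
    thus ?thesis using bij[OF s(1)] bij[OF s(2)] bij[OF s(4)] by (elim disjE) (simp_all only: w bij_id bij_comp)
  qed
  have fwd: "w b y = g a b (w a y)" if "(a, b) \<in> sides p u v" for a b y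
  proof -
    have "(a, b) = (p, p + u) \<or> (a, b) = (p + u, p + u + v) \<or> (a, b) = (p + v, p + u + v) \<or> (a, b) = (p, p + v)"
      using that unfolding sides_def by simp
    thus ?thesis using holonomy[OF puv(1), of p y] T puv(2)
      by (elim disjE) (simp_all only: prod.inject w id_apply o_apply)
  qed
  have bwd: "w b y = g a b (w a y)" if "(b, a) \<in> sides p u v" for a b y
    unfolding fwd[OF that] inverse[OF side[OF that]] ..
  have edge: "w b y = g a b (w a y)" if "closed_segment a b edge_of T" for a b y
    using that edge_of_tile[OF puv(1)] fwd bwd unfolding puv(2) by blast
  show ?thesis by (intro exI[of _ w] conjI allI impI) (fact corner edge)+
qed

text \<open>Edge transports without holonomy around rhombi admit a global solution with any prescribed value at
  the origin.\<close>

lemma transport_along_edges: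
  fixes g :: "complex \<Rightarrow> complex \<Rightarrow> 'b \<Rightarrow> 'b"
  assumes inverse: "\<And>a b y. (a, b) \<in> edges \<Lambda> \<Longrightarrow> g b a (g a b y) = y"
    and holonomy: "\<And>p u v y. \<lbrakk>rhomb u v; tile p u v \<in> \<Lambda>\<rbrakk> \<Longrightarrow>
      g (p + u) (p + u + v) (g p (p + u) y) = g (p + v) (p + u + v) (g p (p + v) y)"
    and zero: "0 \<in> verts \<Lambda>"
  obtains s where "s 0 = y0" "\<And>a b. (a, b) \<in> edges \<Lambda> \<Longrightarrow> s b = g a b (s a)"
proof -
  have "\<forall>T\<in>\<Lambda>. \<exists>w :: complex \<Rightarrow> 'b \<Rightarrow> 'b. (\<forall>x. x extreme_point_of T \<longrightarrow> bij (w x)) \<and>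
    (\<forall>a b y. closed_segment a b edge_of T \<longrightarrow> w b y = g a b (w a y))"
    using face_section[of g, OF inverse holonomy] by blast
  then obtain w :: "complex set \<Rightarrow> complex \<Rightarrow> 'b \<Rightarrow> 'b" where w: "\<forall>T\<in>\<Lambda>. (\<forall>x. x extreme_point_of T \<longrightarrow> bij (w T x)) \<and>
    (\<forall>a b y. closed_segment a b edge_of T \<longrightarrow> w T b y = g a b (w T a y))"
    using bchoice by metis
  have bij: "bij (w T x)" if "T \<in> \<Lambda>" "x extreme_point_of T" for T x using w that by simp
  have edge: "w T b y = g a b (w T a y)" if "T \<in> \<Lambda>" "closed_segment a b edge_of T" for T a b y
    using w that by simp
  \<comment> \<open>\<open>tr T T' y\<close> labels the solution on \<open>T'\<close> that agrees, at the common vertices, with the one labelled \<open>y\<close> on \<open>T\<close>.\<close>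
  define tr where "tr T T' y = (SOME y'. \<forall>x. x extreme_point_of T \<and> x extreme_point_of T' \<longrightarrow> w T' x y' = w T x y)" for T T' y
  have tr: "w T' x (tr T T' y) = w T x y"
    if T: "T \<in> \<Lambda>" "T' \<in> \<Lambda>" and x: "x extreme_point_of T" "x extreme_point_of T'" for T T' x y
  proof -
    obtain y' where y': "w T' x y' = w T x y" using bij[OF T(2) x(2)] by (metis bij_pointE)
    have "w T' x' y' = w T x' y" if x': "x' extreme_point_of T" "x' extreme_point_of T'" for x'
    proof (cases "x' = x \<or> T = T'")
      case True
      have "y' = y" if "T = T'" using y' bij[OF T(2) x(2)] that by (simp add: bij_is_inj inj_eq)
      thus ?thesis using True y' by auto
    next
      case False
      hence "closed_segment x x' edge_of T" "closed_segment x x' edge_of T'"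
        using common_edge[OF T _ x x'] common_edge[OF T(2,1) _ x(2,1) x'(2,1)] by auto
      thus ?thesis using edge T y' by simp
    qed
    hence "\<exists>y'. \<forall>x. x extreme_point_of T \<and> x extreme_point_of T' \<longrightarrow> w T' x y' = w T x y" by blast
    from someI_ex[OF this] show ?thesis unfolding tr_def using x by simp
  qed
  have tr_trans: "tr T2 T3 (tr T1 T2 y) = tr T1 T3 y"
    if T: "T1 \<in> \<Lambda>" "T2 \<in> \<Lambda>" "T3 \<in> \<Lambda>" "T1 \<inter> T2 \<inter> T3 \<noteq> {}" for T1 T2 T3 y
  proof -
    obtain x where x: "x extreme_point_of T1" "x extreme_point_of T2" "x extreme_point_of T3"
      using common_vertex[OF T] .
    have "w T3 x (tr T2 T3 (tr T1 T2 y)) = w T3 x (tr T1 T3 y)"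
      using tr[OF T(2,3) x(2,3)] tr[OF T(1,2) x(1,2)] tr[OF T(1,3) x(1,3)] by simp
    thus ?thesis using bij[OF T(3) x(3)] by (simp add: bij_is_inj inj_eq)
  qed
  have nonempty: "T \<noteq> {}" if T: "T \<in> \<Lambda>" for T
  proof -
    obtain p u v where "T = tile p u v" using T by (rule tileE)
    thus ?thesis using corners_in_tile[of p u v] by blast
  qed
  have tr_refl: "tr T T y = y" if T: "T \<in> \<Lambda>" for T y
  proof -
    have "T \<inter> T \<inter> T \<noteq> {}" using nonempty[OF T] by simp
    then obtain x where x: "x extreme_point_of T" using common_vertex[OF T T T] by metis
    have "w T x (tr T T y) = w T x y" using tr[OF T T x x] .
    thus ?thesis using bij[OF T x] by (simp add: bij_is_inj inj_eq)
  qed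
  interpret flat_cover \<Lambda> tr
    by unfold_locales (fact covered convex_face locally_near tr_refl tr_trans)+
  obtain T0 where T0: "T0 \<in> \<Lambda>" "0 extreme_point_of T0" using zero unfolding vertex_iff by blast
  hence "0 \<in> T0" unfolding extreme_point_of_def by simp
  obtain z0 where z0: "w T0 0 z0 = y0" using bij[OF T0] by (metis bij_pointE)
  obtain \<sigma> where \<sigma>: "parallel UNIV \<sigma>" "\<sigma> T0 = z0" using global_parallel[OF T0(1) \<open>0 \<in> T0\<close>] .
  define s where "s x = w (SOME T. T \<in> \<Lambda> \<and> x extreme_point_of T) x (\<sigma> (SOME T. T \<in> \<Lambda> \<and> x extreme_point_of T))" for x
  have s: "s x = w T x (\<sigma> T)" if T: "T \<in> \<Lambda>" "x extreme_point_of T" for T x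
  proof -
    let ?T = "SOME T. T \<in> \<Lambda> \<and> x extreme_point_of T"
    have T': "?T \<in> \<Lambda> \<and> x extreme_point_of ?T" by (rule someI[of _ T]) (use T in simp)
    hence "x \<in> ?T \<inter> T" using T unfolding extreme_point_of_def by simp
    hence "\<sigma> T = tr ?T T (\<sigma> ?T)" using \<sigma>(1) T(1) T' unfolding parallel_def by blast
    hence "w T x (\<sigma> T) = w ?T x (\<sigma> ?T)" using tr T T' by simp
    thus ?thesis unfolding s_def by simp
  qed
  show thesis
  proof (rule that[of s])
    show "s 0 = y0" using s[OF T0] \<sigma>(2) z0 by simp
    fix a b assume ab: "(a, b) \<in> edges \<Lambda>"
    obtain T where T: "T \<in> \<Lambda>" "closed_segment a b edge_of T" using ab unfolding edges_iff ..
    hence f: "closed_segment a b face_of T" unfolding edge_of_def by simp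
    have "a extreme_point_of T" "b extreme_point_of T"
      using extreme_point_of_face[OF f, of a] extreme_point_of_face[OF f, of b]
        extreme_point_of_segment[of a a b] extreme_point_of_segment[of b a b] by simp_all
    thus "s b = g a b (s a)" using s[OF T(1)] edge[OF T] by simp
  qed
qed

text \<open>The edge graph is connected: the families \<open>s\<close> and constantly true are both parallel for the trivial
  transport.\<close>

lemma constant_along_edges:
  assumes edge: "\<And>a b. (a, b) \<in> edges \<Lambda> \<Longrightarrow> P a = P b" and z: "z \<in> verts \<Lambda>" "0 \<in> verts \<Lambda>"
  shows "P z = P 0"
proof -
  interpret flat_cover \<Lambda> "\<lambda>_ _ y. y"
    by unfold_locales (auto simp: covered convex_face locally_near)
  have face: "P x = P y" if T: "T \<in> \<Lambda>" and xy: "x extreme_point_of T" "y extreme_point_of T" for T x y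
  proof -
    obtain p u v where puv: "rhomb u v" "T = tile p u v" using T by (rule tileE)
    have "P a = P b" if "(a, b) \<in> sides p u v" for a b
      using edge[OF side_edge[OF puv(1) _ that]] T puv(2) by simp
    hence "P p = P (p + u)" "P (p + u) = P (p + u + v)" "P (p + v) = P (p + u + v)"
      unfolding sides_def by simp_all
    thus ?thesis using xy extreme_point_of_tile[OF puv(1)] puv(2) by auto
  qed
  define s where "s T = (\<exists>x. x extreme_point_of T \<and> P x = P 0)" for T
  have s: "s T \<longleftrightarrow> P x = P 0" if "T \<in> \<Lambda>" "x extreme_point_of T" for T x
    unfolding s_def using face[OF that(1)] that(2) by metis
  have "parallel UNIV s" unfolding parallel_def
  proof (intro ballI impI)
    fix T T' assume T: "T \<in> \<Lambda>" "T' \<in> \<Lambda>" "T \<inter> T' \<inter> UNIV \<noteq> {}"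
    hence "T \<inter> T' \<inter> T' \<noteq> {}" by blast
    then obtain x where "x extreme_point_of T" "x extreme_point_of T'"
      using common_vertex[OF T(1,2,2)] by metis
    thus "s T' = s T" using s T by simp
  qed
  moreover have "parallel UNIV (\<lambda>_. True)" unfolding parallel_def by simp
  moreover obtain T0 where T0: "T0 \<in> \<Lambda>" "0 extreme_point_of T0" using z(2) unfolding vertex_iff by blast
  moreover obtain T where T: "T \<in> \<Lambda>" "z extreme_point_of T" using z(1) unfolding vertex_iff by blast
  moreover have "T0 \<inter> UNIV \<noteq> {}" "T \<inter> UNIV \<noteq> {}" using T0 T unfolding extreme_point_of_def by blast+
  moreover have "s T0 = True" using s[OF T0] by simp
  ultimately have "s T = True"
    using parallel_unique[OF connected_UNIV, of s "\<lambda>_. True" T0 T] by blast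
  thus ?thesis using s[OF T] by simp
qed

end


section \<open>Discrete analyticity as a local condition\<close>

text \<open>The contribution of one edge to a discrete path integral.\<close>

definition step_sum :: "(complex \<Rightarrow> complex) \<Rightarrow> complex \<Rightarrow> complex \<Rightarrow> complex" where
  "step_sum f a b = (f a + f b) / 2 * (b - a)"

lemma path_integral_step_sum:
  "path_integral f \<gamma> = (\<Sum>n<length \<gamma> - 1. step_sum f (\<gamma> ! n) (\<gamma> ! Suc n))"
  unfolding path_integral_def step_sum_def
  by (rule sum.reindex_bij_witness[of _ Suc "\<lambda>n. n - 1"]) auto

lemma path_integral_primitive:
  assumes F: "\<And>a b. (a, b) \<in> edges \<Lambda> \<Longrightarrow> F b - F a = step_sum f a b" and \<gamma>: "lattice_path \<Lambda> \<gamma>"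
  shows "path_integral f \<gamma> = F (last \<gamma>) - F (hd \<gamma>)"
proof -
  have "path_integral f \<gamma> = (\<Sum>n<length \<gamma> - 1. F (\<gamma> ! Suc n) - F (\<gamma> ! n))"
    unfolding path_integral_step_sum
    by (rule sum.cong) (use \<gamma> F in \<open>auto simp: lattice_path_def\<close>)
  also have "\<dots> = F (\<gamma> ! (length \<gamma> - 1)) - F (\<gamma> ! 0)" by (rule sum_lessThan_telescope)
  finally show ?thesis using \<gamma> unfolding lattice_path_def by (simp add: last_conv_nth hd_conv_nth)
qed

text \<open>Twice the discrete integral around a rhombus; its vanishing is the discrete Cauchy--Riemann equation.\<close>

definition rhombus_defect :: "(complex \<Rightarrow> complex) \<Rightarrow> complex \<Rightarrow> complex \<Rightarrow> complex \<Rightarrow> complex" where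
  "rhombus_defect f p u v = (f p - f (p + u + v)) * (u - v) + (f (p + u) - f (p + v)) * (u + v)"

lemma step_sum_around_rhombus:
  "step_sum f p (p + u) + step_sum f (p + u) (p + u + v) - step_sum f (p + v) (p + u + v) - step_sum f p (p + v)
   = rhombus_defect f p u v / 2"
  unfolding step_sum_def rhombus_defect_def by (simp add: field_simps)

text \<open>A rhombic tiling that has the origin among its vertices.\<close>

locale rooted_rhombic_tiling = rhombic_tiling +
  assumes zero_vertex: "0 \<in> verts \<Lambda>"
begin

abbreviation V where "V \<equiv> verts \<Lambda>"

lemma DA_imp_rhombus:
  assumes f: "f \<in> DA \<Lambda>" and T: "rhomb u v" "tile p u v \<in> \<Lambda>"
  shows "rhombus_defect f p u v = 0"
proof -
  let ?g = "[p, p + u, p + u + v, p + v, p]"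
  have e: "(a, b) \<in> edges \<Lambda>" "(b, a) \<in> edges \<Lambda>" if "(a, b) \<in> sides p u v" for a b
    using side_edge[OF T that] edges_sym by blast+
  have "(p, p + u) \<in> edges \<Lambda>" "(p + u, p + u + v) \<in> edges \<Lambda>" "(p + u + v, p + v) \<in> edges \<Lambda>" "(p + v, p) \<in> edges \<Lambda>"
    using e unfolding sides_def by simp_all
  hence "lattice_path \<Lambda> ?g"
    unfolding lattice_path_def using corner_vertex[OF T] by (auto simp: less_Suc_eq nth_Cons')
  moreover have "hd ?g = last ?g" by simp
  ultimately have "path_integral f ?g = 0" using f unfolding DA_def by blast
  moreover have "path_integral f ?g = step_sum f p (p + u) + step_sum f (p + u) (p + u + v)
      + step_sum f (p + u + v) (p + v) + step_sum f (p + v) p"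
    unfolding path_integral_step_sum by (simp add: eval_nat_numeral lessThan_Suc)
  moreover have "step_sum f b a = - step_sum f a b" for a b
    unfolding step_sum_def by (simp add: field_simps)
  ultimately show ?thesis using step_sum_around_rhombus[of f p u v]
    by (metis (no_types, lifting) add_uminus_conv_diff divide_eq_0_iff zero_neq_numeral)
qed

lemma rhombus_imp_primitive:
  assumes "\<And>p u v. \<lbrakk>rhomb u v; tile p u v \<in> \<Lambda>\<rbrakk> \<Longrightarrow> rhombus_defect f p u v = 0"
  obtains F where "F 0 = 0" "\<And>a b. (a, b) \<in> edges \<Lambda> \<Longrightarrow> F b - F a = step_sum f a b"
proof -
  obtain F where F: "F 0 = 0" "\<And>a b. (a, b) \<in> edges \<Lambda> \<Longrightarrow> F b = F a + step_sum f a b"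
  proof (rule transport_along_edges[of "\<lambda>a b y. y + step_sum f a b" 0])
    show "y + step_sum f a b + step_sum f b a = y" for a b y
      unfolding step_sum_def by (simp add: field_simps)
    show "y + step_sum f p (p + u) + step_sum f (p + u) (p + u + v)
        = y + step_sum f p (p + v) + step_sum f (p + v) (p + u + v)"
      if "rhomb u v" "tile p u v \<in> \<Lambda>" for p u v y
      using assms[OF that] step_sum_around_rhombus[of f p u v] by (simp add: algebra_simps)
  qed (use zero_vertex in auto)
  thus thesis using that[of F] by simp
qed

lemma DA_iff:
  "f \<in> DA \<Lambda> \<longleftrightarrow> f \<in> extensional V \<and>
     (\<forall>p u v. rhomb u v \<longrightarrow> tile p u v \<in> \<Lambda> \<longrightarrow> rhombus_defect f p u v = 0)"
proof
  assume "f \<in> DA \<Lambda>"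
  thus "f \<in> extensional V \<and> (\<forall>p u v. rhomb u v \<longrightarrow> tile p u v \<in> \<Lambda> \<longrightarrow> rhombus_defect f p u v = 0)"
    using DA_imp_rhombus unfolding DA_def by blast
next
  assume "f \<in> extensional V \<and> (\<forall>p u v. rhomb u v \<longrightarrow> tile p u v \<in> \<Lambda> \<longrightarrow> rhombus_defect f p u v = 0)"
  hence ext: "f \<in> extensional V"
    and "\<forall>p u v. rhomb u v \<longrightarrow> tile p u v \<in> \<Lambda> \<longrightarrow> rhombus_defect f p u v = 0" by simp_all
  hence R: "rhombus_defect f p u v = 0" if "rhomb u v" "tile p u v \<in> \<Lambda>" for p u v
    using that by simp
  obtain F where F: "\<And>a b. (a, b) \<in> edges \<Lambda> \<Longrightarrow> F b - F a = step_sum f a b"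
    by (rule rhombus_imp_primitive[of f, OF R]) auto
  have "path_integral f \<gamma> = 0" if "lattice_path \<Lambda> \<gamma>" "hd \<gamma> = last \<gamma>" for \<gamma>
    using path_integral_primitive[OF _ that(1), of F f] F that(2) by simp
  thus "f \<in> DA \<Lambda>" using ext unfolding DA_def by simp
qed

lemma path_exists:
  assumes "z \<in> V" obtains \<gamma> where "lattice_path \<Lambda> \<gamma>" "hd \<gamma> = 0" "last \<gamma> = z"
proof -
  define P where "P z \<longleftrightarrow> (\<exists>\<gamma>. lattice_path \<Lambda> \<gamma> \<and> hd \<gamma> = 0 \<and> last \<gamma> = z)" for z
  have step: "P b" if ab: "(a, b) \<in> edges \<Lambda>" "P a" for a b
  proof -
    obtain \<gamma> where \<gamma>: "lattice_path \<Lambda> \<gamma>" "hd \<gamma> = 0" "last \<gamma> = a" using ab(2) unfolding P_def by blast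
    have ne: "\<gamma> \<noteq> []" using \<gamma>(1) unfolding lattice_path_def by simp
    have "((\<gamma> @ [b]) ! n, (\<gamma> @ [b]) ! Suc n) \<in> edges \<Lambda>" if n: "Suc n < length (\<gamma> @ [b])" for n
    proof (cases "Suc n < length \<gamma>")
      case True
      thus ?thesis using \<gamma>(1) unfolding lattice_path_def by (simp add: nth_append)
    next
      case False
      hence "Suc n = length \<gamma>" using n by simp
      moreover from this have "\<gamma> ! n = a" using \<gamma>(3) ne by (simp add: last_conv_nth flip: \<open>Suc n = length \<gamma>\<close>)
      ultimately show ?thesis using ab(1) by (simp add: nth_append)
    qed
    hence "lattice_path \<Lambda> (\<gamma> @ [b])"
      using \<gamma>(1) edge_vertices[OF ab(1)] unfolding lattice_path_def by auto
    moreover have "hd (\<gamma> @ [b]) = 0" using \<gamma>(2) ne by simp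
    ultimately show ?thesis unfolding P_def by (metis last_snoc)
  qed
  have "P z = P 0" by (rule constant_along_edges[OF _ assms zero_vertex]) (use step edges_sym in blast)
  moreover have "lattice_path \<Lambda> [0]" unfolding lattice_path_def using zero_vertex by simp
  hence "P 0" unfolding P_def by (intro exI[of _ "[0]"]) simp
  ultimately show thesis using that unfolding P_def by blast
qed

lemma integral_between_primitive:
  assumes F: "\<And>a b. (a, b) \<in> edges \<Lambda> \<Longrightarrow> F b - F a = step_sum f a b" "F 0 = 0" and z: "z \<in> V"
  shows "integral_between \<Lambda> 0 z f = F z"
proof -
  define \<gamma> where "\<gamma> = (SOME \<gamma>. lattice_path \<Lambda> \<gamma> \<and> hd \<gamma> = 0 \<and> last \<gamma> = z)"
  have "\<exists>\<gamma>. lattice_path \<Lambda> \<gamma> \<and> hd \<gamma> = 0 \<and> last \<gamma> = z" using path_exists[OF z] by metis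
  hence "lattice_path \<Lambda> \<gamma> \<and> hd \<gamma> = 0 \<and> last \<gamma> = z" unfolding \<gamma>_def by (rule someI_ex)
  thus ?thesis using path_integral_primitive[of \<Lambda> F f \<gamma>] F unfolding integral_between_def \<gamma>_def by simp
qed

section \<open>The shift operators\<close>

text \<open>The increment of \<open>Z\<^sub>+ f\<close> along the edge from \<open>a\<close> to \<open>b\<close>.\<close>

definition shift_step :: "(complex \<Rightarrow> complex) \<Rightarrow> complex \<Rightarrow> complex \<Rightarrow> complex" where
  "shift_step f a b = ((1 + (b - a)) * f a - (1 - (b - a)) * f b) / 2"

lemma DA_primitive:
  assumes f: "f \<in> DA \<Lambda>"
  obtains F where "\<And>a b. (a, b) \<in> edges \<Lambda> \<Longrightarrow> F b - F a = step_sum f a b"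
    "\<And>z. z \<in> V \<Longrightarrow> Z_plus \<Lambda> f z = (f 0 - f z) / 2 + F z" "F 0 = 0"
proof -
  obtain F where F: "F 0 = 0" "\<And>a b. (a, b) \<in> edges \<Lambda> \<Longrightarrow> F b - F a = step_sum f a b"
    by (rule rhombus_imp_primitive[of f, OF DA_imp_rhombus[OF f]]) auto
  have "Z_plus \<Lambda> f z = (f 0 - f z) / 2 + F z" if "z \<in> V" for z
    using integral_between_primitive[OF F(2,1) that] that unfolding Z_plus_def by simp
  thus thesis using that F by blast
qed

lemma Z_plus_zero: "f \<in> DA \<Lambda> \<Longrightarrow> Z_plus \<Lambda> f 0 = 0"
  by (erule DA_primitive) (simp add: zero_vertex)

lemma Z_plus_edge:
  assumes f: "f \<in> DA \<Lambda>" and ab: "(a, b) \<in> edges \<Lambda>"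
  shows "Z_plus \<Lambda> f b - Z_plus \<Lambda> f a = shift_step f a b"
proof -
  obtain F where F: "\<And>a b. (a, b) \<in> edges \<Lambda> \<Longrightarrow> F b - F a = step_sum f a b"
    "\<And>z. z \<in> V \<Longrightarrow> Z_plus \<Lambda> f z = (f 0 - f z) / 2 + F z" using DA_primitive[OF f] by metis
  have "Z_plus \<Lambda> f b - Z_plus \<Lambda> f a = (f a - f b) / 2 + step_sum f a b"
    using F(2)[OF edge_vertices(1)[OF ab]] F(2)[OF edge_vertices(2)[OF ab]] F(1)[OF ab]
    by (simp add: field_simps)
  also have "\<dots> = shift_step f a b" unfolding step_sum_def shift_step_def by (simp add: field_simps)
  finally show ?thesis .
qed

lemma Z_plus_extensional: "Z_plus \<Lambda> f \<in> extensional V"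
  unfolding Z_plus_def by simp

lemma DA_extensional: "f \<in> DA \<Lambda> \<Longrightarrow> f \<in> extensional V"
  unfolding DA_def by blast

lemma Z_plus_DA:
  assumes f: "f \<in> DA \<Lambda>" shows "Z_plus \<Lambda> f \<in> DA \<Lambda>"
  unfolding DA_iff
proof (intro conjI allI impI)
  show "Z_plus \<Lambda> f \<in> extensional V" by (rule Z_plus_extensional)
  fix p u v assume T: "rhomb u v" "tile p u v \<in> \<Lambda>"
  let ?g = "Z_plus \<Lambda> f"
  have g: "?g b = ?g a + shift_step f a b" if "(a, b) \<in> sides p u v" for a b
    using Z_plus_edge[OF f side_edge[OF T that]] by (simp add: algebra_simps)
  have g1: "?g (p + u) = ?g p + shift_step f p (p + u)"
    and g2: "?g (p + v) = ?g p + shift_step f p (p + v)"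
    by (rule g, simp add: sides_def)+
  have g3: "?g (p + u + v) = ?g (p + u) + shift_step f (p + u) (p + u + v)"
    by (rule g) (simp add: sides_def)
  have d: "rhombus_defect f p u v = 0" using DA_imp_rhombus[OF f T] .
  have "rhombus_defect ?g p u v = (v - 1) / 2 * rhombus_defect f p u v"
    unfolding rhombus_defect_def g3 g1 g2 shift_step_def by (simp add: field_simps)
  thus "rhombus_defect ?g p u v = 0" using d by simp
qed

lemma Z_plus_eqI:
  assumes f: "f \<in> DA \<Lambda>" and h: "h 0 = 0" "\<And>a b. (a, b) \<in> edges \<Lambda> \<Longrightarrow> h b - h a = shift_step f a b"
    and z: "z \<in> V"
  shows "Z_plus \<Lambda> f z = h z"
proof -
  have "Z_plus \<Lambda> f z - h z = Z_plus \<Lambda> f 0 - h 0"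
  proof (rule constant_along_edges[where P = "\<lambda>z. Z_plus \<Lambda> f z - h z", OF _ z zero_vertex])
    fix a b assume ab: "(a, b) \<in> edges \<Lambda>"
    have "Z_plus \<Lambda> f b - Z_plus \<Lambda> f a = h b - h a"
      unfolding Z_plus_edge[OF f ab] h(2)[OF ab] ..
    thus "Z_plus \<Lambda> f a - h a = Z_plus \<Lambda> f b - h b" by (simp add: algebra_simps)
  qed
  thus ?thesis using h(1) Z_plus_zero[OF f] by simp
qed

end

locale rooted_reachable_tiling = rooted_rhombic_tiling +
  assumes reachable: "unit_step_reachable \<Lambda>"
begin

text \<open>The path supplied by the reachability assumption is traversed backwards: its last step \<open>1\<close> forces
  \<open>f = 0\<close> at the last but one vertex, and a step different from \<open>-1\<close> carries zeros backwards.\<close>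

lemma shift_step_injective:
  assumes fg: "\<And>a b. (a, b) \<in> edges \<Lambda> \<Longrightarrow> shift_step f a b = 0" and z: "z \<in> V"
  shows "f z = 0"
proof -
  obtain N \<gamma> where N: "N \<ge> 1" "length \<gamma> = Suc N" "lattice_path \<Lambda> \<gamma>" "\<gamma> ! 0 = z"
    "\<forall>n\<in>{1..N - 1}. \<gamma> ! n - \<gamma> ! (n - 1) \<notin> {1, -1}" "\<gamma> ! N - \<gamma> ! (N - 1) = 1"
    using reachable z unfolding unit_step_reachable_def by blast
  have e: "(\<gamma> ! n, \<gamma> ! Suc n) \<in> edges \<Lambda>" if "n < N" for n
    using N(2,3) that unfolding lattice_path_def by simp
  have "f (\<gamma> ! (N - 1 - k)) = 0" if "k \<le> N - 1" for k
    using that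
  proof (induction k)
    case 0
    have "(\<gamma> ! (N - 1), \<gamma> ! N) \<in> edges \<Lambda>" using e[of "N - 1"] N(1) by simp
    thus ?case using fg[of "\<gamma> ! (N - 1)" "\<gamma> ! N"] N(6) unfolding shift_step_def by simp
  next
    case (Suc k)
    define n where "n = N - 1 - Suc k"
    have n: "Suc n = N - 1 - k" "n < N" "Suc n \<in> {1..N - 1}" using Suc.prems N(1) unfolding n_def by auto
    have "\<gamma> ! Suc n - \<gamma> ! n \<noteq> -1" using N(5) n(3) by force
    hence "1 + (\<gamma> ! Suc n - \<gamma> ! n) \<noteq> 0" by (metis add.inverse_unique)
    moreover have "f (\<gamma> ! Suc n) = 0" using Suc n(1) by simp
    ultimately have "f (\<gamma> ! n) = 0" using fg[OF e[OF n(2)]] unfolding shift_step_def by simp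
    thus ?case unfolding n_def .
  qed
  from this[of "N - 1"] show ?thesis using N(4) by simp
qed

lemma Z_minus_eqI:
  assumes g: "g \<in> DA \<Lambda>" "\<And>z. z \<in> V \<Longrightarrow> Z_plus \<Lambda> g z = f z - f 0"
  shows "Z_minus \<Lambda> f = g"
  unfolding Z_minus_def
proof (rule the_equality)
  show "g \<in> DA \<Lambda> \<and> (\<forall>z\<in>V. Z_plus \<Lambda> g z = f z - f 0)" using g by blast
  fix h assume h: "h \<in> DA \<Lambda> \<and> (\<forall>z\<in>V. Z_plus \<Lambda> h z = f z - f 0)"
  have "h z - g z = 0" if z: "z \<in> V" for z
  proof (rule shift_step_injective[where f = "\<lambda>z. h z - g z", OF _ z])
    fix a b assume ab: "(a, b) \<in> edges \<Lambda>"
    have "shift_step h a b = shift_step g a b"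
      using Z_plus_edge[OF g(1) ab] Z_plus_edge[OF _ ab, of h] h g(2) edge_vertices[OF ab] by simp
    moreover have "shift_step (\<lambda>z. h z - g z) a b = shift_step h a b - shift_step g a b"
      unfolding shift_step_def by (simp add: field_simps)
    ultimately show "shift_step (\<lambda>z. h z - g z) a b = 0" by simp
  qed
  thus "h = g" using DA_extensional g(1) h by (intro extensionalityI[of h V g]) auto
qed

end


section \<open>Recurrent sequences as linear functionals on polynomials\<close>

text \<open>The linear functional on polynomials with value \<open>a k\<close> at the \<open>k\<close>-th power of the indeterminate.\<close>

definition lin :: "(nat \<Rightarrow> complex) \<Rightarrow> complex poly \<Rightarrow> complex" where
  "lin a p = (\<Sum>k\<le>degree p. coeff p k * a k)"

lemma lin_bound: "degree p \<le> N \<Longrightarrow> lin a p = (\<Sum>k\<le>N. coeff p k * a k)"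
  unfolding lin_def by (rule sum.mono_neutral_left) (auto simp: coeff_eq_0)

lemma lin_0 [simp]: "lin a 0 = 0"
  unfolding lin_def by simp

lemma lin_1 [simp]: "lin a 1 = a 0"
  unfolding lin_def by simp

lemma lin_add: "lin a (p + q) = lin a p + lin a q"
proof -
  let ?N = "max (degree p) (degree q)"
  have "lin a (p + q) = (\<Sum>k\<le>?N. coeff (p + q) k * a k)" by (rule lin_bound) (rule degree_add_le_max)
  also have "\<dots> = (\<Sum>k\<le>?N. coeff p k * a k) + (\<Sum>k\<le>?N. coeff q k * a k)"
    by (simp add: algebra_simps sum.distrib)
  also have "\<dots> = lin a p + lin a q" using lin_bound[of p ?N a] lin_bound[of q ?N a] by simp
  finally show ?thesis .
qed

lemma lin_smult: "lin a (Polynomial.smult c p) = c * lin a p"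
  using lin_bound[of "Polynomial.smult c p" "degree p" a] unfolding lin_def
  by (simp add: sum_distrib_left mult.assoc)

lemma lin_diff: "lin a (p - q) = lin a p - lin a q"
  using lin_add[of a "p - q" q] by simp

lemma lin_pCons: "lin a (pCons c p) = c * a 0 + lin (\<lambda>k. a (Suc k)) p"
proof -
  have "lin a (pCons c p) = (\<Sum>k\<le>Suc (degree p). coeff (pCons c p) k * a k)"
    by (rule lin_bound) (rule degree_pCons_le)
  also have "\<dots> = c * a 0 + lin (\<lambda>k. a (Suc k)) p"
    unfolding lin_def by (subst sum.atMost_Suc_shift) simp
  finally show ?thesis .
qed

lemma lin_linear_factor: "lin a (p * [:c, d:]) = c * lin a p + d * lin (\<lambda>k. a (Suc k)) p"
  by (simp add: lin_add lin_smult lin_pCons)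

lemma lin_sum_seq: "lin (\<lambda>k. \<Sum>i\<in>I. a i k) p = (\<Sum>i\<in>I. lin (a i) p)"
  unfolding lin_def by (simp add: sum_distrib_left sum.swap[of _ I])

lemma lin_scale_seq: "lin (\<lambda>k. c * a k) p = c * lin a p"
  unfolding lin_def by (simp add: sum_distrib_left mult_ac)

lemma lin_add_seq: "lin (\<lambda>k. a k + b k) p = lin a p + lin b p"
  unfolding lin_def by (simp add: algebra_simps sum.distrib)

text \<open>The sequence \<open>a\<close> satisfies the linear recurrence with characteristic polynomial \<open>\<mu>\<close>; equivalently,
  \<open>lin a\<close> vanishes on all multiples of \<open>\<mu>\<close>.\<close>

definition recurrent :: "complex poly \<Rightarrow> (nat \<Rightarrow> complex) \<Rightarrow> bool" where
  "recurrent \<mu> a \<longleftrightarrow> (\<forall>k. lin (\<lambda>n. a (n + k)) \<mu> = 0)"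

lemma recurrentD: "recurrent \<mu> a \<Longrightarrow> lin (\<lambda>n. a (n + k)) \<mu> = 0"
  unfolding recurrent_def by blast

lemma recurrent_shift:
  assumes "recurrent \<mu> a" shows "recurrent \<mu> (\<lambda>k. a (Suc k))"
  unfolding recurrent_def
proof
  fix k show "lin (\<lambda>n. a (Suc (n + k))) \<mu> = 0" using recurrentD[OF assms, of "Suc k"] by simp
qed

lemma lin_multiple: "recurrent \<mu> a \<Longrightarrow> lin a (\<mu> * p) = 0"
proof (induction p arbitrary: a)
  case (pCons c p)
  have "lin a (\<mu> * pCons c p) = c * lin a \<mu> + lin (\<lambda>k. a (Suc k)) (\<mu> * p)"
    by (simp add: mult_pCons_right lin_add lin_smult lin_pCons)
  moreover have "lin a \<mu> = 0" using recurrentD[OF pCons.prems, of 0] by simp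
  ultimately show ?case using pCons.IH[OF recurrent_shift[OF pCons.prems]] by simp
qed simp

lemma lin_dvd: "recurrent \<mu> a \<Longrightarrow> \<mu> dvd p \<Longrightarrow> lin a p = 0"
  using lin_multiple by (metis dvdE)

lemma lin_dvd_eq: "recurrent \<mu> a \<Longrightarrow> \<mu> dvd p - q \<Longrightarrow> lin a p = lin a q"
  using lin_dvd[of \<mu> a "p - q"] by (simp add: lin_diff)

lemma lin_shift_mult: "lin (\<lambda>n. a (n + k)) \<mu> = lin a (\<mu> * monom 1 k)"
proof (induction k arbitrary: a)
  case (Suc k)
  have "\<mu> * monom 1 (Suc k) = (\<mu> * monom 1 k) * [:0, 1:]" by (simp add: monom_Suc mult_pCons_right)
  thus ?case using Suc.IH[of "\<lambda>n. a (Suc n)"] lin_linear_factor[of a "\<mu> * monom 1 k" 0 1] by simp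
qed (simp add: monom_0 one_pCons)

lemma recurrent_mult: "recurrent \<mu> a \<Longrightarrow> recurrent (\<mu> * \<nu>) a"
  unfolding recurrent_def[of "\<mu> * \<nu>"] lin_shift_mult by (simp add: lin_multiple mult.assoc)

lemma recurrent_mult2: "recurrent \<nu> a \<Longrightarrow> recurrent (\<mu> * \<nu>) a"
  using recurrent_mult[of \<nu> a \<mu>] by (simp add: mult.commute)

section \<open>Transfer polynomials\<close>

text \<open>On an edge with vector \<open>w\<close>, multiplication by \<open>half_step (- w) / half_step w\<close> is the passage from one
  endpoint to the other in the equation \<open>X - Z\<^sub>+(X) A = I\<close>, with the indeterminate in place of \<open>A\<close>.\<close>

definition half_step :: "complex \<Rightarrow> complex poly" where
  "half_step w = [:2, 1 - w:]"

lemma lin_half_step: "lin a (p * half_step w) = 2 * lin a p + (1 - w) * lin (\<lambda>k. a (Suc k)) p"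
  unfolding half_step_def by (rule lin_linear_factor)

text \<open>The rhombus condition for the products of such multipliers, after clearing denominators.\<close>

lemma half_step_identity:
  "(half_step u * half_step v - half_step (- u) * half_step (- v)) * [:u - v:] +
   (half_step (- u) * half_step v - half_step (- v) * half_step u) * [:u + v:] = 0"
proof -
  have h: "half_step w = [:2, 1:] - [:w:] * [:0, 1:]" for w
    unfolding half_step_def by simp
  have n: "half_step (- w) = [:2, 1:] + [:w:] * [:0, 1:]" for w
    unfolding half_step_def by simp
  have c: "[:u - v:] = [:u:] - [:v:]" "[:u + v:] = [:u:] + [:v:]" by simp_all
  have "((t - U * X) * (t - W * X) - (t + U * X) * (t + W * X)) * (U - W) +
    ((t + U * X) * (t - W * X) - (t + W * X) * (t - U * X)) * (U + W) = (0 :: complex poly)" for t U W X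
    by (simp add: algebra_simps)
  thus ?thesis unfolding n unfolding h c .
qed

context rooted_reachable_tiling begin

abbreviation S where "S \<equiv> S_set \<Lambda>"

text \<open>Moduli for which all multipliers are invertible.\<close>

definition good :: "complex poly \<Rightarrow> bool" where
  "good \<mu> \<longleftrightarrow> \<mu> \<noteq> 0 \<and> (\<forall>t\<in>S. poly \<mu> t \<noteq> 0)"

lemma good_mult: "good \<mu> \<Longrightarrow> good \<nu> \<Longrightarrow> good (\<mu> * \<nu>)"
  unfolding good_def by simp

lemma S_iff: "t \<in> S \<longleftrightarrow> (\<exists>a b. (a, b) \<in> edges \<Lambda> \<and> t * (1 + b - a) = -2)"
  unfolding S_set_def by auto

text \<open>The differences of adjacent vertices.\<close>

definition edge_vectors :: "complex set" where
  "edge_vectors = {w. \<exists>a. (a, a + w) \<in> edges \<Lambda>}"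

lemma edge_vectorsI: "(a, b) \<in> edges \<Lambda> \<Longrightarrow> b - a \<in> edge_vectors"
  unfolding edge_vectors_def by (auto intro!: exI[of _ a])

lemma edge_vectors_uminus: "w \<in> edge_vectors \<Longrightarrow> - w \<in> edge_vectors"
  unfolding edge_vectors_def 
proof (elim CollectE exE, intro CollectI exI)
  fix a assume "(a, a + w) \<in> edges \<Lambda>"
  thus "(a + w, a + w + - w) \<in> edges \<Lambda>" using edges_sym by simp
qed

text \<open>The only root of \<open>half_step w\<close> is \<open>-2 / (1 - w)\<close>, an element of \<open>S\<close>; if \<open>w = 1\<close> there is none.\<close>

lemma half_step_invertible:
  assumes \<mu>: "good \<mu>" and w: "w \<in> edge_vectors"
  shows "\<exists>h. \<mu> dvd half_step w * h - 1"
proof (cases "w = 1")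
  case True
  hence "half_step w * [:1/2:] - 1 = 0" unfolding half_step_def by (simp add: one_pCons)
  thus ?thesis by (metis dvd_0_right)
next
  case False
  define s where "s = -2 / (1 - w)"
  have w1: "1 - w \<noteq> 0" using False by simp
  obtain a where a: "(a, a + w) \<in> edges \<Lambda>" using w unfolding edge_vectors_def by blast
  have cancel: "d * (c / d) = c" "- 1 / (d * m) * d = - 1 / m" if "d \<noteq> 0" for c d m :: complex
    using that by simp_all
  have sw: "(1 - w) * s = -2" unfolding s_def by (rule cancel(1)[OF w1])
  have "1 + a - (a + w) = 1 - w" by simp
  hence "s * (1 + a - (a + w)) = -2" using sw by (simp only: mult.commute)
  hence "s \<in> S" unfolding S_iff using edges_sym[OF a] by blast
  hence m: "poly \<mu> s \<noteq> 0" using \<mu> unfolding good_def by simp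
  have half: "half_step w = Polynomial.smult (1 - w) [:- s, 1:]" unfolding half_step_def using sw by simp
  define h where "h = Polynomial.smult (- 1 / ((1 - w) * poly \<mu> s)) (synthetic_div \<mu> s)"
  have "half_step w * h = Polynomial.smult (- 1 / poly \<mu> s) ([:- s, 1:] * synthetic_div \<mu> s)"
    unfolding half h_def mult_smult_left mult_smult_right smult_smult cancel(2)[OF w1] ..
  also have "[:- s, 1:] * synthetic_div \<mu> s = \<mu> - [:poly \<mu> s:]"
    using synthetic_div_correct'[of s \<mu>] by (simp add: eq_diff_eq)
  also have "Polynomial.smult (- 1 / poly \<mu> s) (\<mu> - [:poly \<mu> s:]) = Polynomial.smult (- 1 / poly \<mu> s) \<mu> + 1"
    using m by (simp add: smult_diff_right one_pCons)
  finally have "half_step w * h - 1 = Polynomial.smult (- 1 / poly \<mu> s) \<mu>" by simp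
  hence "\<mu> dvd half_step w * h - 1" using m by (simp add: dvd_smult)
  thus ?thesis by blast
qed

lemma half_step_cancel:
  assumes "good \<mu>" "w \<in> edge_vectors"
  shows "\<mu> dvd p * half_step w \<longleftrightarrow> \<mu> dvd p"
proof
  obtain h where h: "\<mu> dvd half_step w * h - 1" using half_step_invertible[OF assms] by blast
  assume "\<mu> dvd p * half_step w"
  hence "\<mu> dvd (p * half_step w) * h - p * (half_step w * h - 1)"
    using h by (intro dvd_diff[OF dvd_mult2 dvd_mult])
  thus "\<mu> dvd p" by (simp add: algebra_simps)
qed simp

text \<open>
  Polynomials \<open>P z\<close>, for the vertices \<open>z\<close>, that satisfy modulo \<open>\<mu>\<close> the edge relation with
  \<open>P 0 = 1\<close>: if \<open>A\<close> is annihilated by \<open>\<mu>\<close> then \<open>P z\<close>, evaluated at \<open>A\<close>, is the inverse of \<open>I - zA\<close>.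
\<close>

definition transfer_family :: "complex poly \<Rightarrow> (complex \<Rightarrow> complex poly) \<Rightarrow> bool" where
  "transfer_family \<mu> P \<longleftrightarrow> \<mu> dvd P 0 - 1 \<and>
     (\<forall>(a, b)\<in>edges \<Lambda>. \<mu> dvd P b * half_step (b - a) - P a * half_step (a - b))"

lemma transfer_familyD:
  assumes "transfer_family \<mu> P"
  shows "\<mu> dvd P 0 - 1" "(a, b) \<in> edges \<Lambda> \<Longrightarrow> \<mu> dvd P b * half_step (b - a) - P a * half_step (a - b)"
  using assms unfolding transfer_family_def by auto

lemma transfer_family_exists:
  assumes \<mu>: "good \<mu>" shows "\<exists>P. transfer_family \<mu> P"
proof -
  define h where "h w = (SOME h. \<mu> dvd half_step w * h - 1)" for w
  have h: "\<mu> dvd half_step w * h w - 1" if "w \<in> edge_vectors" for w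
    unfolding h_def by (rule someI_ex[OF half_step_invertible[OF \<mu> that]])
  define m where "m w = half_step (- w) * h w" for w
  \<comment> \<open>Transport on residues, represented by reduced polynomials; elsewhere it is the identity, to be bijective.\<close>
  define g where "g a b y = (if y mod \<mu> = y then (y * m (b - a)) mod \<mu> else y)" for a b y
  have mm: "(y * (m w * m (- w))) mod \<mu> = y mod \<mu>" if w: "w \<in> edge_vectors" for y w
  proof -
    let ?A = "half_step w * h w" and ?B = "half_step (- w) * h (- w)"
    have "m w * m (- w) = ?A * ?B" unfolding m_def by (simp add: mult_ac)
    moreover have "\<mu> dvd (?A - 1) * ?B + (?B - 1)"
      using h[OF w] h[OF edge_vectors_uminus[OF w]] by (intro dvd_add dvd_mult2)
    hence "\<mu> dvd ?A * ?B - 1" by (simp add: algebra_simps)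
    hence "\<mu> dvd y * (?A * ?B - 1)" by (rule dvd_mult)
    hence "\<mu> dvd y * (?A * ?B) - y" by (simp add: algebra_simps)
    ultimately show ?thesis by (simp add: mod_eq_dvd_iff)
  qed
  obtain s where s: "s 0 = 1 mod \<mu>" "\<And>a b. (a, b) \<in> edges \<Lambda> \<Longrightarrow> s b = g a b (s a)"
  proof (rule transport_along_edges[of g "1 mod \<mu>"])
    show "g b a (g a b y) = y" if "(a, b) \<in> edges \<Lambda>" for a b y
    proof (cases "y mod \<mu> = y")
      case True
      have "m (a - b) = m (- (b - a))" by simp
      hence "g b a (g a b y) = (y * (m (b - a) * m (- (b - a)))) mod \<mu>"
        unfolding g_def using True by (simp add: mod_mult_left_eq mult.assoc)
      also have "\<dots> = y" using mm[OF edge_vectorsI[OF that]] True by simp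
      finally show ?thesis .
    qed (simp add: g_def)
    show "g (p + u) (p + u + v) (g p (p + u) y) = g (p + v) (p + u + v) (g p (p + v) y)" for p u v y
    proof (cases "y mod \<mu> = y")
      case True
      have "p + u + v - (p + v) = u" by simp
      thus ?thesis unfolding g_def using True by (simp add: mod_mult_left_eq) (simp only: mult_ac)
    qed (simp add: g_def)
  qed (use zero_vertex in auto)
  have red: "s z mod \<mu> = s z" if "z \<in> V" for z
  proof -
    have "(s z mod \<mu> = s z) = (s 0 mod \<mu> = s 0)"
      by (rule constant_along_edges[where P = "\<lambda>z. s z mod \<mu> = s z", OF _ that zero_vertex])
        (use s(2) in \<open>auto simp: g_def\<close>)
    thus ?thesis using s(1) by simp
  qed
  have "transfer_family \<mu> s"
    unfolding transfer_family_def
  proof (intro conjI ballI, unfold split_paired_all prod.case)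
    show "\<mu> dvd s 0 - 1" unfolding s(1) by (simp flip: mod_eq_dvd_iff)
    fix a b assume ab: "(a, b) \<in> edges \<Lambda>"
    let ?w = "b - a"
    have "s b = (s a * m ?w) mod \<mu>" using s(2)[OF ab] red edge_vertices[OF ab] unfolding g_def by simp
    hence "\<mu> dvd s b - s a * m ?w" by (simp flip: mod_eq_dvd_iff)
    hence "\<mu> dvd (s b - s a * m ?w) * half_step ?w + s a * half_step (- ?w) * (half_step ?w * h ?w - 1)"
      by (rule dvd_add[OF dvd_mult2 dvd_mult[OF h[OF edge_vectorsI[OF ab]]]])
    thus "\<mu> dvd s b * half_step ?w - s a * half_step (a - b)"
      unfolding m_def by (simp add: algebra_simps)
  qed
  thus ?thesis by blast
qed

lemma transfer_family_unique:
  assumes \<mu>: "good \<mu>" and P: "transfer_family \<mu> P" "transfer_family \<mu> Q" and z: "z \<in> V"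
  shows "\<mu> dvd P z - Q z"
proof -
  have "(\<mu> dvd P z - Q z) = (\<mu> dvd P 0 - Q 0)"
  proof (rule constant_along_edges[where P = "\<lambda>z. \<mu> dvd P z - Q z", OF _ z zero_vertex])
    fix a b assume ab: "(a, b) \<in> edges \<Lambda>"
    let ?A = "(P a - Q a) * half_step (a - b)" and ?B = "(P b - Q b) * half_step (b - a)"
    have "\<mu> dvd (P b * half_step (b - a) - P a * half_step (a - b)) - (Q b * half_step (b - a) - Q a * half_step (a - b))"
      using transfer_familyD(2)[OF P(1) ab] transfer_familyD(2)[OF P(2) ab] by (rule dvd_diff)
    hence "\<mu> dvd ?B - ?A" by (simp add: algebra_simps)
    from dvd_add_left_iff[OF this, of ?A] have "\<mu> dvd ?A \<longleftrightarrow> \<mu> dvd ?B" by simp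
    thus "(\<mu> dvd P a - Q a) = (\<mu> dvd P b - Q b)"
      using half_step_cancel[OF \<mu> edge_vectorsI[OF ab]] half_step_cancel[OF \<mu> edge_vectorsI[OF edges_sym[OF ab]]]
      by simp
  qed
  moreover have "\<mu> dvd (P 0 - 1) - (Q 0 - 1)"
    using transfer_familyD(1)[OF P(1)] transfer_familyD(1)[OF P(2)] by (rule dvd_diff)
  ultimately show ?thesis by simp
qed

lemma transfer_family_dvd: "transfer_family \<mu> P \<Longrightarrow> \<nu> dvd \<mu> \<Longrightarrow> transfer_family \<nu> P"
  unfolding transfer_family_def by (blast intro: dvd_trans)

text \<open>The rhombus condition holds modulo \<open>\<mu>\<close> because it holds after multiplication by two units.\<close>

lemma transfer_family_rhombus:
  assumes \<mu>: "good \<mu>" and P: "transfer_family \<mu> P" and T: "rhomb u v" "tile p u v \<in> \<Lambda>"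
  shows "\<mu> dvd (P p - P (p + u + v)) * [:u - v:] + (P (p + u) - P (p + v)) * [:u + v:]"
    (is "_ dvd ?E")
proof -
  have e: "(p, p + u) \<in> edges \<Lambda>" "(p + u, p + u + v) \<in> edges \<Lambda>" "(p, p + v) \<in> edges \<Lambda>"
    by (rule side_edge[OF T], simp add: sides_def)+
  define R1 where "R1 = P (p + u) * half_step u - P p * half_step (- u)"
  define R2 where "R2 = P (p + u + v) * half_step v - P (p + u) * half_step (- v)"
  define R3 where "R3 = P (p + v) * half_step v - P p * half_step (- v)"
  have R: "\<mu> dvd R1" "\<mu> dvd R2" "\<mu> dvd R3"
    using transfer_familyD(2)[OF P e(1)] transfer_familyD(2)[OF P e(2)] transfer_familyD(2)[OF P e(3)]
    unfolding R1_def R2_def R3_def by simp_all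
  have ring: "((a - c) * k + (b - d) * l) * (x * y) =
      a * ((x * y - x' * y') * k + (x' * y - y' * x) * l)
      - (c * y - b * y') * x * k - y' * (b * x - a * x') * k
      + (b * x - a * x') * y * l - (d * y - a * y') * x * l" for a b c d k l x y x' y' :: "complex poly"
    by (simp add: algebra_simps)
  have eq: "?E * (half_step u * half_step v) = P p * 0
      - R2 * half_step u * [:u - v:] - half_step (- v) * R1 * [:u - v:]
      + R1 * half_step v * [:u + v:] - R3 * half_step u * [:u + v:]"
    using ring[where a = "P p" and b = "P (p + u)" and c = "P (p + u + v)" and d = "P (p + v)"
      and k = "[:u - v:]" and l = "[:u + v:]" and x = "half_step u" and y = "half_step v"
      and x' = "half_step (- u)" and y' = "half_step (- v)"]
    unfolding half_step_identity R1_def R2_def R3_def .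
  have D: "\<mu> dvd R * q * r" "\<mu> dvd q * R * r" if "\<mu> dvd R" for R q r
    using that by (metis dvd_mult2 dvd_mult)+
  have "\<mu> dvd ?E * (half_step u * half_step v)"
    unfolding eq
    by (rule dvd_diff[OF dvd_add[OF dvd_diff[OF dvd_diff[OF _ D(1)[OF R(2)]] D(2)[OF R(1)]]
      D(1)[OF R(1)]] D(1)[OF R(3)]]) simp
  hence "\<mu> dvd ?E * half_step u * half_step v" by (simp only: mult.assoc)
  moreover have "u \<in> edge_vectors" "v \<in> edge_vectors"
    using edge_vectorsI[OF e(1)] edge_vectorsI[OF e(3)] by simp_all
  ultimately show ?thesis using half_step_cancel[OF \<mu>] by blast
qed

end


section \<open>Scalar rational functions\<close>

context rooted_reachable_tiling begin

text \<open>Sequences with a recurrence whose characteristic polynomial has no root in \<open>S\<close>.\<close>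

definition regular :: "(nat \<Rightarrow> complex) \<Rightarrow> bool" where
  "regular a \<longleftrightarrow> (\<exists>\<mu>. good \<mu> \<and> recurrent \<mu> a)"

text \<open>The discrete analytic function whose iterated backward shifts have the values \<open>a 0, a 1, \<dots>\<close> at the
  origin. The choice of the modulus and of the transfer family is immaterial, see \<open>phi_eq\<close>.\<close>

definition phi :: "(nat \<Rightarrow> complex) \<Rightarrow> complex \<Rightarrow> complex" where
  "phi a = (\<lambda>z\<in>V. lin a ((SOME P. transfer_family (SOME \<mu>. good \<mu> \<and> recurrent \<mu> a) P) z))"

lemma phi_eq:
  assumes \<mu>: "good \<mu>" and a: "recurrent \<mu> a" and P: "transfer_family \<mu> P" and z: "z \<in> V"
  shows "phi a z = lin a (P z)"
proof -
  define \<nu> where "\<nu> = (SOME \<mu>. good \<mu> \<and> recurrent \<mu> a)"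
  define Q where "Q = (SOME P. transfer_family \<nu> P)"
  have "\<exists>\<mu>. good \<mu> \<and> recurrent \<mu> a" using \<mu> a by blast
  hence "good \<nu> \<and> recurrent \<nu> a" unfolding \<nu>_def by (rule someI_ex)
  hence \<nu>: "good \<nu>" "recurrent \<nu> a" by simp_all
  have Q: "transfer_family \<nu> Q" unfolding Q_def by (rule someI_ex[OF transfer_family_exists[OF \<nu>(1)]])
  obtain R where R: "transfer_family (\<mu> * \<nu>) R" using transfer_family_exists[OF good_mult[OF \<mu> \<nu>(1)]] by blast
  have "\<mu> dvd P z - R z"
    by (rule transfer_family_unique[OF \<mu> P transfer_family_dvd[OF R] z]) simp
  moreover have "\<nu> dvd Q z - R z"
    by (rule transfer_family_unique[OF \<nu>(1) Q transfer_family_dvd[OF R] z]) simp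
  ultimately have "lin a (P z) = lin a (Q z)"
    using lin_dvd_eq[OF a] lin_dvd_eq[OF \<nu>(2)] by metis
  thus ?thesis unfolding phi_def \<nu>_def[symmetric] Q_def[symmetric] using z by simp
qed

lemma phi_extensional: "phi a \<in> extensional V"
  unfolding phi_def by simp

lemma phi_DA:
  assumes "regular a" shows "phi a \<in> DA \<Lambda>"
  unfolding DA_iff
proof (intro conjI allI impI)
  show "phi a \<in> extensional V" by (rule phi_extensional)
  fix p u v assume T: "rhomb u v" "tile p u v \<in> \<Lambda>"
  obtain \<mu> where \<mu>: "good \<mu>" "recurrent \<mu> a" using assms unfolding regular_def by blast
  obtain P where P: "transfer_family \<mu> P" using transfer_family_exists[OF \<mu>(1)] by blast
  have phi: "phi a x = lin a (P x)" if "x \<in> {p, p + u, p + u + v, p + v}" for x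
    by (rule phi_eq[OF \<mu> P corner_vertex[OF T that]])
  have const: "lin a (q * [:c:]) = c * lin a q" for q c
    using lin_smult[of a c q] by (simp add: mult.commute)
  have "lin a ((P p - P (p + u + v)) * [:u - v:] + (P (p + u) - P (p + v)) * [:u + v:]) = 0"
    by (rule lin_dvd[OF \<mu>(2) transfer_family_rhombus[OF \<mu>(1) P T]])
  hence "(u - v) * (lin a (P p) - lin a (P (p + u + v))) + (u + v) * (lin a (P (p + u)) - lin a (P (p + v))) = 0"
    unfolding lin_add const lin_diff .
  thus "rhombus_defect (phi a) p u v = 0"
    unfolding rhombus_defect_def by (simp add: phi mult.commute)
qed

lemma phi_zero:
  assumes "regular a" shows "phi a 0 = a 0"
proof -
  obtain \<mu> where \<mu>: "good \<mu>" "recurrent \<mu> a" using assms unfolding regular_def by blast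
  obtain P where P: "transfer_family \<mu> P" using transfer_family_exists[OF \<mu>(1)] by blast
  have "lin a (P 0) = lin a 1" by (rule lin_dvd_eq[OF \<mu>(2) transfer_familyD(1)[OF P]])
  thus ?thesis using phi_eq[OF \<mu> P zero_vertex] by simp
qed

lemma regular_shift: "regular a \<Longrightarrow> regular (\<lambda>k. a (Suc k))"
  unfolding regular_def using recurrent_shift by blast

lemma Z_plus_phi_shift:
  assumes a: "regular a" and z: "z \<in> V"
  shows "Z_plus \<Lambda> (phi (\<lambda>k. a (Suc k))) z = phi a z - a 0"
proof (rule Z_plus_eqI[where h = "\<lambda>z. phi a z - a 0", OF phi_DA[OF regular_shift[OF a]] _ _ z])
  show "phi a 0 - a 0 = 0" using phi_zero[OF a] by simp
  fix x y assume xy: "(x, y) \<in> edges \<Lambda>"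
  obtain \<mu> where \<mu>: "good \<mu>" "recurrent \<mu> a" using a unfolding regular_def by blast
  obtain P where P: "transfer_family \<mu> P" using transfer_family_exists[OF \<mu>(1)] by blast
  let ?s = "\<lambda>k. a (Suc k)"
  have phi: "phi a w = lin a (P w)" "phi ?s w = lin ?s (P w)" if "w \<in> V" for w
    using phi_eq[OF \<mu> P that] phi_eq[OF \<mu>(1) recurrent_shift[OF \<mu>(2)] P that] by simp_all
  have "lin a (P y * half_step (y - x)) = lin a (P x * half_step (x - y))"
    by (rule lin_dvd_eq[OF \<mu>(2) transfer_familyD(2)[OF P xy]])
  hence e: "2 * lin a (P y) + (1 - (y - x)) * lin ?s (P y) = 2 * lin a (P x) + (1 - (x - y)) * lin ?s (P x)"
    unfolding lin_half_step .
  have "phi a y - a 0 - (phi a x - a 0) = (2 * lin a (P y) - 2 * lin a (P x)) / 2"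
    using phi edge_vertices[OF xy] by simp
  also have "2 * lin a (P y) - 2 * lin a (P x) = (1 - (x - y)) * lin ?s (P x) - (1 - (y - x)) * lin ?s (P y)"
    using e by (simp add: algebra_simps)
  also have "\<dots> / 2 = shift_step (phi ?s) x y"
    unfolding shift_step_def using phi edge_vertices[OF xy] by (simp add: algebra_simps)
  finally show "phi a y - a 0 - (phi a x - a 0) = shift_step (phi ?s) x y" .
qed

lemma regular_common:
  assumes "finite I" "\<And>i. i \<in> I \<Longrightarrow> regular (a i)"
  obtains \<mu> where "good \<mu>" "\<And>i. i \<in> I \<Longrightarrow> recurrent \<mu> (a i)"
proof -
  have "\<exists>\<mu>. good \<mu> \<and> (\<forall>i\<in>I. recurrent \<mu> (a i))"
    using assms
  proof (induction rule: finite_induct)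
    case empty
    have "good 1" unfolding good_def by simp
    thus ?case by blast
  next
    case (insert i I)
    obtain \<mu> where \<mu>: "good \<mu>" "\<forall>i\<in>I. recurrent \<mu> (a i)" using insert by blast
    obtain \<nu> where \<nu>: "good \<nu>" "recurrent \<nu> (a i)" using insert.prems[of i] unfolding regular_def by blast
    have "good (\<mu> * \<nu>)" "\<forall>j\<in>insert i I. recurrent (\<mu> * \<nu>) (a j)"
      using good_mult[OF \<mu>(1) \<nu>(1)] recurrent_mult recurrent_mult2[OF \<nu>(2)] \<mu>(2) by auto
    thus ?case by blast
  qed
  thus thesis using that by blast
qed

lemma recurrent_sum: "(\<And>i. i \<in> I \<Longrightarrow> recurrent \<mu> (a i)) \<Longrightarrow> recurrent \<mu> (\<lambda>k. \<Sum>i\<in>I. a i k)"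
  unfolding recurrent_def by (simp add: lin_sum_seq)

lemma recurrent_scale: "recurrent \<mu> a \<Longrightarrow> recurrent \<mu> (\<lambda>k. c * a k)"
  unfolding recurrent_def by (simp add: lin_scale_seq)

lemma recurrent_add: "recurrent \<mu> a \<Longrightarrow> recurrent \<mu> b \<Longrightarrow> recurrent \<mu> (\<lambda>k. a k + b k)"
  unfolding recurrent_def by (simp add: lin_add_seq)

lemma regular_scale: "regular a \<Longrightarrow> regular (\<lambda>k. c * a k)"
  unfolding regular_def using recurrent_scale by blast

lemma regular_add:
  assumes "regular a" "regular b" shows "regular (\<lambda>k. a k + b k)"
proof -
  obtain \<mu> where \<mu>: "good \<mu>" "recurrent \<mu> a" using assms(1) unfolding regular_def by blast
  obtain \<nu> where \<nu>: "good \<nu>" "recurrent \<nu> b" using assms(2) unfolding regular_def by blast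
  have "recurrent (\<mu> * \<nu>) (\<lambda>k. a k + b k)"
    by (rule recurrent_add[OF recurrent_mult[OF \<mu>(2)] recurrent_mult2[OF \<nu>(2)]])
  thus ?thesis unfolding regular_def using good_mult[OF \<mu>(1) \<nu>(1)] by blast
qed

lemma phi_scale:
  assumes "regular a" "z \<in> V" shows "phi (\<lambda>k. c * a k) z = c * phi a z"
proof -
  obtain \<mu> where \<mu>: "good \<mu>" "recurrent \<mu> a" using assms(1) unfolding regular_def by blast
  obtain P where P: "transfer_family \<mu> P" using transfer_family_exists[OF \<mu>(1)] by blast
  show ?thesis
    unfolding phi_eq[OF \<mu> P assms(2)] phi_eq[OF \<mu>(1) recurrent_scale[OF \<mu>(2)] P assms(2)]
    by (rule lin_scale_seq)
qed

lemma phi_sum: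
  assumes I: "finite I" "\<And>i. i \<in> I \<Longrightarrow> regular (a i)" and z: "z \<in> V"
  shows "phi (\<lambda>k. \<Sum>i\<in>I. a i k) z = (\<Sum>i\<in>I. phi (a i) z)"
proof -
  obtain \<mu> where \<mu>: "good \<mu>" "\<And>i. i \<in> I \<Longrightarrow> recurrent \<mu> (a i)" using regular_common[of I a] I by metis
  obtain P where P: "transfer_family \<mu> P" using transfer_family_exists[OF \<mu>(1)] by blast
  have "phi (\<lambda>k. \<Sum>i\<in>I. a i k) z = lin (\<lambda>k. \<Sum>i\<in>I. a i k) (P z)"
    by (rule phi_eq[OF \<mu>(1) recurrent_sum[OF \<mu>(2)] P z])
  also have "\<dots> = (\<Sum>i\<in>I. lin (a i) (P z))" by (rule lin_sum_seq)
  also have "\<dots> = (\<Sum>i\<in>I. phi (a i) z)"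
    by (rule sum.cong[OF refl]) (simp add: phi_eq[OF \<mu>(1) \<mu>(2) P z])
  finally show ?thesis .
qed

lemma regular_sum:
  assumes "finite I" "\<And>i. i \<in> I \<Longrightarrow> regular (a i)" shows "regular (\<lambda>k. \<Sum>i\<in>I. a i k)"
proof -
  obtain \<mu> where "good \<mu>" "\<And>i. i \<in> I \<Longrightarrow> recurrent \<mu> (a i)" using regular_common[of I a] assms by metis
  thus ?thesis unfolding regular_def using recurrent_sum by blast
qed

lemma phi_add:
  assumes "regular a" "regular b" "z \<in> V" shows "phi (\<lambda>k. a k + b k) z = phi a z + phi b z"
  using phi_sum[of "UNIV :: bool set" "\<lambda>i. if i then a else b" z] assms
  by (simp add: UNIV_bool add.commute)

lemma shift_step_linear:
  "shift_step (\<lambda>z. \<Sum>i\<in>I. c i * f i z) a b = (\<Sum>i\<in>I. c i * shift_step (f i) a b)"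
  unfolding shift_step_def
  by (simp add: sum_distrib_left sum_subtractf right_diff_distrib mult_ac flip: sum_divide_distrib)

lemma DA_const: "(\<lambda>z\<in>V. d) \<in> DA \<Lambda>"
  unfolding DA_iff rhombus_defect_def using corner_vertex by simp

lemma rhombus_defect_linear:
  "rhombus_defect (\<lambda>z. c * f z + g z) p u v = c * rhombus_defect f p u v + rhombus_defect g p u v"
  unfolding rhombus_defect_def by (simp add: algebra_simps)

lemma rhombus_defect_sum:
  "rhombus_defect (\<lambda>z. \<Sum>i\<in>I. c i * f i z) p u v = (\<Sum>i\<in>I. c i * rhombus_defect (f i) p u v)"
proof (induction I rule: infinite_finite_induct)
  case (insert i I)
  thus ?case using rhombus_defect_linear[of "c i" "f i" "\<lambda>z. \<Sum>i\<in>I. c i * f i z"] by simp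
qed (simp_all add: rhombus_defect_def)

lemma rhombus_defect_cong:
  assumes "rhomb u v" "tile p u v \<in> \<Lambda>" "\<And>z. z \<in> V \<Longrightarrow> f z = g z"
  shows "rhombus_defect f p u v = rhombus_defect g p u v"
  unfolding rhombus_defect_def using assms(3) corner_vertex[OF assms(1,2)] by simp

lemma DA_sum:
  assumes "\<And>i. i \<in> I \<Longrightarrow> f i \<in> DA \<Lambda>"
  shows "(\<lambda>z\<in>V. \<Sum>i\<in>I. c i * f i z) \<in> DA \<Lambda>"
  unfolding DA_iff
proof (intro conjI allI impI)
  fix p u v assume T: "rhomb u v" "tile p u v \<in> \<Lambda>"
  have "rhombus_defect (\<lambda>z\<in>V. \<Sum>i\<in>I. c i * f i z) p u v = rhombus_defect (\<lambda>z. \<Sum>i\<in>I. c i * f i z) p u v"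
    by (rule rhombus_defect_cong[OF T]) simp
  also have "\<dots> = 0" unfolding rhombus_defect_sum using DA_imp_rhombus[OF assms T] by simp
  finally show "rhombus_defect (\<lambda>z\<in>V. \<Sum>i\<in>I. c i * f i z) p u v = 0" .
qed simp

lemma DA_add:
  assumes "f \<in> DA \<Lambda>" "g \<in> DA \<Lambda>" shows "(\<lambda>z\<in>V. f z + g z) \<in> DA \<Lambda>"
  using DA_sum[of UNIV "\<lambda>i. if i then f else g" "\<lambda>_. 1"] assms
  by (simp add: UNIV_bool add.commute cong: restrict_cong)

lemma Z_plus_sum:
  assumes f: "\<And>i. i \<in> I \<Longrightarrow> f i \<in> DA \<Lambda>" and z: "z \<in> V"
  shows "Z_plus \<Lambda> (\<lambda>z\<in>V. \<Sum>i\<in>I. c i * f i z) z = (\<Sum>i\<in>I. c i * Z_plus \<Lambda> (f i) z)"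
proof (rule Z_plus_eqI[where h = "\<lambda>z. \<Sum>i\<in>I. c i * Z_plus \<Lambda> (f i) z", OF DA_sum[OF f] _ _ z])
  show "(\<Sum>i\<in>I. c i * Z_plus \<Lambda> (f i) 0) = 0" using Z_plus_zero[OF f] by simp
  fix a b assume ab: "(a, b) \<in> edges \<Lambda>"
  have "(\<Sum>i\<in>I. c i * Z_plus \<Lambda> (f i) b) - (\<Sum>i\<in>I. c i * Z_plus \<Lambda> (f i) a)
      = (\<Sum>i\<in>I. c i * (Z_plus \<Lambda> (f i) b - Z_plus \<Lambda> (f i) a))"
    by (simp add: sum_subtractf right_diff_distrib)
  also have "\<dots> = (\<Sum>i\<in>I. c i * shift_step (f i) a b)" using Z_plus_edge[OF f ab] by simp
  also have "\<dots> = shift_step (\<lambda>z\<in>V. \<Sum>i\<in>I. c i * f i z) a b"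
    unfolding shift_step_linear[symmetric] unfolding shift_step_def using edge_vertices[OF ab] by simp
  finally show "(\<Sum>i\<in>I. c i * Z_plus \<Lambda> (f i) b) - (\<Sum>i\<in>I. c i * Z_plus \<Lambda> (f i) a)
      = shift_step (\<lambda>z\<in>V. \<Sum>i\<in>I. c i * f i z) a b" .
qed auto

text \<open>The rational function whose iterated backward shifts have the values \<open>d, a 0, a 1, \<dots>\<close> at the origin.\<close>

definition rfun :: "complex \<Rightarrow> (nat \<Rightarrow> complex) \<Rightarrow> complex \<Rightarrow> complex" where
  "rfun d a = (\<lambda>z\<in>V. d + Z_plus \<Lambda> (phi a) z)"

lemma rfun_DA: "regular a \<Longrightarrow> rfun d a \<in> DA \<Lambda>"
  using DA_add[OF DA_const[of d] Z_plus_DA[OF phi_DA]] unfolding rfun_def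
  by (simp cong: restrict_cong)

lemma rfun_zero: "regular a \<Longrightarrow> rfun d a 0 = d"
  unfolding rfun_def using zero_vertex Z_plus_zero[OF phi_DA] by simp

lemma Z_minus_rfun: "regular a \<Longrightarrow> Z_minus \<Lambda> (rfun d a) = phi a"
  by (rule Z_minus_eqI) (simp_all add: phi_DA rfun_zero, simp add: rfun_def)

lemma Z_minus_phi: "regular a \<Longrightarrow> Z_minus \<Lambda> (phi a) = phi (\<lambda>k. a (Suc k))"
  by (rule Z_minus_eqI) (simp_all add: phi_DA regular_shift Z_plus_phi_shift phi_zero)

lemma rfun_add:
  assumes "regular a" "regular b" "z \<in> V"
  shows "rfun (d + e) (\<lambda>k. a k + b k) z = rfun d a z + rfun e b z"
proof -
  have p: "phi (\<lambda>k. a k + b k) = (\<lambda>z\<in>V. \<Sum>i\<in>UNIV. 1 * (if i then phi a else phi b) z)"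
  proof (rule extensionalityI[where A = V])
    show "phi (\<lambda>k. a k + b k) x = (\<lambda>z\<in>V. \<Sum>i\<in>UNIV. 1 * (if i then phi a else phi b) z) x" if "x \<in> V" for x
      using phi_add[OF assms(1,2) that] that by (simp add: UNIV_bool)
  qed (simp_all add: phi_extensional)
  have "Z_plus \<Lambda> (phi (\<lambda>k. a k + b k)) z = (\<Sum>i\<in>UNIV. 1 * Z_plus \<Lambda> (if i then phi a else phi b) z)"
    unfolding p by (rule Z_plus_sum) (use assms phi_DA in auto)
  thus ?thesis unfolding rfun_def using assms(3) by (simp add: UNIV_bool)
qed

lemma rfun_scale:
  assumes "regular a" "z \<in> V"
  shows "rfun (c * d) (\<lambda>k. c * a k) z = c * rfun d a z"
proof -
  have p: "phi (\<lambda>k. c * a k) = (\<lambda>z\<in>V. \<Sum>i\<in>{True}. c * phi a z)"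
  proof (rule extensionalityI[where A = V])
    show "phi (\<lambda>k. c * a k) x = (\<lambda>z\<in>V. \<Sum>i\<in>{True}. c * phi a z) x" if "x \<in> V" for x
      using phi_scale[OF assms(1) that] that by simp
  qed (simp_all add: phi_extensional)
  have "Z_plus \<Lambda> (phi (\<lambda>k. c * a k)) z = (\<Sum>i\<in>{True}. c * Z_plus \<Lambda> (phi a) z)"
    unfolding p by (rule Z_plus_sum) (use assms phi_DA in auto)
  thus ?thesis unfolding rfun_def using assms(2) by (simp add: algebra_simps)
qed

end


section \<open>Entries of matrix powers\<close>

lemma mult_mat_entry:
  assumes "A \<in> carrier_mat m l" "B \<in> carrier_mat l n" "i < m" "j < n"
  shows "(A * B) $$ (i, j) = (\<Sum>k<l. A $$ (i, k) * B $$ (k, j))"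
  using assms by (simp add: scalar_prod_def lessThan_atLeast0)

text \<open>An entry of the powers of a matrix, as a sequence in the exponent.\<close>

definition power_entry :: "complex mat \<Rightarrow> nat \<Rightarrow> nat \<Rightarrow> nat \<Rightarrow> complex" where
  "power_entry A i j k = (A ^\<^sub>m k) $$ (i, j)"

context
  fixes A :: "complex mat" and l :: nat
  assumes A: "A \<in> carrier_mat l l"
begin

lemma power_entry_0: "i < l \<Longrightarrow> j < l \<Longrightarrow> power_entry A i j 0 = (if i = j then 1 else 0)"
  unfolding power_entry_def using A by simp

lemma power_entry_Suc_right:
  assumes "i < l" "j < l"
  shows "power_entry A i j (Suc k) = (\<Sum>q<l. power_entry A i q k * A $$ (q, j))"
  unfolding power_entry_def pow_mat.simps
  by (rule mult_mat_entry[OF pow_carrier_mat[OF A] A assms])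

lemma power_entry_add:
  assumes "i < l" "j < l"
  shows "power_entry A i j (n + k) = (\<Sum>q<l. power_entry A i q n * power_entry A q j k)"
  using assms(2)
proof (induction k arbitrary: j)
  case 0
  have "(\<Sum>q<l. power_entry A i q n * power_entry A q j 0) = (\<Sum>q<l. if q = j then power_entry A i q n else 0)"
    by (rule sum.cong) (use 0 in \<open>auto simp: power_entry_0\<close>)
  thus ?case using 0 by simp
next
  case (Suc k)
  have "power_entry A i j (n + Suc k) = (\<Sum>p<l. power_entry A i p (n + k) * A $$ (p, j))"
    using power_entry_Suc_right[OF assms(1) Suc.prems, of "n + k"] by simp
  also have "\<dots> = (\<Sum>p<l. \<Sum>q<l. power_entry A i q n * (power_entry A q p k * A $$ (p, j)))"
    by (rule sum.cong[OF refl]) (simp add: Suc.IH sum_distrib_right mult.assoc)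
  also have "\<dots> = (\<Sum>q<l. power_entry A i q n * (\<Sum>p<l. power_entry A q p k * A $$ (p, j)))"
    by (subst sum.swap) (simp add: sum_distrib_left)
  also have "\<dots> = (\<Sum>q<l. power_entry A i q n * power_entry A q j (Suc k))"
    by (rule sum.cong[OF refl]) (simp add: power_entry_Suc_right Suc.prems)
  finally show ?case .
qed

lemma power_entry_Suc_left:
  assumes "i < l" "j < l"
  shows "power_entry A i j (Suc k) = (\<Sum>q<l. A $$ (i, q) * power_entry A q j k)"
proof -
  have 1: "power_entry A i q (Suc 0) = A $$ (i, q)" if "q < l" for q
  proof -
    have "power_entry A i q (Suc 0) = (\<Sum>p<l. if p = i then A $$ (p, q) else 0)"
      unfolding power_entry_Suc_right[OF assms(1) that]
      by (rule sum.cong) (use assms in \<open>auto simp: power_entry_0\<close>)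
    thus ?thesis using assms by simp
  qed
  show ?thesis using power_entry_add[OF assms, of "Suc 0" k] by (simp add: 1)
qed

text \<open>Cayley--Hamilton, entry by entry: the product of the characteristic matrix and its adjugate is the
  characteristic polynomial times the identity.\<close>

lemma lin_char_poly:
  assumes ij: "i < l" "j < l"
  shows "lin (power_entry A i j) (char_poly A) = 0"
proof -
  define M where "M = char_poly_matrix A"
  define B where "B = adj_mat M"
  have M: "M \<in> carrier_mat l l" unfolding M_def using A by simp
  have B: "B \<in> carrier_mat l l" "M * B = char_poly A \<cdot>\<^sub>m 1\<^sub>m l"
    using adj_mat[OF M] unfolding B_def char_poly_def M_def by simp_all
  have entry: "M $$ (k, q) = (if k = q then [:0, 1:] else 0) - [:A $$ (k, q):]" if "k < l" "q < l" for k q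
    unfolding M_def char_poly_matrix_def using A that by simp
  have MB: "(\<Sum>q<l. M $$ (k, q) * B $$ (q, j)) = (if k = j then char_poly A else 0)" if k: "k < l" for k
    using mult_mat_entry[OF M B(1) k ij(2)] unfolding B(2) using k ij by (cases "k = j") simp_all
  have lin_sum: "lin a (\<Sum>q<n. f q) = (\<Sum>q<n. lin a (f q))" for a f and n :: nat
    by (induction n) (simp_all add: lin_add)
  have expand: "lin (power_entry A i k) (M $$ (k, q) * p) =
      (if k = q then lin (\<lambda>n. power_entry A i k (Suc n)) p else 0) - A $$ (k, q) * lin (power_entry A i k) p"
    if "k < l" "q < l" for k q p
    unfolding entry[OF that] left_diff_distrib lin_diff by (simp add: lin_smult lin_pCons)
  have vanish: "(\<Sum>k<l. lin (power_entry A i k) (M $$ (k, q) * p)) = 0" if q: "q < l" for q p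
  proof -
    have "(\<Sum>k<l. lin (power_entry A i k) (M $$ (k, q) * p)) =
        (\<Sum>k<l. if k = q then lin (\<lambda>n. power_entry A i k (Suc n)) p else 0)
        - (\<Sum>k<l. A $$ (k, q) * lin (power_entry A i k) p)"
      by (simp add: expand q sum_subtractf)
    also have "(\<Sum>k<l. if k = q then lin (\<lambda>n. power_entry A i k (Suc n)) p else 0)
        = lin (\<lambda>n. power_entry A i q (Suc n)) p"
      using q by simp
    also have "\<dots> = lin (\<lambda>n. \<Sum>k<l. A $$ (k, q) * power_entry A i k n) p"
      by (simp only: power_entry_Suc_right[OF ij(1) q] mult.commute)
    also have "\<dots> = (\<Sum>k<l. A $$ (k, q) * lin (power_entry A i k) p)"
      unfolding lin_sum_seq lin_scale_seq ..
    finally show ?thesis by simp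
  qed
  have "lin (power_entry A i j) (char_poly A) = (\<Sum>k<l. if k = j then lin (power_entry A i k) (char_poly A) else 0)"
    using ij by simp
  also have "\<dots> = (\<Sum>k<l. lin (power_entry A i k) (\<Sum>q<l. M $$ (k, q) * B $$ (q, j)))"
    by (rule sum.cong[OF refl]) (simp add: MB)
  also have "\<dots> = (\<Sum>q<l. \<Sum>k<l. lin (power_entry A i k) (M $$ (k, q) * B $$ (q, j)))"
    unfolding lin_sum by (rule sum.swap)
  also have "\<dots> = 0" by (simp add: vanish)
  finally show ?thesis .
qed

lemma recurrent_power_entry:
  assumes "i < l" "j < l"
  shows "recurrent (char_poly A) (power_entry A i j)"
  unfolding recurrent_def
proof
  fix k
  have "(\<lambda>n. power_entry A i j (n + k)) = (\<lambda>n. \<Sum>q<l. power_entry A q j k * power_entry A i q n)"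
    using power_entry_add[OF assms] by (simp add: mult.commute)
  thus "lin (\<lambda>n. power_entry A i j (n + k)) (char_poly A) = 0"
    using lin_char_poly assms(1) by (simp add: lin_sum_seq lin_scale_seq)
qed

lemma triple_product_entry:
  assumes "C \<in> carrier_mat m l" "B \<in> carrier_mat l n" "i < m" "j < n"
  shows "(C * A ^\<^sub>m k * B) $$ (i, j) = (\<Sum>(r, s)\<in>{..<l} \<times> {..<l}. C $$ (i, r) * B $$ (s, j) * power_entry A r s k)"
proof -
  note P = pow_carrier_mat[OF A]
  have "(C * A ^\<^sub>m k * B) $$ (i, j) = (\<Sum>s<l. (\<Sum>r<l. C $$ (i, r) * power_entry A r s k) * B $$ (s, j))"
    unfolding mult_mat_entry[OF mult_carrier_mat[OF assms(1) P] assms(2-4)] power_entry_def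
    by (rule sum.cong[OF refl]) (simp add: mult_mat_entry[OF assms(1) P assms(3)] del: index_mult_mat)
  also have "\<dots> = (\<Sum>r<l. \<Sum>s<l. C $$ (i, r) * B $$ (s, j) * power_entry A r s k)"
    unfolding sum_distrib_right by (subst sum.swap) (simp add: mult_ac)
  finally show ?thesis by (simp add: sum.cartesian_product)
qed

end

section \<open>Matrix-valued functions and the resolvent\<close>

text \<open>The matrix-valued function on the vertices with the entries \<open>F i j\<close>.\<close>

definition mat_fun :: "complex set set \<Rightarrow> nat \<Rightarrow> nat \<Rightarrow> (nat \<Rightarrow> nat \<Rightarrow> complex \<Rightarrow> complex) \<Rightarrow> complex \<Rightarrow> complex mat" where
  "mat_fun \<Lambda> m n F = (\<lambda>z\<in>verts \<Lambda>. Matrix.mat m n (\<lambda>(i, j). F i j z))"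

lemma mat_fun_apply [simp]: "z \<in> verts \<Lambda> \<Longrightarrow> mat_fun \<Lambda> m n F z = Matrix.mat m n (\<lambda>(i, j). F i j z)"
  unfolding mat_fun_def by simp

lemma mat_fun_cong:
  assumes "\<And>i j z. i < m \<Longrightarrow> j < n \<Longrightarrow> z \<in> verts \<Lambda> \<Longrightarrow> F i j z = G i j z"
  shows "mat_fun \<Lambda> m n F = mat_fun \<Lambda> m n G"
  unfolding mat_fun_def by (rule restrict_ext, rule cong_mat) (use assms in auto)

lemma entry_mat_fun:
  "i < m \<Longrightarrow> j < n \<Longrightarrow> (\<lambda>z\<in>verts \<Lambda>. mat_fun \<Lambda> m n F z $$ (i, j)) = restrict (F i j) (verts \<Lambda>)"
  by (rule restrict_ext) simp

lemma mat_fun_DA: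
  assumes "\<And>i j. i < m \<Longrightarrow> j < n \<Longrightarrow> restrict (F i j) (verts \<Lambda>) \<in> DA \<Lambda>"
  shows "mat_fun \<Lambda> m n F \<in> DA_mat \<Lambda> m n"
  unfolding DA_mat_def using assms entry_mat_fun[of _ m _ n \<Lambda> F]
  by (auto simp: mat_fun_def intro!: restrict_PiE_iff[THEN iffD2])

lemma entrywise_mat_fun:
  assumes "\<And>i j. i < m \<Longrightarrow> j < n \<Longrightarrow> F i j \<in> extensional (verts \<Lambda>)"
  shows "entrywise \<Lambda> Op (mat_fun \<Lambda> m n F) = mat_fun \<Lambda> m n (\<lambda>i j. Op (F i j))"
  unfolding entrywise_def mat_fun_def[of \<Lambda> m n "\<lambda>i j. Op (F i j)"]
proof (rule restrict_ext, rule cong_mat)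
  fix z i j assume z: "z \<in> verts \<Lambda>"
  show "dim_row (mat_fun \<Lambda> m n F z) = m" "dim_col (mat_fun \<Lambda> m n F z) = n" using z by simp_all
  assume "i < dim_row (mat_fun \<Lambda> m n F z)" "j < dim_col (mat_fun \<Lambda> m n F z)"
  hence ij: "i < m" "j < n" using z by simp_all
  have "(\<lambda>w\<in>verts \<Lambda>. mat_fun \<Lambda> m n F w $$ (i, j)) = F i j"
    unfolding entry_mat_fun[OF ij] by (rule extensional_restrict[OF assms[OF ij]])
  thus "(case (i, j) of (i, j) \<Rightarrow> Op (\<lambda>w\<in>verts \<Lambda>. mat_fun \<Lambda> m n F w $$ (i, j)) z) =
      (case (i, j) of (i, j) \<Rightarrow> Op (F i j) z)" by simp
qed

lemma mat_fun_entries: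
  assumes "X \<in> verts \<Lambda> \<rightarrow>\<^sub>E carrier_mat m n"
  shows "X = mat_fun \<Lambda> m n (\<lambda>i j. \<lambda>z\<in>verts \<Lambda>. X z $$ (i, j))"
proof (rule extensionalityI[where A = "verts \<Lambda>"])
  show "X \<in> extensional (verts \<Lambda>)" using assms by (simp add: PiE_def)
  show "mat_fun \<Lambda> m n (\<lambda>i j. \<lambda>z\<in>verts \<Lambda>. X z $$ (i, j)) \<in> extensional (verts \<Lambda>)"
    unfolding mat_fun_def by simp
  fix z assume z: "z \<in> verts \<Lambda>"
  have "X z \<in> carrier_mat m n" using assms z by auto
  thus "X z = mat_fun \<Lambda> m n (\<lambda>i j. \<lambda>z\<in>verts \<Lambda>. X z $$ (i, j)) z"
    using z by (intro eq_matI) auto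
qed

context rooted_reachable_tiling begin

lemma good_char_poly:
  assumes A: "A \<in> carrier_mat l l" and S: "S \<inter> spectrum A = {}"
  shows "good (char_poly A)"
proof -
  have "char_poly A \<noteq> 0" using degree_monic_char_poly[OF A] by auto
  moreover have "poly (char_poly A) t \<noteq> 0" if "t \<in> S" for t
    using spectrum_root_char_poly[OF A] S that by auto
  ultimately show ?thesis unfolding good_def by simp
qed

lemma Z_plus_phi_sum:
  assumes I: "finite I" "\<And>i. i \<in> I \<Longrightarrow> regular (a i)" and z: "z \<in> V"
  shows "Z_plus \<Lambda> (phi (\<lambda>k. \<Sum>i\<in>I. c i * a i k)) z = (\<Sum>i\<in>I. c i * Z_plus \<Lambda> (phi (a i)) z)"
proof -
  have "phi (\<lambda>k. \<Sum>i\<in>I. c i * a i k) = (\<lambda>z\<in>V. \<Sum>i\<in>I. c i * phi (a i) z)"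
  proof (rule extensionalityI[where A = V])
    fix x assume x: "x \<in> V"
    have "phi (\<lambda>k. \<Sum>i\<in>I. c i * a i k) x = (\<Sum>i\<in>I. phi (\<lambda>k. c i * a i k) x)"
      by (rule phi_sum[OF I(1) regular_scale[OF I(2)] x])
    also have "\<dots> = (\<Sum>i\<in>I. c i * phi (a i) x)"
      by (rule sum.cong[OF refl]) (rule phi_scale[OF I(2) x])
    finally show "phi (\<lambda>k. \<Sum>i\<in>I. c i * a i k) x = (\<lambda>z\<in>V. \<Sum>i\<in>I. c i * phi (a i) z) x" using x by simp
  qed (simp_all add: phi_extensional)
  thus ?thesis using Z_plus_sum[OF phi_DA[OF I(2)] z] by simp
qed

lemma conv_poly_right_linear:
  assumes G: "\<And>i j. i < m \<Longrightarrow> j < l \<Longrightarrow> G i j \<in> extensional V"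
    and P: "P0 \<in> carrier_mat l n" "P1 \<in> carrier_mat l n" and z: "z \<in> V" and ij: "i < m" "j < n"
  shows "conv_poly_right \<Lambda> (mat_fun \<Lambda> m l G) [P0, P1] z $$ (i, j) =
    (\<Sum>k<l. G i k z * P0 $$ (k, j)) + (\<Sum>k<l. Z_plus \<Lambda> (G i k) z * P1 $$ (k, j))"
proof -
  have ew: "Z_plus_mat \<Lambda> (mat_fun \<Lambda> m l G) = mat_fun \<Lambda> m l (\<lambda>i j. Z_plus \<Lambda> (G i j))"
    by (rule entrywise_mat_fun[OF G])
  have mult: "(mat_fun \<Lambda> m l H z * P) $$ (i, j) = (\<Sum>k<l. H i k z * P $$ (k, j))"
    if P: "P \<in> carrier_mat l n" for H P
  proof -
    have "mat_fun \<Lambda> m l H z \<in> carrier_mat m l" using z by simp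
    from mult_mat_entry[OF this P ij] show ?thesis using z ij by simp
  qed
  have d: "dim_row (mat_fun \<Lambda> m l G z) = m" using z by simp
  have "conv_poly_right \<Lambda> (mat_fun \<Lambda> m l G) [P0, P1] z $$ (i, j) =
      (mat_fun \<Lambda> m l G z * P0) $$ (i, j) + (mat_fun \<Lambda> m l (\<lambda>i j. Z_plus \<Lambda> (G i j)) z * P1) $$ (i, j)"
    unfolding conv_poly_right_def using z ij P by (simp add: d ew del: index_mult_mat(1) mat_fun_apply)
  thus ?thesis unfolding mult[OF P(1)] mult[OF P(2)] .
qed

lemma conv_poly_right_dim:
  assumes "z \<in> V" "dim_col P0 = n"
  shows "dim_row (conv_poly_right \<Lambda> (mat_fun \<Lambda> m l G) [P0, P1] z) = m"
    "dim_col (conv_poly_right \<Lambda> (mat_fun \<Lambda> m l G) [P0, P1] z) = n"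
  unfolding conv_poly_right_def using assms by simp_all

lemma conv_poly_left_linear:
  assumes G: "\<And>i j. i < l \<Longrightarrow> j < n \<Longrightarrow> G i j \<in> extensional V"
    and P: "P0 \<in> carrier_mat m l" "P1 \<in> carrier_mat m l" and z: "z \<in> V" and ij: "i < m" "j < n"
  shows "conv_poly_left \<Lambda> [P0, P1] (mat_fun \<Lambda> l n G) z $$ (i, j) =
    (\<Sum>k<l. P0 $$ (i, k) * G k j z) + (\<Sum>k<l. P1 $$ (i, k) * Z_plus \<Lambda> (G k j) z)"
proof -
  have ew: "Z_plus_mat \<Lambda> (mat_fun \<Lambda> l n G) = mat_fun \<Lambda> l n (\<lambda>i j. Z_plus \<Lambda> (G i j))"
    by (rule entrywise_mat_fun[OF G])
  have mult: "(P * mat_fun \<Lambda> l n H z) $$ (i, j) = (\<Sum>k<l. P $$ (i, k) * H k j z)"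
    if P: "P \<in> carrier_mat m l" for H P
  proof -
    have "mat_fun \<Lambda> l n H z \<in> carrier_mat l n" using z by simp
    from mult_mat_entry[OF P this ij] show ?thesis using z ij by simp
  qed
  have d: "dim_col (mat_fun \<Lambda> l n G z) = n" using z by simp
  have "conv_poly_left \<Lambda> [P0, P1] (mat_fun \<Lambda> l n G) z $$ (i, j) =
      (P0 * mat_fun \<Lambda> l n G z) $$ (i, j) + (P1 * mat_fun \<Lambda> l n (\<lambda>i j. Z_plus \<Lambda> (G i j)) z) $$ (i, j)"
    unfolding conv_poly_left_def using z ij P by (simp add: d ew del: index_mult_mat(1) mat_fun_apply)
  thus ?thesis unfolding mult[OF P(1)] mult[OF P(2)] .
qed

lemma sum_one_mat:
  assumes "i < l" shows "(\<Sum>k<l. 1\<^sub>m l $$ (i, k) * g k) = (g i :: complex)" "(\<Sum>k<l. g k * 1\<^sub>m l $$ (k, i)) = (g i :: complex)"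
proof -
  have "(\<Sum>k<l. 1\<^sub>m l $$ (i, k) * g k) = (\<Sum>k<l. if k = i then g k else 0)"
    by (rule sum.cong) (use assms in auto)
  thus "(\<Sum>k<l. 1\<^sub>m l $$ (i, k) * g k) = g i" using assms by simp
  have "(\<Sum>k<l. g k * 1\<^sub>m l $$ (k, i)) = (\<Sum>k<l. if k = i then g k else 0)"
    by (rule sum.cong) (use assms in auto)
  thus "(\<Sum>k<l. g k * 1\<^sub>m l $$ (k, i)) = g i" using assms by simp
qed

context
  fixes A :: "complex mat" and l :: nat
  assumes A: "A \<in> carrier_mat l l" and S: "S \<inter> spectrum A = {}"
begin

lemma regular_power_entry: "i < l \<Longrightarrow> j < l \<Longrightarrow> regular (power_entry A i j)"
  unfolding regular_def using good_char_poly[OF A S] recurrent_power_entry[OF A] by blast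

text \<open>The inverse of \<open>I - zA\<close> for the convolution product.\<close>

definition resolvent :: "complex \<Rightarrow> complex mat" where
  "resolvent = mat_fun \<Lambda> l l (\<lambda>i j. phi (power_entry A i j))"

lemma Z_plus_power_entry_left:
  assumes ij: "i < l" "j < l" and z: "z \<in> V"
  shows "(\<Sum>k<l. A $$ (i, k) * Z_plus \<Lambda> (phi (power_entry A k j)) z) = phi (power_entry A i j) z - (if i = j then 1 else 0)"
proof -
  have "(\<Sum>k<l. A $$ (i, k) * Z_plus \<Lambda> (phi (power_entry A k j)) z)
      = Z_plus \<Lambda> (phi (\<lambda>n. \<Sum>k<l. A $$ (i, k) * power_entry A k j n)) z"
    by (rule Z_plus_phi_sum[symmetric, OF _ _ z]) (use regular_power_entry ij in auto)
  also have "\<dots> = Z_plus \<Lambda> (phi (\<lambda>n. power_entry A i j (Suc n))) z"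
    by (simp only: power_entry_Suc_left[OF A ij])
  also have "\<dots> = phi (power_entry A i j) z - (if i = j then 1 else 0)"
    using Z_plus_phi_shift[OF regular_power_entry[OF ij] z] power_entry_0[OF A ij] by simp
  finally show ?thesis .
qed

lemma Z_plus_power_entry_right:
  assumes ij: "i < l" "j < l" and z: "z \<in> V"
  shows "(\<Sum>k<l. Z_plus \<Lambda> (phi (power_entry A i k)) z * A $$ (k, j)) = phi (power_entry A i j) z - (if i = j then 1 else 0)"
proof -
  have "(\<Sum>k<l. Z_plus \<Lambda> (phi (power_entry A i k)) z * A $$ (k, j))
      = (\<Sum>k<l. A $$ (k, j) * Z_plus \<Lambda> (phi (power_entry A i k)) z)"
    by (simp only: mult.commute)
  also have "\<dots> = Z_plus \<Lambda> (phi (\<lambda>n. \<Sum>k<l. A $$ (k, j) * power_entry A i k n)) z"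
    by (rule Z_plus_phi_sum[symmetric, OF _ _ z]) (use regular_power_entry ij in auto)
  also have "(\<lambda>n. \<Sum>k<l. A $$ (k, j) * power_entry A i k n) = (\<lambda>n. power_entry A i j (Suc n))"
    by (rule ext) (simp only: power_entry_Suc_right[OF A ij] mult.commute)
  also have "Z_plus \<Lambda> (phi (\<lambda>n. power_entry A i j (Suc n))) z = phi (power_entry A i j) z - (if i = j then 1 else 0)"
    using Z_plus_phi_shift[OF regular_power_entry[OF ij] z] power_entry_0[OF A ij] by simp
  finally show ?thesis .
qed

lemma resolvent_right_inverse:
  "conv_poly_right \<Lambda> resolvent [1\<^sub>m l, - A] = (\<lambda>z\<in>V. 1\<^sub>m l)"
proof (rule extensionalityI[where A = V])
  fix z assume z: "z \<in> V"
  have "conv_poly_right \<Lambda> resolvent [1\<^sub>m l, - A] z = 1\<^sub>m l"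
  proof (rule eq_matI)
    fix i j assume "i < dim_row (1\<^sub>m l :: complex mat)" "j < dim_col (1\<^sub>m l :: complex mat)"
    hence ij: "i < l" "j < l" by simp_all
    have mA: "- A \<in> carrier_mat l l" using A by simp
    have "(\<Sum>k<l. Z_plus \<Lambda> (phi (power_entry A i k)) z * (- A) $$ (k, j))
       = - (\<Sum>k<l. Z_plus \<Lambda> (phi (power_entry A i k)) z * A $$ (k, j))"
      unfolding sum_negf[symmetric] by (rule sum.cong) (use A ij in auto)
    thus "conv_poly_right \<Lambda> resolvent [1\<^sub>m l, - A] z $$ (i, j) = 1\<^sub>m l $$ (i, j)"
      unfolding resolvent_def conv_poly_right_linear[OF phi_extensional one_carrier_mat mA z ij]
        sum_one_mat(2)[OF ij(2)] Z_plus_power_entry_right[OF ij z]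
      using ij by simp
  qed (use conv_poly_right_dim[OF z, of "1\<^sub>m l" l] in \<open>simp_all add: resolvent_def\<close>)
  thus "conv_poly_right \<Lambda> resolvent [1\<^sub>m l, - A] z = (\<lambda>z\<in>V. 1\<^sub>m l) z" using z by simp
qed (simp_all add: conv_poly_right_def)

lemma resolvent_left_inverse:
  "conv_poly_left \<Lambda> [1\<^sub>m l, - A] resolvent = (\<lambda>z\<in>V. 1\<^sub>m l)"
proof (rule extensionalityI[where A = V])
  fix z assume z: "z \<in> V"
  have "conv_poly_left \<Lambda> [1\<^sub>m l, - A] resolvent z = 1\<^sub>m l"
  proof (rule eq_matI)
    fix i j assume "i < dim_row (1\<^sub>m l :: complex mat)" "j < dim_col (1\<^sub>m l :: complex mat)"
    hence ij: "i < l" "j < l" by simp_all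
    have mA: "- A \<in> carrier_mat l l" using A by simp
    have "(\<Sum>k<l. (- A) $$ (i, k) * Z_plus \<Lambda> (phi (power_entry A k j)) z)
       = - (\<Sum>k<l. A $$ (i, k) * Z_plus \<Lambda> (phi (power_entry A k j)) z)"
      unfolding sum_negf[symmetric] by (rule sum.cong) (use A ij in auto)
    thus "conv_poly_left \<Lambda> [1\<^sub>m l, - A] resolvent z $$ (i, j) = 1\<^sub>m l $$ (i, j)"
      unfolding resolvent_def conv_poly_left_linear[OF phi_extensional one_carrier_mat mA z ij]
        sum_one_mat(1)[OF ij(1)] Z_plus_power_entry_left[OF ij z]
      using ij by simp
  qed (use z in \<open>simp_all add: resolvent_def conv_poly_left_def\<close>)
  thus "conv_poly_left \<Lambda> [1\<^sub>m l, - A] resolvent z = (\<lambda>z\<in>V. 1\<^sub>m l) z" using z by simp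
qed (simp_all add: conv_poly_left_def)

text \<open>No element of \<open>S\<close> is an eigenvalue of the transpose of \<open>A\<close>.\<close>

lemma left_eigenvector_zero:
  assumes r: "\<And>j. j < l \<Longrightarrow> (\<Sum>k<l. r k * A $$ (k, j)) = s * r j" and s: "s \<in> S" and j: "j < l"
  shows "r j = 0"
proof -
  have pow: "(\<Sum>k<l. r k * power_entry A k j e) = s ^ e * r j" if "j < l" for j e
    using that
  proof (induction e arbitrary: j)
    case 0
    have "(\<Sum>k<l. r k * power_entry A k j 0) = (\<Sum>k<l. if k = j then r k else 0)"
      by (rule sum.cong) (use 0 in \<open>auto simp: power_entry_0[OF A]\<close>)
    thus ?case using 0 by simp
  next
    case (Suc e)
    have "(\<Sum>k<l. r k * power_entry A k j (Suc e)) = (\<Sum>k<l. \<Sum>q<l. r k * power_entry A k q e * A $$ (q, j))"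
      by (rule sum.cong[OF refl]) (simp add: power_entry_Suc_right[OF A _ Suc.prems] sum_distrib_left mult.assoc)
    also have "\<dots> = (\<Sum>q<l. (\<Sum>k<l. r k * power_entry A k q e) * A $$ (q, j))"
      by (subst sum.swap) (simp add: sum_distrib_right)
    also have "\<dots> = (\<Sum>q<l. s ^ e * (r q * A $$ (q, j)))"
      by (rule sum.cong[OF refl]) (simp add: Suc.IH mult.assoc)
    also have "\<dots> = s ^ Suc e * r j" unfolding sum_distrib_left[symmetric] r[OF Suc.prems] by simp
    finally show ?case .
  qed
  have "0 = (\<Sum>k<l. r k * lin (power_entry A k j) (char_poly A))" using lin_char_poly[OF A _ j] by simp
  also have "\<dots> = lin (\<lambda>e. \<Sum>k<l. r k * power_entry A k j e) (char_poly A)"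
    unfolding lin_sum_seq lin_scale_seq ..
  also have "\<dots> = lin (\<lambda>e. r j * s ^ e) (char_poly A)" by (simp add: pow[OF j] mult.commute)
  also have "\<dots> = r j * poly (char_poly A) s"
    unfolding lin_scale_seq unfolding lin_def poly_altdef ..
  finally show ?thesis using good_char_poly[OF A S] s unfolding good_def by auto
qed

text \<open>The difference of two solutions vanishes at the origin and its zeros propagate along edges.\<close>

lemma resolvent_unique:
  assumes Y: "Y \<in> DA_mat \<Lambda> l l" and inv: "conv_poly_right \<Lambda> Y [1\<^sub>m l, - A] = (\<lambda>z\<in>V. 1\<^sub>m l)"
  shows "Y = resolvent"
proof -
  define y where "y i j = (\<lambda>z\<in>V. Y z $$ (i, j))" for i j
  have Yy: "Y = mat_fun \<Lambda> l l y"
    unfolding y_def by (rule mat_fun_entries) (use Y in \<open>simp add: DA_mat_def\<close>)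
  have DA: "y i j \<in> DA \<Lambda>" if "i < l" "j < l" for i j
    unfolding y_def using Y that by (simp add: DA_mat_def)
  have mA: "- A \<in> carrier_mat l l" using A by simp
  have eq: "y i j z - (\<Sum>k<l. Z_plus \<Lambda> (y i k) z * A $$ (k, j)) = (if i = j then 1 else 0)"
    if ij: "i < l" "j < l" and z: "z \<in> V" for i j z
  proof -
    have "(\<Sum>k<l. Z_plus \<Lambda> (y i k) z * (- A) $$ (k, j)) = - (\<Sum>k<l. Z_plus \<Lambda> (y i k) z * A $$ (k, j))"
      unfolding sum_negf[symmetric] by (rule sum.cong) (use A ij in auto)
    moreover have "conv_poly_right \<Lambda> Y [1\<^sub>m l, - A] z $$ (i, j) = (if i = j then 1 else 0)"
      unfolding inv using z ij by simp
    moreover have "conv_poly_right \<Lambda> (mat_fun \<Lambda> l l y) [1\<^sub>m l, - A] z $$ (i, j) =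
        (\<Sum>k<l. y i k z * 1\<^sub>m l $$ (k, j)) + (\<Sum>k<l. Z_plus \<Lambda> (y i k) z * (- A) $$ (k, j))"
      by (rule conv_poly_right_linear[OF _ one_carrier_mat mA z ij]) (rule DA_extensional[OF DA])
    hence "conv_poly_right \<Lambda> Y [1\<^sub>m l, - A] z $$ (i, j) =
        y i j z + (\<Sum>k<l. Z_plus \<Lambda> (y i k) z * (- A) $$ (k, j))"
      unfolding sum_one_mat(2)[OF ij(2)] Yy[symmetric] .
    ultimately show ?thesis by simp
  qed
  define w where "w i j z = y i j z - phi (power_entry A i j) z" for i j z
  have w0: "w i j z = 0" if i: "i < l" and j: "j < l" and z: "z \<in> V" for i j z
  proof -
    have step: "\<forall>j<l. w i j b = 0" if ab: "(a, b) \<in> edges \<Lambda>" and a: "\<forall>j<l. w i j a = 0" for a b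
    proof -
      let ?c = "(1 - (b - a)) / 2"
      have w: "w i j b = - ?c * (\<Sum>k<l. w i k b * A $$ (k, j))" if j: "j < l" for j
      proof -
        let ?Z = "\<lambda>k z. Z_plus \<Lambda> (y i k) z - Z_plus \<Lambda> (phi (power_entry A i k)) z"
        have wz: "w i j z = (\<Sum>k<l. ?Z k z * A $$ (k, j))" if z: "z \<in> V" for z
          using eq[OF i j z] Z_plus_power_entry_right[OF i j z] unfolding w_def
          by (simp add: left_diff_distrib sum_subtractf algebra_simps)
        have Zd: "?Z k b - ?Z k a = - ?c * w i k b" if k: "k < l" for k
        proof -
          have "?Z k b - ?Z k a = shift_step (y i k) a b - shift_step (phi (power_entry A i k)) a b"
            using Z_plus_edge[OF DA[OF i k] ab] Z_plus_edge[OF phi_DA[OF regular_power_entry[OF i k]] ab]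
            by (simp add: algebra_simps)
          also have "\<dots> = ((1 + (b - a)) * w i k a - (1 - (b - a)) * w i k b) / 2"
            unfolding shift_step_def w_def by (simp add: field_simps)
          finally show ?thesis using a k by simp
        qed
        have "w i j b = w i j b - w i j a" using a j by simp
        also have "\<dots> = (\<Sum>k<l. (?Z k b - ?Z k a) * A $$ (k, j))"
          unfolding wz[OF edge_vertices(1)[OF ab]] wz[OF edge_vertices(2)[OF ab]]
          by (simp add: left_diff_distrib sum_subtractf)
        also have "\<dots> = (\<Sum>k<l. - ?c * (w i k b * A $$ (k, j)))"
          by (rule sum.cong[OF refl]) (simp add: Zd)
        finally show ?thesis unfolding sum_distrib_left .
      qed
      show ?thesis
      proof (cases "b - a = 1")
        case True
        thus ?thesis using w by simp
      next
        case False
        \<comment> \<open>The rows of the difference at \<open>b\<close> are left eigenvectors of \<open>A\<close> for the eigenvalue \<open>-2 / (1 - (b - a))\<close>.\<close>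
        define s where "s = - 1 / ?c"
        have c0: "?c \<noteq> 0" using False by simp
        have cancel: "- c * x = y \<longleftrightarrow> x = - 1 / c * y" if "c \<noteq> 0" for c x y :: complex
          using that by (auto simp: field_simps)
        have "(\<Sum>k<l. w i k b * A $$ (k, j)) = s * w i j b" if "j < l" for j
          using w[OF that] cancel[OF c0] unfolding s_def by metis
        moreover have "s \<in> S"
        proof -
          have two: "- 1 / c * (2 * c) = -2" if "c \<noteq> 0" for c :: complex using that by simp
          have "1 + a - b = 2 * ?c" by simp
          hence "s * (1 + a - b) = -2" unfolding s_def by (simp only: two[OF c0])
          thus ?thesis unfolding S_iff using edges_sym[OF ab] by blast
        qed
        ultimately show ?thesis using left_eigenvector_zero[of "\<lambda>k. w i k b" s] by blast
      qed
    qed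
    have "(\<forall>j<l. w i j z = 0) = (\<forall>j<l. w i j 0 = 0)"
      by (rule constant_along_edges[where P = "\<lambda>z. \<forall>j<l. w i j z = 0", OF _ z zero_vertex])
        (use step edges_sym in blast)
    moreover have "w i j 0 = 0" if j: "j < l" for j
    proof -
      have "(\<Sum>k<l. Z_plus \<Lambda> (y i k) 0 * A $$ (k, j)) = 0"
        by (rule sum.neutral) (use Z_plus_zero[OF DA[OF i]] in auto)
      thus ?thesis
        using eq[OF i j zero_vertex] phi_zero[OF regular_power_entry[OF i j]] power_entry_0[OF A i j]
        unfolding w_def by simp
    qed
    ultimately show ?thesis using j by blast
  qed
  show ?thesis unfolding Yy resolvent_def
    by (rule mat_fun_cong) (use w0 in \<open>simp add: w_def\<close>)
qed

lemma resolvent_DA_eq: "resolvent_DA \<Lambda> l A = resolvent"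
  unfolding resolvent_DA_def
proof (rule the_equality)
  have "resolvent \<in> DA_mat \<Lambda> l l"
    unfolding resolvent_def
    by (rule mat_fun_DA) (simp add: extensional_restrict[OF phi_extensional] phi_DA regular_power_entry)
  thus "resolvent \<in> DA_mat \<Lambda> l l \<and> conv_poly_left \<Lambda> [1\<^sub>m l, - A] resolvent = (\<lambda>z\<in>V. 1\<^sub>m l) \<and>
     conv_poly_right \<Lambda> resolvent [1\<^sub>m l, - A] = (\<lambda>z\<in>V. 1\<^sub>m l)"
    using resolvent_left_inverse resolvent_right_inverse by blast
qed (use resolvent_unique in blast)

lemma regular_triple_product:
  assumes "C \<in> carrier_mat m l" "B \<in> carrier_mat l n" "i < m" "j < n"
  shows "regular (\<lambda>k. (C * A ^\<^sub>m k * B) $$ (i, j))"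
  unfolding triple_product_entry[OF A assms]
  unfolding case_prod_unfold by (intro regular_sum regular_scale regular_power_entry) auto

lemma realization_function:
  assumes C: "C \<in> carrier_mat m l" and B: "B \<in> carrier_mat l n" and D: "D \<in> carrier_mat m n"
  shows "(\<lambda>z\<in>V. D + C * conv_poly_right \<Lambda> (resolvent_DA \<Lambda> l A) [0\<^sub>m l n, B] z) =
    mat_fun \<Lambda> m n (\<lambda>i j. rfun (D $$ (i, j)) (\<lambda>k. (C * A ^\<^sub>m k * B) $$ (i, j)))"
  unfolding resolvent_DA_eq mat_fun_def[of \<Lambda> m n]
proof (rule restrict_ext, rule eq_matI)
  fix z i j assume z: "z \<in> V"
  let ?R = "conv_poly_right \<Lambda> resolvent [0\<^sub>m l n, B] z"
  have R: "?R \<in> carrier_mat l n"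
    unfolding resolvent_def using conv_poly_right_dim[OF z, of "0\<^sub>m l n" n] by (intro carrier_matI) simp_all
  assume "i < dim_row (Matrix.mat m n (\<lambda>(i, j). rfun (D $$ (i, j)) (\<lambda>k. (C * A ^\<^sub>m k * B) $$ (i, j)) z))"
    and "j < dim_col (Matrix.mat m n (\<lambda>(i, j). rfun (D $$ (i, j)) (\<lambda>k. (C * A ^\<^sub>m k * B) $$ (i, j)) z))"
  hence ij: "i < m" "j < n" by simp_all
  have Rk: "?R $$ (r, j) = (\<Sum>s<l. Z_plus \<Lambda> (phi (power_entry A r s)) z * B $$ (s, j))" if r: "r < l" for r
  proof -
    have "(\<Sum>k<l. phi (power_entry A r k) z * 0\<^sub>m l n $$ (k, j)) = 0"
      by (rule sum.neutral) (use ij in auto)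
    thus ?thesis unfolding resolvent_def
      conv_poly_right_linear[OF phi_extensional zero_carrier_mat B z r ij(2)] by simp
  qed
  have "(C * ?R) $$ (i, j) = (\<Sum>r<l. \<Sum>s<l. C $$ (i, r) * B $$ (s, j) * Z_plus \<Lambda> (phi (power_entry A r s)) z)"
    unfolding mult_mat_entry[OF C R ij]
    by (rule sum.cong[OF refl]) (simp add: Rk sum_distrib_left mult_ac)
  also have "\<dots> = (\<Sum>(r, s)\<in>{..<l} \<times> {..<l}. C $$ (i, r) * B $$ (s, j) * Z_plus \<Lambda> (phi (power_entry A r s)) z)"
    by (simp add: sum.cartesian_product)
  also have "\<dots> = Z_plus \<Lambda> (phi (\<lambda>k. (C * A ^\<^sub>m k * B) $$ (i, j))) z"
    unfolding triple_product_entry[OF A C B ij] case_prod_unfold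
    by (rule Z_plus_phi_sum[symmetric, OF _ _ z]) (auto intro: regular_power_entry)
  finally have "(C * ?R) $$ (i, j) = Z_plus \<Lambda> (phi (\<lambda>k. (C * A ^\<^sub>m k * B) $$ (i, j))) z" .
  thus "(D + C * ?R) $$ (i, j) = Matrix.mat m n (\<lambda>(i, j). rfun (D $$ (i, j)) (\<lambda>k. (C * A ^\<^sub>m k * B) $$ (i, j)) z) $$ (i, j)"
    using ij C D R z by (simp add: rfun_def del: index_mult_mat(1))
next
  fix z assume z: "z \<in> V"
  show "dim_row (D + C * conv_poly_right \<Lambda> resolvent [0\<^sub>m l n, B] z) =
     dim_row (Matrix.mat m n (\<lambda>(i, j). rfun (D $$ (i, j)) (\<lambda>k. (C * A ^\<^sub>m k * B) $$ (i, j)) z))"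
    using C by simp
  show "dim_col (D + C * conv_poly_right \<Lambda> resolvent [0\<^sub>m l n, B] z) =
     dim_col (Matrix.mat m n (\<lambda>(i, j). rfun (D $$ (i, j)) (\<lambda>k. (C * A ^\<^sub>m k * B) $$ (i, j)) z))"
    using conv_poly_right_dim[OF z, of "0\<^sub>m l n" n] unfolding resolvent_def by simp
qed

end

end


section \<open>Rational functions and their Taylor series\<close>

lemma rat_eval_Fract:
  assumes "poly q t \<noteq> 0"
  shows "rat_eval (Fraction_Field.Fract p q) t = poly p t / poly q t"
  unfolding rat_eval_def
proof (rule the_equality)
  fix v assume "\<exists>p' q'. poly q' t \<noteq> 0 \<and> Fraction_Field.Fract p q = Fraction_Field.Fract p' q' \<and> v = poly p' t / poly q' t"
  then obtain p' q' where *: "poly q' t \<noteq> 0" "Fraction_Field.Fract p q = Fraction_Field.Fract p' q'"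
    "v = poly p' t / poly q' t" by blast
  have "q \<noteq> 0" "q' \<noteq> 0" using assms *(1) by auto
  hence "p * q' = p' * q" using *(2) by (simp add: eq_fract)
  hence "poly p t * poly q' t = poly p' t * poly q t" by (metis poly_mult)
  thus "v = poly p t / poly q t" unfolding *(3) using assms *(1) by (simp add: field_simps)
qed (use assms in blast)

lemma has_fps_expansion_poly: "poly p has_fps_expansion fps_of_poly (p :: complex poly)"
proof (induction p)
  case (pCons c p)
  have "(\<lambda>x. c + poly p x * x) has_fps_expansion fps_const c + fps_of_poly p * fps_X"
    by (intro fps_expansion_intros pCons.IH)
  thus ?case by (simp add: fps_of_poly_pCons mult.commute)
qed simp

text \<open>The rational function \<open>r\<close> has no pole at \<open>0\<close> and the Taylor series \<open>F\<close> there, expressed by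
  multiplication with the denominator.\<close>

definition series_of :: "complex poly fract \<Rightarrow> complex fps \<Rightarrow> bool" where
  "series_of r F \<longleftrightarrow> (\<exists>p q. poly q 0 \<noteq> 0 \<and> r = Fraction_Field.Fract p q \<and> F * fps_of_poly q = fps_of_poly p)"

lemma rat_eval_expansion:
  assumes q: "poly q 0 \<noteq> 0" and F: "F * fps_of_poly q = fps_of_poly p"
  shows "rat_eval (Fraction_Field.Fract p q) has_fps_expansion F"
proof -
  have q0: "fps_nth (fps_of_poly q) 0 \<noteq> 0" using q by (simp add: poly_0_coeff_0)
  hence "fps_of_poly q \<noteq> 0" by auto
  have "F = fps_of_poly p / fps_of_poly q"
    using F \<open>fps_of_poly q \<noteq> 0\<close> by (metis nonzero_mult_div_cancel_right)
  moreover have "(\<lambda>t. poly p t / poly q t) has_fps_expansion fps_of_poly p / fps_of_poly q"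
    by (rule has_fps_expansion_divide'[OF has_fps_expansion_poly has_fps_expansion_poly q0])
  ultimately have e: "(\<lambda>t. poly p t / poly q t) has_fps_expansion F" by simp
  have "open (poly q -` (- {0}))"
    by (rule open_vimage) (auto intro: continuous_intros)
  hence "eventually (\<lambda>t. poly q t \<noteq> 0) (nhds 0)"
    unfolding eventually_nhds using q by (intro exI[of _ "poly q -` (- {0})"]) auto
  hence "eventually (\<lambda>t. eval_fps F t = rat_eval (Fraction_Field.Fract p q) t) (nhds 0)"
    using e unfolding has_fps_expansion_def
    by (auto elim: eventually_elim2 simp: rat_eval_Fract)
  thus ?thesis using e unfolding has_fps_expansion_def by blast
qed

lemma has_fps_expansion_unique:
  fixes f :: "complex \<Rightarrow> complex"
  assumes "f has_fps_expansion F" "f has_fps_expansion G" shows "F = G"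
  by (rule fps_ext) (simp add: fps_nth_fps_expansion[OF assms(1)] fps_nth_fps_expansion[OF assms(2)])

lemma series_of_iff: "series_of r F \<longleftrightarrow> no_pole_at r 0 \<and> rat_eval r has_fps_expansion F"
proof
  assume "series_of r F"
  thus "no_pole_at r 0 \<and> rat_eval r has_fps_expansion F"
    unfolding series_of_def no_pole_at_def using rat_eval_expansion by blast
next
  assume r: "no_pole_at r 0 \<and> rat_eval r has_fps_expansion F"
  then obtain p q where pq: "poly q 0 \<noteq> 0" "r = Fraction_Field.Fract p q" unfolding no_pole_at_def by blast
  have q0: "fps_nth (fps_of_poly q) 0 \<noteq> 0" using pq(1) by (simp add: poly_0_coeff_0)
  define G where "G = fps_of_poly p * inverse (fps_of_poly q)"
  have G: "G * fps_of_poly q = fps_of_poly p"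
    unfolding G_def using inverse_mult_eq_1[OF q0] by (simp add: mult.assoc)
  have "F = G" using r rat_eval_expansion[OF pq(1) G] pq(2) has_fps_expansion_unique by blast
  thus "series_of r F" unfolding series_of_def using pq G by blast
qed

lemma series_of_unique:
  assumes "series_of r F" "series_of r' F" shows "r = r'"
proof -
  obtain p q where pq: "poly q 0 \<noteq> 0" "r = Fraction_Field.Fract p q" "F * fps_of_poly q = fps_of_poly p"
    using assms(1) unfolding series_of_def by blast
  obtain p' q' where pq': "poly q' 0 \<noteq> 0" "r' = Fraction_Field.Fract p' q'" "F * fps_of_poly q' = fps_of_poly p'"
    using assms(2) unfolding series_of_def by blast
  have "fps_of_poly (p * q') = fps_of_poly (p' * q)"
    unfolding fps_of_poly_mult pq(3)[symmetric] pq'(3)[symmetric] by (simp add: mult_ac)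
  hence "p * q' = p' * q" by (simp only: fps_of_poly_eq_iff)
  moreover have "q \<noteq> 0" "q' \<noteq> 0" using pq(1) pq'(1) by auto
  ultimately show ?thesis unfolding pq(2) pq'(2) by (simp add: eq_fract)
qed

lemma series_of_add:
  assumes "series_of r F" "series_of r' F'" shows "series_of (r + r') (F + F')"
proof -
  obtain p q where pq: "poly q 0 \<noteq> 0" "r = Fraction_Field.Fract p q" "F * fps_of_poly q = fps_of_poly p"
    using assms(1) unfolding series_of_def by blast
  obtain p' q' where pq': "poly q' 0 \<noteq> 0" "r' = Fraction_Field.Fract p' q'" "F' * fps_of_poly q' = fps_of_poly p'"
    using assms(2) unfolding series_of_def by blast
  have "q \<noteq> 0" "q' \<noteq> 0" using pq(1) pq'(1) by auto
  hence "r + r' = Fraction_Field.Fract (p * q' + p' * q) (q * q')" unfolding pq(2) pq'(2) by simp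
  moreover have "(F + F') * fps_of_poly (q * q') = fps_of_poly (p * q' + p' * q)"
    unfolding fps_of_poly_mult fps_of_poly_add pq(3)[symmetric] pq'(3)[symmetric] by (simp add: algebra_simps)
  moreover have "poly (q * q') 0 \<noteq> 0" using pq(1) pq'(1) by simp
  ultimately show ?thesis unfolding series_of_def by blast
qed

lemma series_of_scale:
  assumes "series_of r F" shows "series_of (const_fract c * r) (fps_const c * F)"
proof -
  obtain p q where pq: "poly q 0 \<noteq> 0" "r = Fraction_Field.Fract p q" "F * fps_of_poly q = fps_of_poly p"
    using assms(1) unfolding series_of_def by blast
  have "const_fract c * r = Fraction_Field.Fract ([:c:] * p) q" unfolding const_fract_def pq(2) by simp
  moreover have "fps_const c * F * fps_of_poly q = fps_of_poly ([:c:] * p)"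
    unfolding fps_of_poly_mult pq(3)[symmetric] fps_of_poly_const by (simp add: mult.assoc)
  ultimately show ?thesis unfolding series_of_def using pq(1) by blast
qed

lemma has_Taylor_series_iff:
  "has_Taylor_series_at_0 M s \<longleftrightarrow>
     (\<forall>i<dim_row M. \<forall>j<dim_col M. series_of (M $$ (i, j)) (Abs_fps (\<lambda>k. s k $$ (i, j))))"
  unfolding has_Taylor_series_at_0_def mat_no_pole_at_def series_of_iff by blast

lemma tau_eqI:
  assumes M: "M \<in> carrier_mat m n" "has_Taylor_series_at_0 M (\<lambda>k. (Z_minus_mat \<Lambda> ^^ k) f 0)"
  shows "tau \<Lambda> m n f = M"
  unfolding tau_def
proof (rule the_equality)
  fix M' assume "M' \<in> carrier_mat m n \<and> has_Taylor_series_at_0 M' (\<lambda>k. (Z_minus_mat \<Lambda> ^^ k) f 0)"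
  hence M': "M' \<in> carrier_mat m n" "has_Taylor_series_at_0 M' (\<lambda>k. (Z_minus_mat \<Lambda> ^^ k) f 0)" by simp_all
  show "M' = M"
  proof (rule eq_matI)
    fix i j assume ij: "i < dim_row M" "j < dim_col M"
    hence ij': "i < dim_row M'" "j < dim_col M'" using M(1) M'(1) by auto
    show "M' $$ (i, j) = M $$ (i, j)"
      by (rule series_of_unique) (use M(2) M'(2) ij ij' in \<open>unfold has_Taylor_series_iff, blast+\<close>)
  qed (use M(1) M'(1) in auto)
qed (use M in simp)

lemma no_pole_reduced:
  assumes r: "\<forall>t\<in>P. no_pole_at r t"
  shows "\<exists>p q. r = Fraction_Field.Fract p q \<and> q \<noteq> 0 \<and> (\<forall>t\<in>P. poly q t \<noteq> 0)"
proof -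
  have "\<exists>p q. r = Fraction_Field.Fract p q \<and> q \<noteq> 0 \<and> (\<forall>t\<in>P. poly q t \<noteq> 0)"
    if "r = Fraction_Field.Fract p q" "q \<noteq> 0" for p q
    using that
  proof (induction "degree q" arbitrary: p q rule: less_induct)
    case less
    show ?case
    proof (cases "\<forall>t\<in>P. poly q t \<noteq> 0")
      case True
      thus ?thesis using less.prems by blast
    next
      case False
      then obtain t where t: "t \<in> P" "poly q t = 0" by blast
      obtain p' q' where pq': "poly q' t \<noteq> 0" "r = Fraction_Field.Fract p' q'"
        using r t unfolding no_pole_at_def by blast
      have "q' \<noteq> 0" using pq'(1) by auto
      hence "p * q' = p' * q" using less.prems pq'(2) by (simp add: eq_fract)
      hence "poly p t * poly q' t = 0" using t(2) by (metis mult_zero_right poly_mult)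
      hence "poly p t = 0" using pq'(1) by simp
      then obtain p1 where p1: "p = [:- t, 1:] * p1" by (auto simp: poly_eq_0_iff_dvd)
      obtain q1 where q1: "q = [:- t, 1:] * q1" using t(2) by (auto simp: poly_eq_0_iff_dvd)
      have q1n: "q1 \<noteq> 0" using q1 less.prems(2) by auto
      have "degree q = Suc (degree q1)" unfolding q1 using q1n by (subst degree_mult_eq) auto
      hence "degree q1 < degree q" by simp
      moreover have "p * q1 = p1 * q" unfolding p1 q1 by (simp only: mult.assoc mult.commute mult.left_commute)
      hence "r = Fraction_Field.Fract p1 q1" using less.prems q1n by (simp add: eq_fract)
      ultimately show ?thesis using less.hyps q1n by blast
    qed
  qed
  moreover obtain p q where "r = Fraction_Field.Fract p q" "q \<noteq> 0" by (cases r)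
  ultimately show ?thesis by blast
qed

section \<open>Rational functions with given Taylor coefficients\<close>

text \<open>The relation \<open>v\<close> is satisfied by the tails of a power series in \<open>t\<close> with coefficients \<open>a\<close>, and by
  \<open>C A^k (I - tA)^{-1} B\<close> when \<open>a k = C A^k B\<close>.\<close>

lemma telescoped_recurrence:
  fixes v :: "nat \<Rightarrow> 'a :: comm_ring_1"
  assumes v: "\<And>k. v k = a k + t * v (Suc k)" and c: "(\<Sum>e\<le>N. c e * v e) = 0"
  shows "v 0 * (\<Sum>e\<le>N. c e * t ^ (N - e)) = (\<Sum>e\<le>N. \<Sum>i<e. c e * a i * t ^ (N - e + i))"
proof -
  have v0: "v 0 = (\<Sum>i<e. a i * t ^ i) + t ^ e * v e" for e
  proof (induction e)
    case (Suc e)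
    have "t ^ e * v e = a e * t ^ e + t ^ Suc e * v (Suc e)"
      by (subst v) (simp add: algebra_simps)
    thus ?case using Suc by simp
  qed simp
  have "v 0 * (\<Sum>e\<le>N. c e * t ^ (N - e)) = (\<Sum>e\<le>N. c e * t ^ (N - e) * v 0)"
    by (simp add: sum_distrib_left mult.commute)
  also have "\<dots> = (\<Sum>e\<le>N. (\<Sum>i<e. c e * a i * t ^ (N - e + i)) + t ^ N * (c e * v e))"
  proof (rule sum.cong[OF refl])
    fix e assume "e \<in> {..N}"
    hence "t ^ (N - e) * t ^ e = t ^ N" by (simp flip: power_add)
    hence "c e * t ^ (N - e) * (t ^ e * v e) = t ^ N * (c e * v e)" by (metis mult.assoc mult.commute)
    moreover have "c e * t ^ (N - e) * (\<Sum>i<e. a i * t ^ i) = (\<Sum>i<e. c e * a i * t ^ (N - e + i))"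
      by (simp add: sum_distrib_left power_add mult_ac)
    ultimately show "c e * t ^ (N - e) * v 0 = (\<Sum>i<e. c e * a i * t ^ (N - e + i)) + t ^ N * (c e * v e)"
      by (subst v0[of e]) (simp add: distrib_left)
  qed
  also have "\<dots> = (\<Sum>e\<le>N. \<Sum>i<e. c e * a i * t ^ (N - e + i))"
    unfolding sum.distrib sum_distrib_left[symmetric] c by simp
  finally show ?thesis .
qed

text \<open>The polynomial \<open>\<mu>\<close> with its coefficients in reverse order.\<close>

definition series_den :: "complex poly \<Rightarrow> complex poly" where
  "series_den \<mu> = (\<Sum>e\<le>degree \<mu>. monom (coeff \<mu> e) (degree \<mu> - e))"

text \<open>The numerator over \<open>series_den \<mu>\<close> of the series with the coefficients \<open>a\<close>.\<close>

definition series_num :: "complex poly \<Rightarrow> (nat \<Rightarrow> complex) \<Rightarrow> complex poly" where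
  "series_num \<mu> a = (\<Sum>e\<le>degree \<mu>. \<Sum>i<e. monom (coeff \<mu> e * a i) (degree \<mu> - e + i))"

text \<open>The rational function with Taylor coefficients \<open>d, a 0, a 1, \<dots>\<close>, provided that \<open>a\<close> is recurrent for \<open>\<mu>\<close>.\<close>

definition rat_of :: "complex \<Rightarrow> complex poly \<Rightarrow> (nat \<Rightarrow> complex) \<Rightarrow> complex poly fract" where
  "rat_of d \<mu> a = Fraction_Field.Fract ([:d:] * series_den \<mu> + [:0, 1:] * series_num \<mu> a) (series_den \<mu>)"

lemma poly_series_den: "poly (series_den \<mu>) t = (\<Sum>e\<le>degree \<mu>. coeff \<mu> e * t ^ (degree \<mu> - e))"
  unfolding series_den_def by (simp add: poly_sum poly_monom)

lemma poly_series_den_0: "poly (series_den \<mu>) 0 = lead_coeff \<mu>"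
proof -
  have "poly (series_den \<mu>) 0 = (\<Sum>e\<le>degree \<mu>. if e = degree \<mu> then coeff \<mu> e else 0)"
    unfolding poly_series_den by (rule sum.cong) (auto simp: power_0_left)
  thus ?thesis by simp
qed

lemma poly_series_den_inverse:
  assumes "t \<noteq> 0" shows "poly (series_den \<mu>) t = t ^ degree \<mu> * poly \<mu> (1 / t)"
proof -
  have "coeff \<mu> e * t ^ (degree \<mu> - e) = t ^ degree \<mu> * (coeff \<mu> e * (1 / t) ^ e)" if "e \<le> degree \<mu>" for e
    using assms that by (simp add: power_diff field_simps)
  thus ?thesis unfolding poly_series_den poly_altdef[of \<mu>] sum_distrib_left
    by (intro sum.cong[OF refl]) simp
qed

lemma rat_of_no_pole: "poly (series_den \<mu>) t \<noteq> 0 \<Longrightarrow> no_pole_at (rat_of d \<mu> a) t"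
  unfolding no_pole_at_def rat_of_def by blast

lemma rat_of_eval:
  assumes den: "poly (series_den \<mu>) t \<noteq> 0" and v: "\<And>k. v k = a k + t * v (Suc k)" and lin: "lin v \<mu> = 0"
  shows "rat_eval (rat_of d \<mu> a) t = d + t * v 0"
proof -
  have "v 0 * poly (series_den \<mu>) t = poly (series_num \<mu> a) t"
    using telescoped_recurrence[of v a t "coeff \<mu>" "degree \<mu>", OF v] lin
    unfolding lin_def poly_series_den series_num_def by (simp add: poly_sum poly_monom)
  hence "poly ([:d:] * series_den \<mu> + [:0, 1:] * series_num \<mu> a) t = (d + t * v 0) * poly (series_den \<mu>) t"
    by (simp add: algebra_simps)
  thus ?thesis unfolding rat_of_def using rat_eval_Fract[OF den] den by simp
qed

text \<open>The sequence \<open>d, a 0, a 1, \<dots>\<close>.\<close>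

definition cons_seq :: "complex \<Rightarrow> (nat \<Rightarrow> complex) \<Rightarrow> nat \<Rightarrow> complex" where
  "cons_seq d a k = (case k of 0 \<Rightarrow> d | Suc k \<Rightarrow> a k)"

lemma rat_of_series:
  assumes \<mu>: "\<mu> \<noteq> 0" "recurrent \<mu> a"
  shows "series_of (rat_of d \<mu> a) (Abs_fps (cons_seq d a))"
proof -
  define v where "v k = Abs_fps (\<lambda>i. a (i + k))" for k
  have v: "v k = fps_const (a k) + fps_X * v (Suc k)" for k
    by (rule fps_ext) (auto simp: v_def fps_X_mult_nth gr0_conv_Suc split: nat.split)
  have sum0: "(\<Sum>e\<le>degree \<mu>. fps_const (coeff \<mu> e) * v e) = 0"
  proof (rule fps_ext)
    fix n
    have "fps_nth (\<Sum>e\<le>degree \<mu>. fps_const (coeff \<mu> e) * v e) n = lin (\<lambda>e. a (e + n)) \<mu>"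
      unfolding lin_def v_def by (simp add: fps_sum_nth add.commute)
    thus "fps_nth (\<Sum>e\<le>degree \<mu>. fps_const (coeff \<mu> e) * v e) n = fps_nth 0 n"
      using recurrentD[OF \<mu>(2)] by simp
  qed
  have monom: "fps_of_poly (monom c n) = fps_const c * fps_X ^ n" for c :: complex and n
    by (rule fps_ext) (simp add: fps_X_power_iff)
  have den: "fps_of_poly (series_den \<mu>) = (\<Sum>e\<le>degree \<mu>. fps_const (coeff \<mu> e) * fps_X ^ (degree \<mu> - e))"
    unfolding series_den_def by (simp add: fps_of_poly_sum monom)
  have num: "fps_of_poly (series_num \<mu> a) =
      (\<Sum>e\<le>degree \<mu>. \<Sum>i<e. fps_const (coeff \<mu> e) * fps_const (a i) * fps_X ^ (degree \<mu> - e + i))"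
    unfolding series_num_def by (simp add: fps_of_poly_sum monom)
  have v0: "v 0 * fps_of_poly (series_den \<mu>) = fps_of_poly (series_num \<mu> a)"
    unfolding den num by (rule telescoped_recurrence[OF v sum0])
  have F: "Abs_fps (cons_seq d a) = fps_const d + fps_X * v 0"
    by (rule fps_ext) (auto simp: v_def cons_seq_def fps_X_mult_nth split: nat.split)
  have "Abs_fps (cons_seq d a) * fps_of_poly (series_den \<mu>) =
      fps_of_poly ([:d:] * series_den \<mu> + [:0, 1:] * series_num \<mu> a)"
    unfolding fps_of_poly_add fps_of_poly_mult fps_of_poly_const fps_of_poly_fps_X v0[symmetric] F
    by (simp only: distrib_right mult.assoc)
  moreover have "poly (series_den \<mu>) 0 \<noteq> 0" using \<mu>(1) by (simp add: poly_series_den_0)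
  ultimately show ?thesis unfolding series_of_def rat_of_def by blast
qed

lemma recurrent_triple_product:
  assumes A: "A \<in> carrier_mat l l" and "C \<in> carrier_mat m l" "B \<in> carrier_mat l n" "i < m" "j < n"
  shows "recurrent (char_poly A) (\<lambda>k. (C * A ^\<^sub>m k * B) $$ (i, j))"
proof -
  have sum: "recurrent \<mu> (\<lambda>k. \<Sum>i\<in>I. a i k)" if "\<And>i. i \<in> I \<Longrightarrow> recurrent \<mu> (a i)" for \<mu> a and I :: "(nat \<times> nat) set"
    using that unfolding recurrent_def by (simp add: lin_sum_seq)
  have scale: "recurrent \<mu> (\<lambda>k. c * a k)" if "recurrent \<mu> a" for \<mu> a c
    using that unfolding recurrent_def by (simp add: lin_scale_seq)
  show ?thesis
    unfolding triple_product_entry[OF assms] case_prod_unfold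
    by (intro sum scale recurrent_power_entry[OF A]) auto
qed

lemma mat_inverse_invertible:
  fixes M :: "complex mat"
  assumes M: "M \<in> carrier_mat l l" and inv: "invertible_mat M"
  shows "the (mat_inverse M) \<in> carrier_mat l l" "M * the (mat_inverse M) = 1\<^sub>m l" "the (mat_inverse M) * M = 1\<^sub>m l"
proof -
  obtain B where B: "M * B = 1\<^sub>m (dim_row M)" "B * M = 1\<^sub>m (dim_row B)"
    using inv unfolding invertible_mat_def inverts_mat_def by blast
  have "dim_col (M * B) = l" "dim_col (B * M) = dim_row B" unfolding B using M by simp_all
  hence Bc: "B \<in> carrier_mat l l" using M by auto
  hence "M \<in> Units (ring_mat TYPE(complex) l ())"
    unfolding Units_def using M B by (auto simp: ring_mat_simps)
  hence "mat_inverse M \<noteq> None" using mat_inverse(1)[OF M, where b = "()"] by blast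
  then obtain Y where Y: "mat_inverse M = Some Y" by blast
  show "the (mat_inverse M) \<in> carrier_mat l l" "M * the (mat_inverse M) = 1\<^sub>m l" "the (mat_inverse M) * M = 1\<^sub>m l"
    using mat_inverse(2)[OF M Y] unfolding Y by simp_all
qed

lemma series_den_char_poly_nonzero:
  assumes A: "A \<in> carrier_mat l l" and inv: "invertible_mat (1\<^sub>m l - t \<cdot>\<^sub>m A)"
  shows "poly (series_den (char_poly A)) t \<noteq> 0"
proof (cases "t = 0")
  case True
  thus ?thesis using degree_monic_char_poly[OF A] by (simp add: poly_series_den_0)
next
  case False
  let ?M = "1\<^sub>m l - t \<cdot>\<^sub>m A"
  have M: "?M \<in> carrier_mat l l" using A by (simp add: minus_carrier_mat)
  note Y = mat_inverse_invertible[OF M inv]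
  have "\<not> eigenvalue A (1 / t)"
  proof
    assume "eigenvalue A (1 / t)"
    then obtain x where x: "x \<in> carrier_vec l" "x \<noteq> 0\<^sub>v l" "A *\<^sub>v x = (1 / t) \<cdot>\<^sub>v x"
      unfolding eigenvalue_def eigenvector_def using A by auto
    have "?M *\<^sub>v x = 1\<^sub>m l *\<^sub>v x - (t \<cdot>\<^sub>m A) *\<^sub>v x"
      by (rule minus_mult_distrib_mat_vec) (use A x in auto)
    also have "(t \<cdot>\<^sub>m A) *\<^sub>v x = t \<cdot>\<^sub>v (A *\<^sub>v x)"
      using A x(1) by (intro eq_vecI) auto
    also have "\<dots> = x" unfolding x(3) using False by (simp add: smult_smult_assoc)
    also have "1\<^sub>m l *\<^sub>v x - x = 0\<^sub>v l" using x(1) by auto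
    finally have "?M *\<^sub>v x = 0\<^sub>v l" .
    hence "the (mat_inverse ?M) *\<^sub>v (?M *\<^sub>v x) = 0\<^sub>v l" using Y(1) by auto
    moreover have "the (mat_inverse ?M) *\<^sub>v (?M *\<^sub>v x) = x"
      using assoc_mult_mat_vec[OF Y(1) M x(1)] Y(3) x(1) by simp
    ultimately show False using x(2) by simp
  qed
  hence "poly (char_poly A) (1 / t) \<noteq> 0" using eigenvalue_root_char_poly[OF A] by blast
  thus ?thesis unfolding poly_series_den_inverse[OF False] using False by simp
qed

lemma rat_of_state_space_eval:
  assumes A: "A \<in> carrier_mat l l" and C: "C \<in> carrier_mat m l" and B: "B \<in> carrier_mat l n"
    and ij: "i < m" "j < n" and inv: "invertible_mat (1\<^sub>m l - t \<cdot>\<^sub>m A)"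
  shows "rat_eval (rat_of d (char_poly A) (\<lambda>k. (C * A ^\<^sub>m k * B) $$ (i, j))) t =
    d + t * (C * the (mat_inverse (1\<^sub>m l - t \<cdot>\<^sub>m A)) * B) $$ (i, j)"
proof -
  let ?M = "1\<^sub>m l - t \<cdot>\<^sub>m A"
  define Y where "Y = the (mat_inverse ?M)"
  have M: "?M \<in> carrier_mat l l" using A by (simp add: minus_carrier_mat)
  have Y: "Y \<in> carrier_mat l l" "?M * Y = 1\<^sub>m l" using mat_inverse_invertible[OF M inv] unfolding Y_def by simp_all
  define W where "W = Y * B"
  have W: "W \<in> carrier_mat l n" unfolding W_def using Y B by simp
  have tA: "t \<cdot>\<^sub>m A \<in> carrier_mat l l" using A by simp
  have "?M * W = B" unfolding W_def using assoc_mult_mat[OF M Y(1) B] Y(2) B by simp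
  moreover have "?M * W = 1\<^sub>m l * W - (t \<cdot>\<^sub>m A) * W" by (rule minus_mult_distrib_mat[OF one_carrier_mat tA W])
  moreover have "(t \<cdot>\<^sub>m A) * W = t \<cdot>\<^sub>m (A * W)" by (rule mult_smult_assoc_mat[OF A W])
  ultimately have BW: "B = W - t \<cdot>\<^sub>m (A * W)" using W by simp
  define v where "v k = (C * A ^\<^sub>m k * W) $$ (i, j)" for k
  have v: "v k = (C * A ^\<^sub>m k * B) $$ (i, j) + t * v (Suc k)" for k
  proof -
    have P: "C * A ^\<^sub>m k \<in> carrier_mat m l" using C pow_carrier_mat[OF A] by simp
    have AW: "A * W \<in> carrier_mat l n" using A W by simp
    have "C * A ^\<^sub>m k * B = C * A ^\<^sub>m k * W - C * A ^\<^sub>m k * (t \<cdot>\<^sub>m (A * W))"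
      unfolding BW by (rule mult_minus_distrib_mat[OF P W]) (use AW in simp)
    also have "C * A ^\<^sub>m k * (t \<cdot>\<^sub>m (A * W)) = t \<cdot>\<^sub>m (C * A ^\<^sub>m k * (A * W))"
      by (rule mult_smult_distrib[OF P AW])
    also have "C * A ^\<^sub>m k * (A * W) = C * A ^\<^sub>m Suc k * W"
      using assoc_mult_mat[OF P A W] assoc_mult_mat[OF C pow_carrier_mat[OF A] A] by simp
    finally have e: "C * A ^\<^sub>m k * B = C * A ^\<^sub>m k * W - t \<cdot>\<^sub>m (C * A ^\<^sub>m Suc k * W)" .
    show ?thesis unfolding e v_def using C W ij by (simp del: index_mult_mat(1) pow_mat.simps)
  qed
  have "lin v (char_poly A) = 0"
    using recurrentD[OF recurrent_triple_product[OF A C W ij], of 0] unfolding v_def by simp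
  from rat_of_eval[OF series_den_char_poly_nonzero[OF A inv] v this]
  have "rat_eval (rat_of d (char_poly A) (\<lambda>k. (C * A ^\<^sub>m k * B) $$ (i, j))) t = d + t * v 0" .
  moreover have "C * A ^\<^sub>m 0 * W = C * Y * B"
    unfolding W_def using assoc_mult_mat[OF C Y(1) B] A C by simp
  ultimately show ?thesis unfolding v_def Y_def by simp
qed

section \<open>Realization by a block companion matrix\<close>

lemma block_index:
  fixes i m e N :: nat
  assumes "i < m" "e < N" shows "i * N + e < m * N"
proof -
  have "i * N + e < Suc i * N" using assms(2) by simp
  also have "Suc i * N \<le> m * N" using assms(1) by (intro mult_le_mono1) simp
  finally show ?thesis .
qed

lemma block_sum:
  fixes i m N :: nat
  assumes N: "N > 0" and i: "i < m"
  shows "(\<Sum>s<m * N. if s div N = i then g s else (0 :: complex)) = (\<Sum>e<N. g (i * N + e))"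
proof -
  have "(\<Sum>s<m * N. if s div N = i then g s else 0) = (\<Sum>s\<in>{s\<in>{..<m * N}. s div N = i}. g s)"
    by (rule sum.inter_filter[symmetric]) simp
  also have "\<dots> = (\<Sum>e<N. g (i * N + e))"
  proof (rule sum.reindex_bij_witness[of _ "\<lambda>e. i * N + e" "\<lambda>s. s mod N"])
    fix s assume s: "s \<in> {s\<in>{..<m * N}. s div N = i}"
    show "i * N + s mod N = s" using s div_mult_mod_eq[of s N] by auto
    show "s mod N \<in> {..<N}" using N by simp
    show "g (i * N + s mod N) = g s" using s div_mult_mod_eq[of s N] by auto
  next
    fix e assume "e \<in> {..<N}"
    thus "(i * N + e) mod N = e" "i * N + e \<in> {s\<in>{..<m * N}. s div N = i}"
      using block_index[OF i] by simp_all
  qed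
  finally show ?thesis .
qed

context
  fixes m N :: nat and c :: "nat \<Rightarrow> complex"
  assumes N: "N > 0" and cN: "c N \<noteq> 0"
begin

text \<open>The block diagonal matrix of \<open>m\<close> copies of the companion matrix of the polynomial with the
  coefficients \<open>c 0, \<dots>, c N\<close>. The index \<open>i * N + e\<close> stands for position \<open>e\<close> in block \<open>i\<close>.\<close>

definition companion :: "complex mat" where
  "companion = Matrix.mat (m * N) (m * N) (\<lambda>(r, s).
     if Suc (r mod N) < N then (if s = Suc r then 1 else 0)
     else if s div N = r div N then - c (s mod N) / c N else 0)"

lemma companion_carrier: "companion \<in> carrier_mat (m * N) (m * N)"
  unfolding companion_def by simp

lemma companion_row:
  assumes r: "r < m * N"
  shows "(\<Sum>s<m * N. companion $$ (r, s) * x s) =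
    (if Suc (r mod N) < N then x (Suc r) else (\<Sum>e<N. - c e / c N * x (r div N * N + e)))"
proof (cases "Suc (r mod N) < N")
  case True
  have i: "r div N < m" using r by (simp add: less_mult_imp_div_less)
  have "Suc r = r div N * N + Suc (r mod N)" by (simp only: add_Suc_right div_mult_mod_eq)
  hence "Suc r < m * N" using block_index[OF i True] by simp
  moreover have "(\<Sum>s<m * N. companion $$ (r, s) * x s) = (\<Sum>s<m * N. if s = Suc r then x s else 0)"
    by (rule sum.cong) (use r True in \<open>auto simp: companion_def\<close>)
  ultimately show ?thesis using True by simp
next
  case False
  have i: "r div N < m" using r by (simp add: less_mult_imp_div_less)
  have "(\<Sum>s<m * N. companion $$ (r, s) * x s) =
      (\<Sum>s<m * N. if s div N = r div N then - c (s mod N) / c N * x s else 0)"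
    by (rule sum.cong) (use r False in \<open>auto simp: companion_def\<close>)
  also have "\<dots> = (\<Sum>e<N. - c ((r div N * N + e) mod N) / c N * x (r div N * N + e))"
    by (rule block_sum[OF N i])
  also have "\<dots> = (\<Sum>e<N. - c e / c N * x (r div N * N + e))" by (rule sum.cong) auto
  finally show ?thesis using False by simp
qed

lemma companion_eigenvalue:
  assumes ev: "eigenvalue companion s"
  shows "(\<Sum>e\<le>N. c e * s ^ e) = 0"
proof (rule ccontr)
  assume nz: "(\<Sum>e\<le>N. c e * s ^ e) \<noteq> 0"
  obtain x where x: "x \<in> carrier_vec (m * N)" "x \<noteq> 0\<^sub>v (m * N)" "companion *\<^sub>v x = s \<cdot>\<^sub>v x"
    using ev companion_carrier unfolding eigenvalue_def eigenvector_def by auto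
  define y where "y = vec_index x"
  have row: "(\<Sum>q<m * N. companion $$ (r, q) * y q) = s * y r" if r: "r < m * N" for r
  proof -
    have "vec_index (companion *\<^sub>v x) r = (\<Sum>q<m * N. companion $$ (r, q) * y q)"
      using companion_carrier x(1) r unfolding y_def by (simp add: scalar_prod_def lessThan_atLeast0)
    moreover have "vec_index (companion *\<^sub>v x) r = s * y r" unfolding x(3) y_def using x(1) r by simp
    ultimately show ?thesis by simp
  qed
  have pow: "y (i * N + e) = s ^ e * y (i * N)" if i: "i < m" and e: "e < N" for i e
    using e
  proof (induction e)
    case (Suc e)
    have "s * y (i * N + e) = y (Suc (i * N + e))"
      using companion_row[OF block_index[OF i], of e y] row[OF block_index[OF i], of e] Suc.prems by simp
    thus ?case using Suc by (simp add: mult.assoc)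
  qed simp
  have zero: "y (i * N) = 0" if i: "i < m" for i
  proof -
    have e: "N - 1 < N" using N by simp
    have "(i * N + k) mod N = k" "(i * N + k) div N = i" if "k < N" for k using that by simp_all
    note dm = this[OF e]
    have "s * y (i * N + (N - 1)) = (\<Sum>e<N. - c e / c N * y (i * N + e))"
      using companion_row[OF block_index[OF i e], of y] row[OF block_index[OF i e]] dm N by simp
    also have "\<dots> = (\<Sum>e<N. - c e / c N * (s ^ e * y (i * N)))"
      by (rule sum.cong) (simp_all add: pow[OF i])
    also have "\<dots> = - (\<Sum>e<N. c e * s ^ e) / c N * y (i * N)"
      by (simp add: sum_distrib_left sum_distrib_right sum_negf sum_divide_distrib mult_ac)
    also have "s * y (i * N + (N - 1)) = s ^ N * y (i * N)"
      unfolding pow[OF i e] using N by (simp add: power_eq_if)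
    finally have "(c N * s ^ N) * y (i * N) = - (\<Sum>e<N. c e * s ^ e) * y (i * N)"
      using cN by (simp add: field_simps)
    hence "((\<Sum>e<N. c e * s ^ e) + c N * s ^ N) * y (i * N) = 0" by (simp add: algebra_simps)
    moreover have "(\<Sum>e\<le>N. c e * s ^ e) = (\<Sum>e<N. c e * s ^ e) + c N * s ^ N"
      by (simp flip: lessThan_Suc_atMost)
    ultimately show ?thesis using nz by simp
  qed
  have "x = 0\<^sub>v (m * N)"
  proof (rule eq_vecI)
    fix r assume "r < dim_vec (0\<^sub>v (m * N) :: complex vec)"
    hence r: "r < m * N" by simp
    have i: "r div N < m" using r by (simp add: less_mult_imp_div_less)
    have "y (r div N * N + r mod N) = 0"
      unfolding pow[OF i mod_less_divisor[OF N]] zero[OF i] by simp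
    hence "y r = 0" by (simp only: div_mult_mod_eq)
    thus "vec_index x r = vec_index (0\<^sub>v (m * N)) r" using r unfolding y_def by simp
  qed (use x(1) in simp)
  thus False using x(2) by simp
qed

text \<open>The state in block \<open>i\<close> holds \<open>N\<close> consecutive terms of the sequence \<open>a i j\<close>. The companion matrix
  advances them by one, and the output is the first of them.\<close>

lemma companion_realization:
  assumes a: "\<And>i j k. i < m \<Longrightarrow> j < n \<Longrightarrow> (\<Sum>e\<le>N. c e * a i j (k + e)) = 0"
    and ij: "i < m" "j < n"
  shows "(Matrix.mat m (m * N) (\<lambda>(i, r). if r = i * N then 1 else 0) * companion ^\<^sub>m k *
    Matrix.mat (m * N) n (\<lambda>(r, j). a (r div N) j (r mod N))) $$ (i, j) = a i j k"
proof -
  let ?l = "m * N"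
  let ?C = "Matrix.mat m ?l (\<lambda>(i, r). if r = i * N then 1 else 0) :: complex mat"
  let ?B = "Matrix.mat ?l n (\<lambda>(r, j). a (r div N) j (r mod N))"
  have C: "?C \<in> carrier_mat m ?l" and B: "?B \<in> carrier_mat ?l n" by simp_all
  have P: "companion ^\<^sub>m k \<in> carrier_mat ?l ?l" for k by (rule pow_carrier_mat[OF companion_carrier])
  have power: "(\<Sum>q<?l. power_entry companion r q k * ?B $$ (q, j)) = a (r div N) j (r mod N + k)"
    if r: "r < ?l" for r k
    using r
  proof (induction k arbitrary: r)
    case 0
    have "(\<Sum>q<?l. power_entry companion r q 0 * ?B $$ (q, j)) = (\<Sum>q<?l. if q = r then ?B $$ (q, j) else 0)"
      by (rule sum.cong) (use 0 in \<open>auto simp: power_entry_0[OF companion_carrier]\<close>)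
    thus ?case using 0 ij(2) by simp
  next
    case (Suc k)
    have i: "r div N < m" using Suc.prems by (simp add: less_mult_imp_div_less)
    have "(\<Sum>q<?l. power_entry companion r q (Suc k) * ?B $$ (q, j)) =
        (\<Sum>q<?l. \<Sum>s<?l. companion $$ (r, s) * (power_entry companion s q k * ?B $$ (q, j)))"
      by (rule sum.cong[OF refl])
        (simp add: power_entry_Suc_left[OF companion_carrier Suc.prems] sum_distrib_right mult.assoc)
    also have "\<dots> = (\<Sum>s<?l. companion $$ (r, s) * (\<Sum>q<?l. power_entry companion s q k * ?B $$ (q, j)))"
      by (subst sum.swap) (simp add: sum_distrib_left)
    also have "\<dots> = (\<Sum>s<?l. companion $$ (r, s) * a (s div N) j (s mod N + k))"
      by (rule sum.cong[OF refl]) (simp only: Suc.IH lessThan_iff)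
    also have "\<dots> = (if Suc (r mod N) < N then a (Suc r div N) j (Suc r mod N + k)
        else (\<Sum>e<N. - c e / c N * a ((r div N * N + e) div N) j ((r div N * N + e) mod N + k)))"
      by (rule companion_row[OF Suc.prems, of "\<lambda>s. a (s div N) j (s mod N + k)"])
    also have "\<dots> = a (r div N) j (r mod N + Suc k)"
    proof (cases "Suc (r mod N) < N")
      case True
      hence "Suc r mod N = Suc (r mod N)" "Suc r div N = r div N" by (simp_all add: mod_Suc div_Suc)
      thus ?thesis using True by simp
    next
      case False
      hence rN: "Suc (r mod N) = N" using N by (metis Suc_lessI mod_less_divisor)
      have "(\<Sum>e<N. - c e / c N * a ((r div N * N + e) div N) j ((r div N * N + e) mod N + k))
          = (\<Sum>e<N. - c e / c N * a (r div N) j (k + e))"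
        by (rule sum.cong) (auto simp: add.commute)
      also have "\<dots> = - (\<Sum>e<N. c e * a (r div N) j (k + e)) / c N"
        by (simp add: sum_negf sum_divide_distrib)
      also have "(\<Sum>e<N. c e * a (r div N) j (k + e)) = - (c N * a (r div N) j (k + N))"
        using a[OF i ij(2), of k] by (simp add: add_eq_0_iff2 flip: lessThan_Suc_atMost)
      also have "- (- (c N * a (r div N) j (k + N))) / c N = a (r div N) j (k + N)" using cN by simp
      also have "k + N = r mod N + Suc k" using rN by simp
      finally show ?thesis using False by simp
    qed
    finally show ?case .
  qed
  have i0: "i * N < ?l" using block_index[OF ij(1), of 0] N by simp
  have "(?C * companion ^\<^sub>m k * ?B) $$ (i, j) = (?C * (companion ^\<^sub>m k * ?B)) $$ (i, j)"
    using assoc_mult_mat[OF C P B] by simp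
  also have "\<dots> = (\<Sum>r<?l. ?C $$ (i, r) * (companion ^\<^sub>m k * ?B) $$ (r, j))"
    by (rule mult_mat_entry[OF C mult_carrier_mat[OF P B] ij])
  also have "\<dots> = (\<Sum>r<?l. if r = i * N then a (r div N) j (r mod N + k) else 0)"
  proof (rule sum.cong[OF refl])
    fix r assume r: "r \<in> {..<?l}"
    have "(companion ^\<^sub>m k * ?B) $$ (r, j) = a (r div N) j (r mod N + k)"
      using mult_mat_entry[OF P B _ ij(2), of r k] power[of r k] r unfolding power_entry_def by simp
    thus "?C $$ (i, r) * (companion ^\<^sub>m k * ?B) $$ (r, j) = (if r = i * N then a (r div N) j (r mod N + k) else 0)"
      using r ij(1) by simp
  qed
  also have "\<dots> = a i j k" using i0 N by simp
  finally show ?thesis .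
qed

end


section \<open>The transform of rational discrete analytic functions\<close>

context rooted_reachable_tiling begin

text \<open>The matrix-valued rational function with constant terms \<open>d i j\<close> and coefficient sequences \<open>a i j\<close>.\<close>

definition rat_mat_fun :: "nat \<Rightarrow> nat \<Rightarrow> (nat \<Rightarrow> nat \<Rightarrow> complex) \<Rightarrow> (nat \<Rightarrow> nat \<Rightarrow> nat \<Rightarrow> complex) \<Rightarrow> complex \<Rightarrow> complex mat" where
  "rat_mat_fun m n d a = mat_fun \<Lambda> m n (\<lambda>i j. rfun (d i j) (a i j))"

lemma rat_mat_fun_cong:
  assumes "\<And>i j. i < m \<Longrightarrow> j < n \<Longrightarrow> d i j = d' i j" "\<And>i j. i < m \<Longrightarrow> j < n \<Longrightarrow> a i j = a' i j"
  shows "rat_mat_fun m n d a = rat_mat_fun m n d' a'"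
  unfolding rat_mat_fun_def by (rule mat_fun_cong) (simp add: assms)

lemma rfun_extensional: "rfun d a \<in> extensional V"
  unfolding rfun_def by simp

lemma Z_minus_power:
  assumes a: "\<And>i j. i < m \<Longrightarrow> j < n \<Longrightarrow> regular (a i j)"
  shows "(Z_minus_mat \<Lambda> ^^ k) (rat_mat_fun m n d a) 0 = Matrix.mat m n (\<lambda>(i, j). cons_seq (d i j) (a i j) k)"
proof -
  have Zmat: "Z_minus_mat \<Lambda> (mat_fun \<Lambda> m n F) = mat_fun \<Lambda> m n G"
    if "\<And>i j. i < m \<Longrightarrow> j < n \<Longrightarrow> F i j \<in> extensional V" "\<And>i j. i < m \<Longrightarrow> j < n \<Longrightarrow> Z_minus \<Lambda> (F i j) = G i j" for F G
    using entrywise_mat_fun[where Op = "Z_minus \<Lambda>", OF that(1)] mat_fun_cong[of m n \<Lambda> "\<lambda>i j. Z_minus \<Lambda> (F i j)" G] that(2)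
    by simp
  have reg: "regular (\<lambda>q. a i j (q + k))" if "i < m" "j < n" for i j k
  proof (induction k)
    case (Suc k)
    show ?case using regular_shift[OF Suc] by simp
  qed (simp add: a that)
  have iter: "(Z_minus_mat \<Lambda> ^^ Suc k) (rat_mat_fun m n d a) = mat_fun \<Lambda> m n (\<lambda>i j. phi (\<lambda>q. a i j (q + k)))" for k
  proof (induction k)
    case 0
    show ?case unfolding rat_mat_fun_def
      by (simp add: Zmat[OF rfun_extensional Z_minus_rfun[OF a]])
  next
    case (Suc k)
    have "(Z_minus_mat \<Lambda> ^^ Suc (Suc k)) (rat_mat_fun m n d a) =
        Z_minus_mat \<Lambda> (mat_fun \<Lambda> m n (\<lambda>i j. phi (\<lambda>q. a i j (q + k))))"
      using Suc by simp
    also have "\<dots> = mat_fun \<Lambda> m n (\<lambda>i j. phi (\<lambda>q. a i j (Suc q + k)))"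
      by (rule Zmat[OF phi_extensional Z_minus_phi[OF reg]])
    finally show ?case by simp
  qed
  show ?thesis
  proof (cases k)
    case 0
    show ?thesis unfolding 0 rat_mat_fun_def
      by (simp add: zero_vertex cons_seq_def, rule cong_mat) (simp_all add: rfun_zero a)
  next
    case (Suc q)
    have "phi (\<lambda>p. a i j (p + q)) 0 = a i j q" if "i < m" "j < n" for i j
      using phi_zero[OF reg[OF that]] by simp
    thus ?thesis unfolding Suc iter
      by (simp add: zero_vertex cons_seq_def, intro cong_mat) simp_all
  qed
qed

lemma Taylor_rat_mat_fun:
  assumes a: "\<And>i j. i < m \<Longrightarrow> j < n \<Longrightarrow> regular (a i j)" and M: "M \<in> carrier_mat m n"
    and s: "\<And>i j. i < m \<Longrightarrow> j < n \<Longrightarrow> series_of (M $$ (i, j)) (Abs_fps (cons_seq (d i j) (a i j)))"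
  shows "has_Taylor_series_at_0 M (\<lambda>k. (Z_minus_mat \<Lambda> ^^ k) (rat_mat_fun m n d a) 0)"
    and "tau \<Lambda> m n (rat_mat_fun m n d a) = M"
proof -
  have Z: "(Z_minus_mat \<Lambda> ^^ k) (rat_mat_fun m n d a) 0 = Matrix.mat m n (\<lambda>(i, j). cons_seq (d i j) (a i j) k)" for k
    by (rule Z_minus_power[OF a])
  show "has_Taylor_series_at_0 M (\<lambda>k. (Z_minus_mat \<Lambda> ^^ k) (rat_mat_fun m n d a) 0)"
    unfolding has_Taylor_series_iff Z
  proof (intro allI impI)
    fix i j assume "i < dim_row M" "j < dim_col M"
    hence ij: "i < m" "j < n" using M by simp_all
    have "(\<lambda>k. Matrix.mat m n (\<lambda>(i, j). cons_seq (d i j) (a i j) k) $$ (i, j)) = cons_seq (d i j) (a i j)"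
      using ij by simp
    thus "series_of (M $$ (i, j)) (Abs_fps (\<lambda>k. Matrix.mat m n (\<lambda>(i, j). cons_seq (d i j) (a i j) k) $$ (i, j)))"
      using s[OF ij] by simp
  qed
  thus "tau \<Lambda> m n (rat_mat_fun m n d a) = M" by (rule tau_eqI[OF M])
qed

lemma good_den_nonzero:
  assumes \<mu>: "good \<mu>" and t: "t \<in> P_set \<Lambda>" shows "poly (series_den \<mu>) t \<noteq> 0"
proof (cases "t = 0")
  case True
  thus ?thesis using \<mu> unfolding good_def by (simp add: poly_series_den_0)
next
  case False
  hence "1 / t \<in> S" using t unfolding P_set_def by simp
  thus ?thesis using \<mu> False unfolding good_def by (simp add: poly_series_den_inverse)
qed

lemma tau_rat_mat_fun:
  assumes a: "\<And>i j. i < m \<Longrightarrow> j < n \<Longrightarrow> regular (a i j)"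
  shows "tau \<Lambda> m n (rat_mat_fun m n d a) \<in> rational_mats m n (P_set \<Lambda>)"
    and "has_Taylor_series_at_0 (tau \<Lambda> m n (rat_mat_fun m n d a)) (\<lambda>k. (Z_minus_mat \<Lambda> ^^ k) (rat_mat_fun m n d a) 0)"
    and "\<And>i j. i < m \<Longrightarrow> j < n \<Longrightarrow>
      series_of (tau \<Lambda> m n (rat_mat_fun m n d a) $$ (i, j)) (Abs_fps (cons_seq (d i j) (a i j)))"
proof -
  define \<mu> where "\<mu> i j = (SOME \<mu>. good \<mu> \<and> recurrent \<mu> (a i j))" for i j
  have \<mu>: "good (\<mu> i j)" "recurrent (\<mu> i j) (a i j)" if "i < m" "j < n" for i j
    using someI_ex[OF a[OF that, unfolded regular_def]] unfolding \<mu>_def by simp_all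
  define M where "M = Matrix.mat m n (\<lambda>(i, j). rat_of (d i j) (\<mu> i j) (a i j))"
  have M: "M \<in> carrier_mat m n" unfolding M_def by simp
  have s: "series_of (M $$ (i, j)) (Abs_fps (cons_seq (d i j) (a i j)))" if "i < m" "j < n" for i j
    using rat_of_series[of "\<mu> i j" "a i j" "d i j"] \<mu>[OF that] that unfolding M_def good_def by simp
  have tau: "tau \<Lambda> m n (rat_mat_fun m n d a) = M" by (rule Taylor_rat_mat_fun(2)[OF a M s])
  show "tau \<Lambda> m n (rat_mat_fun m n d a) \<in> rational_mats m n (P_set \<Lambda>)"
    unfolding tau rational_mats_def mat_no_pole_at_def
    using M rat_of_no_pole[OF good_den_nonzero[OF \<mu>(1)]] by (auto simp: M_def)
  show "has_Taylor_series_at_0 (tau \<Lambda> m n (rat_mat_fun m n d a)) (\<lambda>k. (Z_minus_mat \<Lambda> ^^ k) (rat_mat_fun m n d a) 0)"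
    unfolding tau by (rule Taylor_rat_mat_fun(1)[OF a M s])
  show "series_of (tau \<Lambda> m n (rat_mat_fun m n d a) $$ (i, j)) (Abs_fps (cons_seq (d i j) (a i j)))"
    if "i < m" "j < n" for i j
    unfolding tau by (rule s[OF that])
qed

lemma realization_iff:
  "realization \<Lambda> m n l A B C D f \<longleftrightarrow>
     A \<in> carrier_mat l l \<and> B \<in> carrier_mat l n \<and> C \<in> carrier_mat m l \<and> D \<in> carrier_mat m n \<and>
     S \<inter> spectrum A = {} \<and>
     f = rat_mat_fun m n (\<lambda>i j. D $$ (i, j)) (\<lambda>i j k. (C * A ^\<^sub>m k * B) $$ (i, j))"
proof (cases "A \<in> carrier_mat l l \<and> B \<in> carrier_mat l n \<and> C \<in> carrier_mat m l \<and> D \<in> carrier_mat m n \<and>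
    S \<inter> spectrum A = {}")
  case True
  hence "(\<lambda>z\<in>V. D + C * conv_poly_right \<Lambda> (resolvent_DA \<Lambda> l A) [0\<^sub>m l n, B] z) =
      mat_fun \<Lambda> m n (\<lambda>i j. rfun (D $$ (i, j)) (\<lambda>k. (C * A ^\<^sub>m k * B) $$ (i, j)))"
    by (intro realization_function) blast+
  thus ?thesis unfolding realization_def rat_mat_fun_def by (simp only:)
qed (unfold realization_def, blast)

lemma realizationD:
  assumes "realization \<Lambda> m n l A B C D f"
  shows "A \<in> carrier_mat l l" "B \<in> carrier_mat l n" "C \<in> carrier_mat m l" "D \<in> carrier_mat m n"
    "S \<inter> spectrum A = {}"
    "f = rat_mat_fun m n (\<lambda>i j. D $$ (i, j)) (\<lambda>i j k. (C * A ^\<^sub>m k * B) $$ (i, j))"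
proof -
  note R = assms[unfolded realization_iff]
  show "A \<in> carrier_mat l l" using R by (elim conjE)
  show "B \<in> carrier_mat l n" using R by (elim conjE)
  show "C \<in> carrier_mat m l" using R by (elim conjE)
  show "D \<in> carrier_mat m n" using R by (elim conjE)
  show "S \<inter> spectrum A = {}" using R by (elim conjE)
  show "f = rat_mat_fun m n (\<lambda>i j. D $$ (i, j)) (\<lambda>i j k. (C * A ^\<^sub>m k * B) $$ (i, j))"
    using R by (elim conjE)
qed

lemma zero_notin_S: "0 \<notin> S"
  unfolding S_iff by simp

lemma rational_DA_E:
  assumes "f \<in> rational_DA \<Lambda> m n"
  obtains d a where "f = rat_mat_fun m n d a" "\<And>i j. i < m \<Longrightarrow> j < n \<Longrightarrow> regular (a i j)"
proof -
  obtain l A B C D where r: "realization \<Lambda> m n l A B C D f" using assms unfolding rational_DA_def by blast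
  show thesis
    by (rule that[OF realizationD(6)[OF r]])
      (rule regular_triple_product[OF realizationD(1,5,3,2)[OF r]])
qed

text \<open>Every matrix of regular sequences comes from a realization.\<close>

lemma rational_DA_I:
  assumes a: "\<And>i j. i < m \<Longrightarrow> j < n \<Longrightarrow> regular (a i j)"
  shows "rat_mat_fun m n d a \<in> rational_DA \<Lambda> m n"
proof -
  have "\<exists>\<mu>. good \<mu> \<and> (\<forall>i<m. \<forall>j<n. recurrent \<mu> (a i j))"
  proof (rule regular_common[of "{..<m} \<times> {..<n}" "\<lambda>(i, j). a i j"])
    show "regular (case ij of (i, j) \<Rightarrow> a i j)" if "ij \<in> {..<m} \<times> {..<n}" for ij
      using a that by auto
  qed auto
  then obtain \<nu> where \<nu>: "good \<nu>" "\<And>i j. i < m \<Longrightarrow> j < n \<Longrightarrow> recurrent \<nu> (a i j)" by blast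
  \<comment> \<open>The factor makes the degree positive and adds only the root \<open>0\<close>, which is not in \<open>S\<close>.\<close>
  define \<mu> where "\<mu> = [:0, 1:] * \<nu>"
  have "\<nu> \<noteq> 0" using \<nu>(1) unfolding good_def by simp
  hence deg: "degree \<mu> = Suc (degree \<nu>)" unfolding \<mu>_def by (subst degree_mult_eq) auto
  have "poly [:0, 1:] s \<noteq> 0" if "s \<in> S" for s :: complex
    using zero_notin_S that by auto
  hence "good [:0, 1:]" unfolding good_def by simp
  hence \<mu>: "good \<mu>" unfolding \<mu>_def using \<nu>(1) by (rule good_mult)
  define N where "N = degree \<mu>"
  have "N > 0" unfolding N_def deg by simp
  moreover have "coeff \<mu> N \<noteq> 0" using \<mu> unfolding N_def good_def by simp
  ultimately have N: "N > 0" "coeff \<mu> N \<noteq> 0" .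
  define A where "A = companion m N (coeff \<mu>)"
  define B where "B = Matrix.mat (m * N) n (\<lambda>(r, j). a (r div N) j (r mod N))"
  define C where "C = (Matrix.mat m (m * N) (\<lambda>(i, r). if r = i * N then 1 else 0) :: complex mat)"
  define D where "D = Matrix.mat m n (\<lambda>(i, j). d i j)"
  have A: "A \<in> carrier_mat (m * N) (m * N)" unfolding A_def by (rule companion_carrier[where c = "coeff \<mu>", OF N])
  have spec: "S \<inter> spectrum A = {}"
  proof -
    have "s \<notin> S" if "eigenvalue A s" for s
    proof -
      have "poly \<mu> s = 0"
        using companion_eigenvalue[where c = "coeff \<mu>", OF N, where m = m and s = s] that unfolding A_def poly_altdef N_def by simp
      thus ?thesis using \<mu> unfolding good_def by blast
    qed
    thus ?thesis unfolding spectrum_def by blast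
  qed
  have rec: "(\<Sum>e\<le>N. coeff \<mu> e * a i j (k + e)) = 0" if "i < m" "j < n" for i j k
    using recurrentD[OF recurrent_mult2[OF \<nu>(2)[OF that], of "[:0, 1:]"], of k]
    unfolding \<mu>_def[symmetric] lin_def N_def by (simp add: add.commute)
  have "(C * A ^\<^sub>m k * B) $$ (i, j) = a i j k" if "i < m" "j < n" for i j k
    unfolding A_def B_def C_def by (rule companion_realization[where c = "coeff \<mu>", OF N rec that])
  hence "rat_mat_fun m n d a = rat_mat_fun m n (\<lambda>i j. D $$ (i, j)) (\<lambda>i j k. (C * A ^\<^sub>m k * B) $$ (i, j))"
    by (intro rat_mat_fun_cong) (auto simp: D_def simp del: index_mult_mat)
  hence "realization \<Lambda> m n (m * N) A B C D (rat_mat_fun m n d a)"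
    unfolding realization_iff using A spec by (simp add: B_def C_def D_def)
  moreover have "rat_mat_fun m n d a \<in> DA_mat \<Lambda> m n"
    unfolding rat_mat_fun_def
    by (rule mat_fun_DA) (simp add: extensional_restrict[OF rfun_extensional] rfun_DA a)
  ultimately show ?thesis unfolding rational_DA_def by blast
qed

lemma Abs_fps_cons_seq_add:
  "Abs_fps (cons_seq (d + e) (\<lambda>k. a k + b k)) = Abs_fps (cons_seq d a) + Abs_fps (cons_seq e b)"
  by (rule fps_ext) (simp add: cons_seq_def split: nat.split)

lemma Abs_fps_cons_seq_scale:
  "Abs_fps (cons_seq (c * d) (\<lambda>k. c * a k)) = fps_const c * Abs_fps (cons_seq d a)"
  by (rule fps_ext) (simp add: cons_seq_def split: nat.split)

lemma tau_carrier: "(\<And>i j. i < m \<Longrightarrow> j < n \<Longrightarrow> regular (a i j)) \<Longrightarrow> tau \<Lambda> m n (rat_mat_fun m n d a) \<in> carrier_mat m n"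
  using tau_rat_mat_fun(1) unfolding rational_mats_def by blast

lemma rational_DA_add:
  assumes f: "f \<in> rational_DA \<Lambda> m n" and g: "g \<in> rational_DA \<Lambda> m n"
  shows "(\<lambda>z\<in>V. f z + g z) \<in> rational_DA \<Lambda> m n"
    and "tau \<Lambda> m n (\<lambda>z\<in>V. f z + g z) = tau \<Lambda> m n f + tau \<Lambda> m n g"
proof -
  obtain d a where f: "f = rat_mat_fun m n d a" and a: "\<And>i j. i < m \<Longrightarrow> j < n \<Longrightarrow> regular (a i j)"
    using f by (rule rational_DA_E) blast
  obtain e b where g: "g = rat_mat_fun m n e b" and b: "\<And>i j. i < m \<Longrightarrow> j < n \<Longrightarrow> regular (b i j)"
    using g by (rule rational_DA_E) blast
  let ?d = "\<lambda>i j. d i j + e i j" and ?a = "\<lambda>i j k. a i j k + b i j k"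
  have ab: "regular (?a i j)" if "i < m" "j < n" for i j by (rule regular_add[OF a[OF that] b[OF that]])
  have sum: "(\<lambda>z\<in>V. f z + g z) = rat_mat_fun m n ?d ?a"
    unfolding f g rat_mat_fun_def mat_fun_def[of \<Lambda> m n "\<lambda>i j. rfun (?d i j) (?a i j)"]
    by (rule restrict_ext, rule eq_matI) (simp_all add: rfun_add a b)
  show "(\<lambda>z\<in>V. f z + g z) \<in> rational_DA \<Lambda> m n" unfolding sum by (rule rational_DA_I[OF ab])
  note tf = tau_carrier[of m n a d, OF a] and tg = tau_carrier[of m n b e, OF b]
  show "tau \<Lambda> m n (\<lambda>z\<in>V. f z + g z) = tau \<Lambda> m n f + tau \<Lambda> m n g"
    unfolding sum unfolding f g
  proof (rule Taylor_rat_mat_fun(2)[OF ab])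
    show "tau \<Lambda> m n (rat_mat_fun m n d a) + tau \<Lambda> m n (rat_mat_fun m n e b) \<in> carrier_mat m n"
      using tf tg by simp
    fix i j assume ij: "i < m" "j < n"
    show "series_of ((tau \<Lambda> m n (rat_mat_fun m n d a) + tau \<Lambda> m n (rat_mat_fun m n e b)) $$ (i, j))
        (Abs_fps (cons_seq (?d i j) (?a i j)))"
      using series_of_add[OF tau_rat_mat_fun(3)[OF a ij] tau_rat_mat_fun(3)[OF b ij]] ij tf tg
      by (simp add: Abs_fps_cons_seq_add)
  qed
qed

lemma rational_DA_scale:
  assumes f: "f \<in> rational_DA \<Lambda> m n"
  shows "(\<lambda>z\<in>V. c \<cdot>\<^sub>m f z) \<in> rational_DA \<Lambda> m n"
    and "tau \<Lambda> m n (\<lambda>z\<in>V. c \<cdot>\<^sub>m f z) = const_fract c \<cdot>\<^sub>m tau \<Lambda> m n f"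
proof -
  obtain d a where f: "f = rat_mat_fun m n d a" and a: "\<And>i j. i < m \<Longrightarrow> j < n \<Longrightarrow> regular (a i j)"
    using f by (rule rational_DA_E) blast
  let ?d = "\<lambda>i j. c * d i j" and ?a = "\<lambda>i j k. c * a i j k"
  have ca: "regular (?a i j)" if "i < m" "j < n" for i j by (rule regular_scale[OF a[OF that]])
  have scale: "(\<lambda>z\<in>V. c \<cdot>\<^sub>m f z) = rat_mat_fun m n ?d ?a"
    unfolding f rat_mat_fun_def mat_fun_def[of \<Lambda> m n "\<lambda>i j. rfun (?d i j) (?a i j)"]
    by (rule restrict_ext, rule eq_matI) (simp_all add: rfun_scale a)
  show "(\<lambda>z\<in>V. c \<cdot>\<^sub>m f z) \<in> rational_DA \<Lambda> m n" unfolding scale by (rule rational_DA_I[OF ca])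
  note tf = tau_carrier[of m n a d, OF a]
  show "tau \<Lambda> m n (\<lambda>z\<in>V. c \<cdot>\<^sub>m f z) = const_fract c \<cdot>\<^sub>m tau \<Lambda> m n f"
    unfolding scale unfolding f
  proof (rule Taylor_rat_mat_fun(2)[OF ca])
    show "const_fract c \<cdot>\<^sub>m tau \<Lambda> m n (rat_mat_fun m n d a) \<in> carrier_mat m n" using tf by simp
    fix i j assume ij: "i < m" "j < n"
    show "series_of ((const_fract c \<cdot>\<^sub>m tau \<Lambda> m n (rat_mat_fun m n d a)) $$ (i, j))
        (Abs_fps (cons_seq (?d i j) (?a i j)))"
      using series_of_scale[OF tau_rat_mat_fun(3)[OF a ij]] ij tf
      by (simp add: Abs_fps_cons_seq_scale)
  qed
qed

lemma tau_inj: "inj_on (tau \<Lambda> m n) (rational_DA \<Lambda> m n)"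
proof (rule inj_onI)
  fix f g assume f: "f \<in> rational_DA \<Lambda> m n" and g: "g \<in> rational_DA \<Lambda> m n" and eq: "tau \<Lambda> m n f = tau \<Lambda> m n g"
  obtain d a where f: "f = rat_mat_fun m n d a" and a: "\<And>i j. i < m \<Longrightarrow> j < n \<Longrightarrow> regular (a i j)"
    using f by (rule rational_DA_E) blast
  obtain e b where g: "g = rat_mat_fun m n e b" and b: "\<And>i j. i < m \<Longrightarrow> j < n \<Longrightarrow> regular (b i j)"
    using g by (rule rational_DA_E) blast
  have cs: "cons_seq (d i j) (a i j) = cons_seq (e i j) (b i j)" if ij: "i < m" "j < n" for i j
  proof -
    have "series_of (tau \<Lambda> m n f $$ (i, j)) (Abs_fps (cons_seq (d i j) (a i j)))"
      unfolding f by (rule tau_rat_mat_fun(3)[OF a ij])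
    moreover have "series_of (tau \<Lambda> m n f $$ (i, j)) (Abs_fps (cons_seq (e i j) (b i j)))"
      unfolding eq g by (rule tau_rat_mat_fun(3)[OF b ij])
    ultimately have "Abs_fps (cons_seq (d i j) (a i j)) = Abs_fps (cons_seq (e i j) (b i j))"
      unfolding series_of_iff using has_fps_expansion_unique by blast
    thus ?thesis by (simp add: Abs_fps_inject)
  qed
  show "f = g" unfolding f g
  proof (rule rat_mat_fun_cong)
    fix i j assume ij: "i < m" "j < n"
    show "d i j = e i j" using fun_cong[OF cs[OF ij], of 0] by (simp add: cons_seq_def)
    show "a i j = b i j"
    proof
      fix k show "a i j k = b i j k" using fun_cong[OF cs[OF ij], of "Suc k"] by (simp add: cons_seq_def)
    qed
  qed
qed

text \<open>If the denominator has no zero in \<open>P(\<Lambda>)\<close>, the polynomial of its reversed coefficients has no root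
  in \<open>S(\<Lambda>)\<close>.\<close>

lemma Taylor_coefficients_regular:
  assumes F: "F * fps_of_poly q = fps_of_poly p" and q: "\<forall>t\<in>P_set \<Lambda>. poly q t \<noteq> 0"
  shows "regular (\<lambda>k. fps_nth F (Suc k))"
proof -
  \<comment> \<open>With this \<open>N\<close> the recurrence holds from the coefficient of order \<open>1\<close> on.\<close>
  define N where "N = max (degree p) (degree q)"
  define \<mu> where "\<mu> = (\<Sum>j\<le>degree q. monom (coeff q j) (N - j))"
  have qN: "degree q \<le> N" unfolding N_def by simp
  have q0: "coeff q 0 \<noteq> 0" using q unfolding P_set_def by (simp flip: poly_0_coeff_0)
  have "coeff \<mu> N = (\<Sum>j\<le>degree q. if j = 0 then coeff q j else 0)"
    unfolding \<mu>_def coeff_sum by (rule sum.cong) (use qN in auto)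
  hence "coeff \<mu> N \<noteq> 0" using q0 by simp
  hence \<mu>0: "\<mu> \<noteq> 0" by auto
  have "poly \<mu> s \<noteq> 0" if s: "s \<in> S" for s
  proof -
    have s0: "s \<noteq> 0" using s zero_notin_S by auto
    have "poly \<mu> s = s ^ N * poly q (1 / s)"
      unfolding \<mu>_def poly_sum poly_monom poly_altdef[of q] sum_distrib_left
    proof (rule sum.cong[OF refl])
      fix j assume "j \<in> {..degree q}"
      hence "j \<le> N" using qN by simp
      thus "coeff q j * s ^ (N - j) = s ^ N * (coeff q j * (1 / s) ^ j)"
        using s0 by (simp add: power_diff field_simps)
    qed
    moreover have "1 / s \<in> P_set \<Lambda>" using s unfolding P_set_def by simp
    ultimately show ?thesis using q s0 by simp
  qed
  hence good: "good \<mu>" unfolding good_def using \<mu>0 by blast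
  have "recurrent \<mu> (\<lambda>k. fps_nth F (Suc k))"
    unfolding recurrent_def
  proof
    fix k
    have lin_sum: "lin b (\<Sum>j\<le>r. f j) = (\<Sum>j\<le>r. lin b (f j))" for b f and r :: nat
      by (induction r) (simp_all add: lin_add)
    have lin_monom: "lin b (monom c r) = c * b r" for b c r
    proof -
      have "lin b (monom c r) = (\<Sum>i\<le>r. if i = r then c * b i else 0)"
        unfolding lin_bound[OF degree_monom_le] by (rule sum.cong) auto
      thus ?thesis by simp
    qed
    have "lin (\<lambda>e. fps_nth F (Suc (e + k))) \<mu> = (\<Sum>j\<le>degree q. coeff q j * fps_nth F (Suc (N - j + k)))"
      unfolding \<mu>_def lin_sum lin_monom ..
    also have "\<dots> = (\<Sum>j\<le>degree q. coeff q j * fps_nth F (Suc (N + k) - j))"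
      by (rule sum.cong) (use qN in \<open>auto simp: Suc_diff_le add.commute\<close>)
    also have "\<dots> = (\<Sum>j=0..Suc (N + k). coeff q j * fps_nth F (Suc (N + k) - j))"
      by (rule sum.mono_neutral_left) (use qN in \<open>auto simp: coeff_eq_0\<close>)
    also have "\<dots> = fps_nth (fps_of_poly q * F) (Suc (N + k))" by (simp add: fps_mult_nth)
    also have "\<dots> = coeff p (Suc (N + k))" using F by (simp add: mult.commute)
    also have "\<dots> = 0" by (rule coeff_eq_0) (simp add: N_def less_Suc_eq_le max.coboundedI1 trans_le_add1)
    finally show "lin (\<lambda>e. fps_nth F (Suc (e + k))) \<mu> = 0" .
  qed
  thus ?thesis unfolding regular_def using good by blast
qed

lemma tau_surj:
  assumes M: "M \<in> rational_mats m n (P_set \<Lambda>)"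
  shows "M \<in> tau \<Lambda> m n ` rational_DA \<Lambda> m n"
proof -
  have Mc: "M \<in> carrier_mat m n" using M unfolding rational_mats_def by simp
  have "\<exists>F. series_of (M $$ (i, j)) F \<and> regular (\<lambda>k. fps_nth F (Suc k))" if ij: "i < m" "j < n" for i j
  proof -
    have "\<forall>t\<in>P_set \<Lambda>. no_pole_at (M $$ (i, j)) t"
      using M Mc ij unfolding rational_mats_def mat_no_pole_at_def by auto
    then obtain p q where pq: "M $$ (i, j) = Fraction_Field.Fract p q" "\<forall>t\<in>P_set \<Lambda>. poly q t \<noteq> 0"
      using no_pole_reduced by blast
    have q0: "poly q 0 \<noteq> 0" using pq(2) unfolding P_set_def by simp
    define F where "F = fps_of_poly p * inverse (fps_of_poly q)"
    have "fps_nth (fps_of_poly q) 0 \<noteq> 0" using q0 by (simp add: poly_0_coeff_0)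
    hence F: "F * fps_of_poly q = fps_of_poly p"
      unfolding F_def using inverse_mult_eq_1[of "fps_of_poly q"] by (simp add: mult.assoc)
    have "series_of (M $$ (i, j)) F" unfolding series_of_def using pq(1) q0 F by blast
    thus ?thesis using Taylor_coefficients_regular[OF F pq(2)] by blast
  qed
  then obtain F where F: "\<And>i j. i < m \<Longrightarrow> j < n \<Longrightarrow> series_of (M $$ (i, j)) (F i j)"
    "\<And>i j. i < m \<Longrightarrow> j < n \<Longrightarrow> regular (\<lambda>k. fps_nth (F i j) (Suc k))" by metis
  let ?d = "\<lambda>i j. fps_nth (F i j) 0" and ?a = "\<lambda>i j k. fps_nth (F i j) (Suc k)"
  have "Abs_fps (cons_seq (?d i j) (?a i j)) = F i j" for i j
    by (rule fps_ext) (simp add: cons_seq_def split: nat.split)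
  hence "tau \<Lambda> m n (rat_mat_fun m n ?d ?a) = M"
    by (intro Taylor_rat_mat_fun(2)[OF F(2) Mc]) (simp_all add: F(1))
  thus ?thesis using rational_DA_I[of m n ?a ?d, OF F(2)] by blast
qed

lemma tau_bij: "bij_betw (tau \<Lambda> m n) (rational_DA \<Lambda> m n) (rational_mats m n (P_set \<Lambda>))"
  unfolding bij_betw_def
proof (intro conjI equalityI subsetI)
  show "inj_on (tau \<Lambda> m n) (rational_DA \<Lambda> m n)" by (rule tau_inj)
  fix M assume "M \<in> tau \<Lambda> m n ` rational_DA \<Lambda> m n"
  then obtain f where f: "f \<in> rational_DA \<Lambda> m n" "M = tau \<Lambda> m n f" by blast
  obtain d a where "f = rat_mat_fun m n d a" "\<And>i j. i < m \<Longrightarrow> j < n \<Longrightarrow> regular (a i j)"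
    using f(1) by (rule rational_DA_E) blast
  thus "M \<in> rational_mats m n (P_set \<Lambda>)" using tau_rat_mat_fun(1)[of m n a d] f(2) by simp
qed (rule tau_surj)

lemma tau_Taylor:
  assumes "f \<in> rational_DA \<Lambda> m n"
  shows "has_Taylor_series_at_0 (tau \<Lambda> m n f) (\<lambda>k. (Z_minus_mat \<Lambda> ^^ k) f 0)"
proof -
  obtain d a where f: "f = rat_mat_fun m n d a" and a: "\<And>i j. i < m \<Longrightarrow> j < n \<Longrightarrow> regular (a i j)"
    using assms by (rule rational_DA_E) blast
  show ?thesis unfolding f by (rule tau_rat_mat_fun(2)[OF a])
qed

lemma tau_realization:
  assumes r: "realization \<Lambda> m n l A B C D f" and inv: "invertible_mat (1\<^sub>m l - t \<cdot>\<^sub>m A)"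
  shows "mat_no_pole_at (tau \<Lambda> m n f) t"
    and "mat_eval (tau \<Lambda> m n f) t = D + t \<cdot>\<^sub>m (C * the (mat_inverse (1\<^sub>m l - t \<cdot>\<^sub>m A)) * B)"
proof -
  note A = realizationD(1)[OF r] and B = realizationD(2)[OF r] and C = realizationD(3)[OF r]
    and D = realizationD(4)[OF r] and S = realizationD(5)[OF r] and f = realizationD(6)[OF r]
  define M where "M = Matrix.mat m n (\<lambda>(i, j). rat_of (D $$ (i, j)) (char_poly A) (\<lambda>k. (C * A ^\<^sub>m k * B) $$ (i, j)))"
  have Mc: "M \<in> carrier_mat m n" unfolding M_def by simp
  have cp: "char_poly A \<noteq> 0" using good_char_poly[OF A S] unfolding good_def by simp
  have tau: "tau \<Lambda> m n f = M"
    unfolding f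
  proof (rule Taylor_rat_mat_fun(2)[OF _ Mc])
    fix i j assume ij: "i < m" "j < n"
    show "regular (\<lambda>k. (C * A ^\<^sub>m k * B) $$ (i, j))" by (rule regular_triple_product[OF A S C B ij])
    show "series_of (M $$ (i, j)) (Abs_fps (cons_seq (D $$ (i, j)) (\<lambda>k. (C * A ^\<^sub>m k * B) $$ (i, j))))"
      using rat_of_series[OF cp recurrent_triple_product[OF A C B ij]] ij unfolding M_def
      by (simp del: index_mult_mat)
  qed
  have den: "poly (series_den (char_poly A)) t \<noteq> 0" by (rule series_den_char_poly_nonzero[OF A inv])
  show "mat_no_pole_at (tau \<Lambda> m n f) t"
    unfolding tau mat_no_pole_at_def M_def by (simp add: rat_of_no_pole[OF den] del: index_mult_mat)
  have Y: "the (mat_inverse (1\<^sub>m l - t \<cdot>\<^sub>m A)) \<in> carrier_mat l l"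
    by (rule mat_inverse_invertible(1)[OF _ inv]) (use A in \<open>simp add: minus_carrier_mat\<close>)
  define W where "W = C * the (mat_inverse (1\<^sub>m l - t \<cdot>\<^sub>m A)) * B"
  have W: "W \<in> carrier_mat m n" unfolding W_def by (rule mult_carrier_mat[OF mult_carrier_mat[OF C Y] B])
  have entry: "rat_eval (M $$ (i, j)) t = D $$ (i, j) + t * W $$ (i, j)" if ij: "i < m" "j < n" for i j
    using rat_of_state_space_eval[OF A C B ij inv, of "D $$ (i, j)"] ij
    unfolding M_def W_def[symmetric] by (simp del: index_mult_mat)
  show "mat_eval (tau \<Lambda> m n f) t = D + t \<cdot>\<^sub>m (C * the (mat_inverse (1\<^sub>m l - t \<cdot>\<^sub>m A)) * B)"
    unfolding tau mat_eval_def W_def[symmetric]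
    by (rule eq_matI) (use W D Mc entry in auto)
qed

end


theorem theorem5p6:
  fixes \<Lambda> :: "complex set set" and m n :: nat
  assumes lattice: "rhombic_lattice \<Lambda>"
    and zero_vertex: "0 \<in> verts \<Lambda>"
    and reachable: "unit_step_reachable \<Lambda>"
    and no_eigenvalue: "\<forall>t\<in>S_set \<Lambda>. \<not> Z_minus_eigenvalue \<Lambda> t"
  shows
    "(\<forall>f\<in>rational_DA \<Lambda> m n. has_Taylor_series_at_0 (tau \<Lambda> m n f) (\<lambda>k. (Z_minus_mat \<Lambda> ^^ k) f 0)) \<and>
     (\<forall>f\<in>rational_DA \<Lambda> m n. \<forall>g\<in>rational_DA \<Lambda> m n.
        (\<lambda>z\<in>verts \<Lambda>. f z + g z) \<in> rational_DA \<Lambda> m n \<and>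
        tau \<Lambda> m n (\<lambda>z\<in>verts \<Lambda>. f z + g z) = tau \<Lambda> m n f + tau \<Lambda> m n g) \<and>
     (\<forall>c. \<forall>f\<in>rational_DA \<Lambda> m n.
        (\<lambda>z\<in>verts \<Lambda>. c \<cdot>\<^sub>m f z) \<in> rational_DA \<Lambda> m n \<and>
        tau \<Lambda> m n (\<lambda>z\<in>verts \<Lambda>. c \<cdot>\<^sub>m f z) = const_fract c \<cdot>\<^sub>m tau \<Lambda> m n f) \<and>
     bij_betw (tau \<Lambda> m n) (rational_DA \<Lambda> m n) (rational_mats m n (P_set \<Lambda>)) \<and>
     (\<forall>f\<in>rational_DA \<Lambda> m n. \<forall>l A B C D. realization \<Lambda> m n l A B C D f \<longrightarrow>
        (\<forall>t. invertible_mat (1\<^sub>m l - t \<cdot>\<^sub>m A) \<longrightarrow>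
           mat_no_pole_at (tau \<Lambda> m n f) t \<and>
           mat_eval (tau \<Lambda> m n f) t = D + t \<cdot>\<^sub>m (C * the (mat_inverse (1\<^sub>m l - t \<cdot>\<^sub>m A)) * B)))"
proof -
  interpret rooted_reachable_tiling \<Lambda>
    by unfold_locales (fact lattice zero_vertex reachable)+
  show ?thesis
    by (intro conjI ballI allI impI)
      (rule tau_Taylor rational_DA_add rational_DA_scale tau_bij tau_realization; assumption)+
qed

end
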